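(* The theory $\mathsf{ACA}_0^\omega+\mathsf{QF\text{-}AC}^{0,1}+\Sigma\text{-}\mathsf{IND}$ proves that $\mathsf{BOOT}$ is equivalent to the following statement: for all cwos $(A,\preceq_A)$ and $(B,\preceq_B)$ with $A,B\subset\mathbb{R}$, the former order is order-isomorphic to the latter or to an initial segment of the latter, or vice versa (the latter is order-isomorphic to the former or to an initial segment of the former).
   Context: Base theory. $\mathsf{RCA}_0^\omega$ is Kohlenbach's base theory of higher-order Reverse Mathematics: the language of all finite types, with primitive recursion on $\mathbb{N}$ (type-$0$ recursor), combinators/$\lambda$-abstraction, the axiom of extensionality, quantifier-free induction, and quantifier-free choice $\mathsf{QF\text{-}AC}^{1,0}$ (if $(\forall f\in\mathbb{N}^\mathbb{N})(\exists n\in\mathbb{N})\varphi(f,n)$ with $\varphi$ quantifier-free, then some $Y:\mathbb{N}^\mathbb{N}\to\mathbb{N}$ satisfies $(\forall f)\varphi(f,Y(f))$). $\mathsf{ACA}_0^\omega$ is $\mathsf{RCA}_0^\omega$ plus $(\exists^2)$: there is $E:\mathbb{N}^\mathbb{N}\to\{0,1\}$ with $E(f)=0\leftrightarrow(\exists n\in\mathbb{N})(f(n)=0)$ for all $f\in\mathbb{N}^\mathbb{N}$. $\mathsf{QF\text{-}AC}^{0,1}$: for quantifier-free $\varphi$ (parameters of any type allowed), if $(\forall n\in\mathbb{N})(\exists f\in\mathbb{N}^\mathbb{N})\varphi(f,n)$, then there is a sequence $(f_n)_{n\in\mathbb{N}}$ in $\mathbb{N}^\mathbb{N}$ with $(\forall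 n)\varphi(f_n,n)$. $\Sigma\text{-}\mathsf{IND}$: the induction axiom for formulas $\varphi(n)$ of the form $(\exists f\in\mathbb{N}^\mathbb{N})(Y(f,n)=0)$, for any $Y:\mathbb{N}^\mathbb{N}\times\mathbb{N}\to\mathbb{N}$. $\mathsf{BOOT}$: for every $Y:\mathbb{N}^\mathbb{N}\times\mathbb{N}\to\mathbb{N}$ there is $X\subset\mathbb{N}$ such that for all $n\in\mathbb{N}$: $n\in X\leftrightarrow(\exists f\in\mathbb{N}^\mathbb{N})(Y(f,n)=0)$. Reals and sets. Reals are represented by fast-converging Cauchy sequences of rationals (elements of $\mathbb{N}^\mathbb{N}$ up to coding); $x=_{\mathbb{R}}y$ means the sequences have the same limit. Functions defined on $\mathbb{R}$ (or $\mathbb{R}^2$) are mappings on representations sending $=_{\mathbb{R}}$-equal inputs to equal outputs. A set $X\subset\mathbb{R}$ is given by a characteristic function $F:\mathbb{R}\to\{0,1\}$. Orders. A linear order $(X,\preceq_X)$ has $\preceq_X$ given by a characteristic function; it is transitive, connex, and anti-symmetric relative to the associated equivalence relation $=_X$ on $X$, where $x=_Xy$ holds iff $x\preceq_Xy$ and $y\preceq_Xx$ (so $=_X$ may be coarser than $=_{\mathbb{R}}$). Write $x\prec_Xy$ for $x\preceq_Xy\wedge x\neq_Xy$. A well-ordering is a linear order with no strictly descending sequence, i.e. no $(x_n)_{n\in\mathbb{N}}$ in $X$ with $x_{n+1}\prec_Xx_n$ for all $n$. A cwo is a well-ordering $(X,\preceq_X)$ for which there is a mapping $Y$ into $\mathbb{N}$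 (defined on $\mathbb{R}$ for $X\subset\mathbb{R}$) with $(\forall x,y\in X)(Y(x)=Y(y)\to x=_Xy)$. An initial segment of $(X,\preceq_X)$ is a set of the form $\{x\in X:x\prec_Xx_0\}$ with $x_0\in X$. An order-isomorphism from $(X,\preceq_X)$ to $(W,\preceq_W)$ is a mapping $Z:X\to W$ that is surjective (for each $w\in W$ there is $x\in X$ with $Z(x)=_Ww$) and satisfies $x\preceq_Xx'\leftrightarrow Z(x)\preceq_WZ(x')$ for all $x,x'\in X$; "$X$ is order-isomorphic to $W$" means such a $Z$ exists. *)

theory Defs
  imports Main
begin

section \<open>Terms and formulas of higher-order arithmetic\<close>

datatype ty = N | Fn ty ty  (infixr "\<rightarrow>" 70)

text \<open>
  The term language is Kohlenbach's: zero, successor, the type-0 recursor, and the typed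
  combinators K (Pi) and S (Sigma), by which lambda abstraction is definable; hence terms have no
  binders. The only primitive relation is equality of type-0 objects.

  Variables carry their sort, and de Bruijn indices are counted separately for each sort:
  \<open>ForallB \<sigma> \<phi>\<close> binds \<open>Var \<sigma> 0\<close> in \<open>\<phi>\<close>, shifts the other variables of sort \<open>\<sigma>\<close> by one,
  and leaves the indices of the variables of all other sorts unchanged.
\<close>

datatype tm =
    Var ty nat
  | Zero
  | Succ
  | Rec0
  | CombK ty ty
  | CombS ty ty ty
  | App tm tm  (infixl "\<cdot>" 100)

datatype fm =
    Eq tm tm  (infix "\<doteq>" 62)
  | Falsum
  | Imp fm fm  (infixr "\<^bold>\<longrightarrow>" 55)
  | ForallB ty fm

inductive has_type :: "tm \<Rightarrow> ty \<Rightarrow> bool" where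
  "has_type (Var \<sigma> n) \<sigma>"
| "has_type Zero N"
| "has_type Succ (N \<rightarrow> N)"
| "has_type Rec0 ((N \<rightarrow> N \<rightarrow> N) \<rightarrow> N \<rightarrow> N \<rightarrow> N)"
| "has_type (CombK \<rho> \<tau>) (\<rho> \<rightarrow> \<tau> \<rightarrow> \<rho>)"
| "has_type (CombS \<delta> \<rho> \<tau>) ((\<delta> \<rightarrow> \<rho> \<rightarrow> \<tau>) \<rightarrow> (\<delta> \<rightarrow> \<rho>) \<rightarrow> \<delta> \<rightarrow> \<tau>)"
| "has_type s (\<sigma> \<rightarrow> \<tau>) \<Longrightarrow> has_type t \<sigma> \<Longrightarrow> has_type (s \<cdot> t) \<tau>"

primrec wf_fm :: "fm \<Rightarrow> bool" where
  "wf_fm (s \<doteq> t) = (has_type s N \<and> has_type t N)"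
| "wf_fm Falsum = True"
| "wf_fm (\<phi> \<^bold>\<longrightarrow> \<psi>) = (wf_fm \<phi> \<and> wf_fm \<psi>)"
| "wf_fm (ForallB \<sigma> \<phi>) = wf_fm \<phi>"

primrec quantifier_free :: "fm \<Rightarrow> bool" where
  "quantifier_free (s \<doteq> t) = True"
| "quantifier_free Falsum = True"
| "quantifier_free (\<phi> \<^bold>\<longrightarrow> \<psi>) = (quantifier_free \<phi> \<and> quantifier_free \<psi>)"
| "quantifier_free (ForallB \<sigma> \<phi>) = False"

definition Neg :: "fm \<Rightarrow> fm"  ("\<^bold>\<not> _" [59] 59) where
  "\<^bold>\<not> \<phi> = (\<phi> \<^bold>\<longrightarrow> Falsum)"

definition Or :: "fm \<Rightarrow> fm \<Rightarrow> fm"  (infixr "\<^bold>\<or>" 56) where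
  "\<phi> \<^bold>\<or> \<psi> = (\<^bold>\<not> \<phi> \<^bold>\<longrightarrow> \<psi>)"

definition And :: "fm \<Rightarrow> fm \<Rightarrow> fm"  (infixr "\<^bold>\<and>" 57) where
  "\<phi> \<^bold>\<and> \<psi> = \<^bold>\<not> (\<phi> \<^bold>\<longrightarrow> \<^bold>\<not> \<psi>)"

definition Iff :: "fm \<Rightarrow> fm \<Rightarrow> fm"  (infix "\<^bold>\<longleftrightarrow>" 54) where
  "(\<phi> \<^bold>\<longleftrightarrow> \<psi>) = ((\<phi> \<^bold>\<longrightarrow> \<psi>) \<^bold>\<and> (\<psi> \<^bold>\<longrightarrow> \<phi>))"


section \<open>Substitution and binding\<close>

type_synonym substitution = "ty \<Rightarrow> nat \<Rightarrow> tm"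

primrec subst_tm :: "substitution \<Rightarrow> tm \<Rightarrow> tm" where
  "subst_tm \<theta> (Var \<sigma> n) = \<theta> \<sigma> n"
| "subst_tm \<theta> Zero = Zero"
| "subst_tm \<theta> Succ = Succ"
| "subst_tm \<theta> Rec0 = Rec0"
| "subst_tm \<theta> (CombK \<rho> \<tau>) = CombK \<rho> \<tau>"
| "subst_tm \<theta> (CombS \<delta> \<rho> \<tau>) = CombS \<delta> \<rho> \<tau>"
| "subst_tm \<theta> (s \<cdot> t) = subst_tm \<theta> s \<cdot> subst_tm \<theta> t"

definition shift :: "ty \<Rightarrow> substitution" where
  "shift \<sigma> = (\<lambda>\<tau> n. if \<tau> = \<sigma> then Var \<sigma> (Suc n) else Var \<tau> n)"

definition under :: "ty \<Rightarrow> substitution \<Rightarrow> substitution" where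
  "under \<sigma> \<theta> = (\<lambda>\<tau> n.
     if \<tau> = \<sigma> then (case n of 0 \<Rightarrow> Var \<sigma> 0 | Suc k \<Rightarrow> subst_tm (shift \<sigma>) (\<theta> \<sigma> k))
     else subst_tm (shift \<sigma>) (\<theta> \<tau> n))"

primrec subst_fm :: "substitution \<Rightarrow> fm \<Rightarrow> fm" where
  "subst_fm \<theta> (s \<doteq> t) = (subst_tm \<theta> s \<doteq> subst_tm \<theta> t)"
| "subst_fm \<theta> Falsum = Falsum"
| "subst_fm \<theta> (\<phi> \<^bold>\<longrightarrow> \<psi>) = (subst_fm \<theta> \<phi> \<^bold>\<longrightarrow> subst_fm \<theta> \<psi>)"
| "subst_fm \<theta> (ForallB \<sigma> \<phi>) = ForallB \<sigma> (subst_fm (under \<sigma> \<theta>) \<phi>)"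

text \<open>\<open>inst \<sigma> t \<phi>\<close> is the instance at \<open>t\<close> of the body \<open>\<phi>\<close> of \<open>ForallB \<sigma> \<phi>\<close>.\<close>

definition inst :: "ty \<Rightarrow> tm \<Rightarrow> fm \<Rightarrow> fm" where
  "inst \<sigma> t = subst_fm (\<lambda>\<tau> n.
     if \<tau> = \<sigma> then (case n of 0 \<Rightarrow> t | Suc k \<Rightarrow> Var \<sigma> k) else Var \<tau> n)"

text \<open>
  Named view of free variables: \<open>replace \<sigma> k t \<phi>\<close> substitutes \<open>t\<close> for the free variable
  \<open>Var \<sigma> k\<close>, while \<open>ForallV \<sigma> k \<phi>\<close> and \<open>ExistsV \<sigma> k \<phi>\<close> quantify over that variable.
\<close>

definition replace :: "ty \<Rightarrow> nat \<Rightarrow> tm \<Rightarrow> fm \<Rightarrow> fm" where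
  "replace \<sigma> k t = subst_fm (\<lambda>\<tau> n. if \<tau> = \<sigma> \<and> n = k then t else Var \<tau> n)"

definition ForallV :: "ty \<Rightarrow> nat \<Rightarrow> fm \<Rightarrow> fm" where
  "ForallV \<sigma> k \<phi> = ForallB \<sigma> (subst_fm (\<lambda>\<tau> n.
     if \<tau> = \<sigma> then (if n = k then Var \<sigma> 0 else Var \<sigma> (Suc n)) else Var \<tau> n) \<phi>)"

definition ExistsV :: "ty \<Rightarrow> nat \<Rightarrow> fm \<Rightarrow> fm" where
  "ExistsV \<sigma> k \<phi> = \<^bold>\<not> ForallV \<sigma> k (\<^bold>\<not> \<phi>)"

text \<open>An index that exceeds those of all variables occurring in the term or formula.\<close>

primrec fresh_tm :: "tm \<Rightarrow> nat" where
  "fresh_tm (Var \<sigma> n) = Suc n"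
| "fresh_tm Zero = 0"
| "fresh_tm Succ = 0"
| "fresh_tm Rec0 = 0"
| "fresh_tm (CombK \<rho> \<tau>) = 0"
| "fresh_tm (CombS \<delta> \<rho> \<tau>) = 0"
| "fresh_tm (s \<cdot> t) = max (fresh_tm s) (fresh_tm t)"

primrec fresh :: "fm \<Rightarrow> nat" where
  "fresh (s \<doteq> t) = max (fresh_tm s) (fresh_tm t)"
| "fresh Falsum = 0"
| "fresh (\<phi> \<^bold>\<longrightarrow> \<psi>) = max (fresh \<phi>) (fresh \<psi>)"
| "fresh (ForallB \<sigma> \<phi>) = fresh \<phi>"

text \<open>
  Quantifiers for writing concrete formulas: the bound variable of \<open>Forall \<sigma> (\<lambda>x. \<phi> x)\<close> is given
  a name that does not occur in \<open>\<phi>\<close>, so that no capture can occur. The argument \<open>Zero\<close> only serves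
  as a variable-free dummy for finding such a name, which disappears in \<open>ForallV\<close>.
\<close>

definition Forall :: "ty \<Rightarrow> (tm \<Rightarrow> fm) \<Rightarrow> fm" where
  "Forall \<sigma> \<phi> = (let k = fresh (\<phi> Zero) in ForallV \<sigma> k (\<phi> (Var \<sigma> k)))"

definition Exists :: "ty \<Rightarrow> (tm \<Rightarrow> fm) \<Rightarrow> fm" where
  "Exists \<sigma> \<phi> = \<^bold>\<not> Forall \<sigma> (\<lambda>x. \<^bold>\<not> \<phi> x)"


section \<open>Provability: classical many-sorted natural deduction\<close>

text \<open>
  \<open>proves T \<Gamma> \<phi>\<close>: derivability of \<open>\<phi>\<close> from the axioms \<open>T\<close> under the assumptions \<open>\<Gamma>\<close>. The
  eigenvariable condition of generalization concerns \<open>\<Gamma>\<close> only, so free variables of axioms are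
  understood universally.
\<close>

inductive proves :: "fm set \<Rightarrow> fm set \<Rightarrow> fm \<Rightarrow> bool" for T :: "fm set" where
  Axiom: "\<phi> \<in> T \<Longrightarrow> proves T \<Gamma> \<phi>"
| Assumption: "\<phi> \<in> \<Gamma> \<Longrightarrow> proves T \<Gamma> \<phi>"
| ImpI: "wf_fm \<phi> \<Longrightarrow> proves T (insert \<phi> \<Gamma>) \<psi> \<Longrightarrow> proves T \<Gamma> (\<phi> \<^bold>\<longrightarrow> \<psi>)"
| ImpE: "proves T \<Gamma> (\<phi> \<^bold>\<longrightarrow> \<psi>) \<Longrightarrow> proves T \<Gamma> \<phi> \<Longrightarrow> proves T \<Gamma> \<psi>"
| Classical: "wf_fm \<phi> \<Longrightarrow> proves T (insert (\<^bold>\<not> \<phi>) \<Gamma>) Falsum \<Longrightarrow> proves T \<Gamma> \<phi>"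
| ForallI: "proves T (subst_fm (shift \<sigma>) ` \<Gamma>) \<phi> \<Longrightarrow> proves T \<Gamma> (ForallB \<sigma> \<phi>)"
| ForallE: "proves T \<Gamma> (ForallB \<sigma> \<phi>) \<Longrightarrow> has_type t \<sigma> \<Longrightarrow> proves T \<Gamma> (inst \<sigma> t \<phi>)"
| EqRefl: "has_type t N \<Longrightarrow> proves T \<Gamma> (t \<doteq> t)"
| EqSubst: "wf_fm \<phi> \<Longrightarrow> proves T \<Gamma> (s \<doteq> t) \<Longrightarrow> proves T \<Gamma> (inst N s \<phi>)
    \<Longrightarrow> proves T \<Gamma> (inst N t \<phi>)"


section \<open>The axiom systems\<close>

abbreviation ty1 :: ty where "ty1 \<equiv> N \<rightarrow> N"
abbreviation ty2 :: ty where "ty2 \<equiv> ty1 \<rightarrow> N"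

abbreviation one :: tm where "one \<equiv> Succ \<cdot> Zero"

primrec eq_at :: "ty \<Rightarrow> tm \<Rightarrow> tm \<Rightarrow> fm" where
  "eq_at N s t = (s \<doteq> t)"
| "eq_at (\<sigma> \<rightarrow> \<tau>) s t = Forall \<sigma> (\<lambda>x. eq_at \<tau> (s \<cdot> x) (t \<cdot> x))"

inductive_set RCA0\<omega> :: "fm set" where
  Succ_nonzero: "Forall N (\<lambda>m. \<^bold>\<not> Succ \<cdot> m \<doteq> Zero) \<in> RCA0\<omega>"
| Succ_inj: "Forall N (\<lambda>m. Forall N (\<lambda>n. Succ \<cdot> m \<doteq> Succ \<cdot> n \<^bold>\<longrightarrow> m \<doteq> n)) \<in> RCA0\<omega>"
| CombK: "Forall \<rho> (\<lambda>x. Forall \<tau> (\<lambda>y. eq_at \<rho> (CombK \<rho> \<tau> \<cdot> x \<cdot> y) x)) \<in> RCA0\<omega>"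
| CombS: "Forall (\<delta> \<rightarrow> \<rho> \<rightarrow> \<tau>) (\<lambda>x. Forall (\<delta> \<rightarrow> \<rho>) (\<lambda>y. Forall \<delta> (\<lambda>z.
    eq_at \<tau> (CombS \<delta> \<rho> \<tau> \<cdot> x \<cdot> y \<cdot> z) (x \<cdot> z \<cdot> (y \<cdot> z))))) \<in> RCA0\<omega>"
| Rec0_Zero: "Forall (N \<rightarrow> N \<rightarrow> N) (\<lambda>f. Forall N (\<lambda>m. Rec0 \<cdot> f \<cdot> m \<cdot> Zero \<doteq> m)) \<in> RCA0\<omega>"
| Rec0_Succ: "Forall (N \<rightarrow> N \<rightarrow> N) (\<lambda>f. Forall N (\<lambda>m. Forall N (\<lambda>n.
    Rec0 \<cdot> f \<cdot> m \<cdot> (Succ \<cdot> n) \<doteq> f \<cdot> n \<cdot> (Rec0 \<cdot> f \<cdot> m \<cdot> n)))) \<in> RCA0\<omega>"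
| Extensionality: "Forall (\<rho> \<rightarrow> \<tau>) (\<lambda>f. Forall \<rho> (\<lambda>x. Forall \<rho> (\<lambda>y.
    eq_at \<rho> x y \<^bold>\<longrightarrow> eq_at \<tau> (f \<cdot> x) (f \<cdot> y)))) \<in> RCA0\<omega>"
| QF_IND: "wf_fm \<phi> \<Longrightarrow> quantifier_free \<phi> \<Longrightarrow>
    replace N n Zero \<phi> \<^bold>\<and> ForallV N n (\<phi> \<^bold>\<longrightarrow> replace N n (Succ \<cdot> Var N n) \<phi>)
    \<^bold>\<longrightarrow> ForallV N n \<phi> \<in> RCA0\<omega>"
| QF_AC_1_0: "wf_fm \<phi> \<Longrightarrow> quantifier_free \<phi> \<Longrightarrow> fresh \<phi> \<le> Y \<Longrightarrow>
    ForallV ty1 f (ExistsV N n \<phi>)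
    \<^bold>\<longrightarrow> ExistsV ty2 Y (ForallV ty1 f (replace N n (Var ty2 Y \<cdot> Var ty1 f) \<phi>)) \<in> RCA0\<omega>"

definition exists2 :: fm where
  "exists2 = Exists ty2 (\<lambda>E. Forall ty1 (\<lambda>f.
     (E \<cdot> f \<doteq> Zero \<^bold>\<or> E \<cdot> f \<doteq> one) \<^bold>\<and>
     (E \<cdot> f \<doteq> Zero \<^bold>\<longleftrightarrow> Exists N (\<lambda>n. f \<cdot> n \<doteq> Zero))))"

definition ACA0\<omega> :: "fm set" where
  "ACA0\<omega> = insert exists2 RCA0\<omega>"

definition QF_AC_0_1 :: "fm set" where
  "QF_AC_0_1 =
     {ForallV N n (ExistsV ty1 f \<phi>)
      \<^bold>\<longrightarrow> ExistsV (N \<rightarrow> ty1) F (ForallV N n (replace ty1 f (Var (N \<rightarrow> ty1) F \<cdot> Var N n) \<phi>))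
      | \<phi> n f F. wf_fm \<phi> \<and> quantifier_free \<phi> \<and> fresh \<phi> \<le> F}"

text \<open>Functions \<open>Y\<close> on a product are curried.\<close>

definition Sigma_IND :: fm where
  "Sigma_IND = Forall (ty1 \<rightarrow> N \<rightarrow> N) (\<lambda>Y.
     Exists ty1 (\<lambda>f. Y \<cdot> f \<cdot> Zero \<doteq> Zero) \<^bold>\<and>
     Forall N (\<lambda>n. Exists ty1 (\<lambda>f. Y \<cdot> f \<cdot> n \<doteq> Zero)
       \<^bold>\<longrightarrow> Exists ty1 (\<lambda>f. Y \<cdot> f \<cdot> (Succ \<cdot> n) \<doteq> Zero))
     \<^bold>\<longrightarrow> Forall N (\<lambda>n. Exists ty1 (\<lambda>f. Y \<cdot> f \<cdot> n \<doteq> Zero)))"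

text \<open>A subset \<open>X\<close> of the natural numbers is given by its 0/1-valued characteristic function.\<close>

definition BOOT :: fm where
  "BOOT = Forall (ty1 \<rightarrow> N \<rightarrow> N) (\<lambda>Y. Exists ty1 (\<lambda>X. Forall N (\<lambda>n.
     (X \<cdot> n \<doteq> Zero \<^bold>\<or> X \<cdot> n \<doteq> one) \<^bold>\<and>
     (X \<cdot> n \<doteq> one \<^bold>\<longleftrightarrow> Exists ty1 (\<lambda>f. Y \<cdot> f \<cdot> n \<doteq> Zero)))))"


section \<open>Arithmetic and real numbers\<close>

text \<open>
  Primitive recursive functions as terms: \<open>Rec0 \<cdot> (CombK ty1 N \<cdot> g) \<cdot> m \<cdot> n\<close> is the \<open>n\<close>-fold iterate
  of \<open>g\<close> at \<open>m\<close>, and \<open>Rec0 \<cdot> CombK N N \<cdot> Zero\<close> is the predecessor function.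
\<close>

definition iterate :: "tm \<Rightarrow> tm \<Rightarrow> tm" where
  "iterate g m = Rec0 \<cdot> (CombK ty1 N \<cdot> g) \<cdot> m"

definition plus_tm :: "tm \<Rightarrow> tm \<Rightarrow> tm"  (infixl "\<oplus>" 80) where
  "m \<oplus> n = iterate Succ m \<cdot> n"

definition times_tm :: "tm \<Rightarrow> tm \<Rightarrow> tm"  (infixl "\<otimes>" 85) where
  "m \<otimes> n = iterate (iterate Succ m) Zero \<cdot> n"

definition monus_tm :: "tm \<Rightarrow> tm \<Rightarrow> tm"  (infixl "\<ominus>" 80) where
  "m \<ominus> n = iterate (Rec0 \<cdot> CombK N N \<cdot> Zero) m \<cdot> n"

definition two :: tm where
  "two = Succ \<cdot> one"

definition pow2 :: "tm \<Rightarrow> tm" where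
  "pow2 n = iterate (iterate (iterate Succ two) Zero) one \<cdot> n"

definition absdiff :: "tm \<Rightarrow> tm \<Rightarrow> tm" where
  "absdiff m n = (m \<ominus> n) \<oplus> (n \<ominus> m)"

definition le_tm :: "tm \<Rightarrow> tm \<Rightarrow> fm" where
  "le_tm m n = (m \<ominus> n \<doteq> Zero)"

definition less_tm :: "tm \<Rightarrow> tm \<Rightarrow> fm" where
  "less_tm m n = le_tm (Succ \<cdot> m) n"

text \<open>
  A rational number is coded by three natural numbers \<open>p\<close>, \<open>q\<close>, \<open>r\<close>, standing for \<open>(p - q)/(r + 1)\<close>.
  An element \<open>x\<close> of Baire space codes the sequence of rationals whose \<open>n\<close>-th entry is coded by
  \<open>x(3n)\<close>, \<open>x(3n + 1)\<close>, \<open>x(3n + 2)\<close>.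
\<close>

definition pos_part :: "tm \<Rightarrow> tm \<Rightarrow> tm" where
  "pos_part x n = x \<cdot> (n \<oplus> n \<oplus> n)"

definition neg_part :: "tm \<Rightarrow> tm \<Rightarrow> tm" where
  "neg_part x n = x \<cdot> (Succ \<cdot> (n \<oplus> n \<oplus> n))"

definition denom :: "tm \<Rightarrow> tm \<Rightarrow> tm" where
  "denom x n = Succ \<cdot> (x \<cdot> (Succ \<cdot> (Succ \<cdot> (n \<oplus> n \<oplus> n))))"

text \<open>
  The distance of the \<open>n\<close>-th entry of \<open>x\<close> and the \<open>m\<close>-th entry of \<open>y\<close> is the quotient
  \<open>dist_num x n y m / (denom x n \<otimes> denom y m)\<close>.
\<close>

definition dist_num :: "tm \<Rightarrow> tm \<Rightarrow> tm \<Rightarrow> tm \<Rightarrow> tm" where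
  "dist_num x n y m = absdiff
     (pos_part x n \<otimes> denom y m \<oplus> neg_part y m \<otimes> denom x n)
     (pos_part y m \<otimes> denom x n \<oplus> neg_part x n \<otimes> denom y m)"

text \<open>Fast convergence: the \<open>n\<close>-th and \<open>(n + i)\<close>-th entries have distance less than \<open>2\<^sup>-\<^sup>n\<close>.\<close>

definition is_real :: "tm \<Rightarrow> fm" where
  "is_real x = Forall N (\<lambda>n. Forall N (\<lambda>i.
     less_tm (dist_num x n x (n \<oplus> i) \<otimes> pow2 n) (denom x n \<otimes> denom x (n \<oplus> i))))"

text \<open>Equality of reals: the \<open>n\<close>-th entries have distance at most \<open>2 \<cdot> 2\<^sup>-\<^sup>n\<close>, for all \<open>n\<close>.\<close>

definition eq_real :: "tm \<Rightarrow> tm \<Rightarrow> fm" where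
  "eq_real x y = Forall N (\<lambda>n.
     le_tm (dist_num x n y n \<otimes> pow2 n) (two \<otimes> (denom x n \<otimes> denom y n)))"

definition ForallR :: "(tm \<Rightarrow> fm) \<Rightarrow> fm" where
  "ForallR \<phi> = Forall ty1 (\<lambda>x. is_real x \<^bold>\<longrightarrow> \<phi> x)"

definition ExistsR :: "(tm \<Rightarrow> fm) \<Rightarrow> fm" where
  "ExistsR \<phi> = Exists ty1 (\<lambda>x. is_real x \<^bold>\<and> \<phi> x)"


section \<open>Countable well-orderings on sets of reals\<close>

definition real_fun_nat :: "tm \<Rightarrow> fm" where
  "real_fun_nat Y = ForallR (\<lambda>x. ForallR (\<lambda>y. eq_real x y \<^bold>\<longrightarrow> Y \<cdot> x \<doteq> Y \<cdot> y))"

definition real_set :: "tm \<Rightarrow> fm" where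
  "real_set X = real_fun_nat X \<^bold>\<and> ForallR (\<lambda>x. X \<cdot> x \<doteq> Zero \<^bold>\<or> X \<cdot> x \<doteq> one)"

definition mem :: "tm \<Rightarrow> tm \<Rightarrow> fm" where
  "mem X x = (is_real x \<^bold>\<and> X \<cdot> x \<doteq> one)"

definition real_rel :: "tm \<Rightarrow> fm" where
  "real_rel R =
     ForallR (\<lambda>x. ForallR (\<lambda>x'. ForallR (\<lambda>y. ForallR (\<lambda>y'.
       eq_real x x' \<^bold>\<and> eq_real y y' \<^bold>\<longrightarrow> R \<cdot> x \<cdot> y \<doteq> R \<cdot> x' \<cdot> y')))) \<^bold>\<and>
     ForallR (\<lambda>x. ForallR (\<lambda>y. R \<cdot> x \<cdot> y \<doteq> Zero \<^bold>\<or> R \<cdot> x \<cdot> y \<doteq> one))"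

definition rel :: "tm \<Rightarrow> tm \<Rightarrow> tm \<Rightarrow> fm" where
  "rel R x y = (R \<cdot> x \<cdot> y \<doteq> one)"

definition ord_eq :: "tm \<Rightarrow> tm \<Rightarrow> tm \<Rightarrow> fm" where
  "ord_eq R x y = (rel R x y \<^bold>\<and> rel R y x)"

definition prec :: "tm \<Rightarrow> tm \<Rightarrow> tm \<Rightarrow> fm" where
  "prec R x y = (rel R x y \<^bold>\<and> \<^bold>\<not> ord_eq R x y)"

text \<open>Antisymmetry relative to \<open>ord_eq R\<close> holds by the definition of the latter.\<close>

definition linear_order :: "tm \<Rightarrow> tm \<Rightarrow> fm" where
  "linear_order X R = (real_set X \<^bold>\<and> real_rel R \<^bold>\<and>
     Forall ty1 (\<lambda>x. Forall ty1 (\<lambda>y. Forall ty1 (\<lambda>z.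
       mem X x \<^bold>\<and> mem X y \<^bold>\<and> mem X z \<^bold>\<longrightarrow> rel R x y \<^bold>\<and> rel R y z \<^bold>\<longrightarrow> rel R x z))) \<^bold>\<and>
     Forall ty1 (\<lambda>x. Forall ty1 (\<lambda>y.
       mem X x \<^bold>\<and> mem X y \<^bold>\<longrightarrow> rel R x y \<^bold>\<or> rel R y x)))"

definition well_ordering :: "tm \<Rightarrow> tm \<Rightarrow> fm" where
  "well_ordering X R = (linear_order X R \<^bold>\<and>
     \<^bold>\<not> Exists (N \<rightarrow> ty1) (\<lambda>s. Forall N (\<lambda>n. mem X (s \<cdot> n) \<^bold>\<and> prec R (s \<cdot> (Succ \<cdot> n)) (s \<cdot> n))))"

definition cwo :: "tm \<Rightarrow> tm \<Rightarrow> fm" where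
  "cwo X R = (well_ordering X R \<^bold>\<and>
     Exists ty2 (\<lambda>Y. real_fun_nat Y \<^bold>\<and>
       Forall ty1 (\<lambda>x. Forall ty1 (\<lambda>y.
         mem X x \<^bold>\<and> mem X y \<^bold>\<longrightarrow> Y \<cdot> x \<doteq> Y \<cdot> y \<^bold>\<longrightarrow> ord_eq R x y))))"

definition initial_segment :: "tm \<Rightarrow> tm \<Rightarrow> tm \<Rightarrow> tm \<Rightarrow> fm" where
  "initial_segment X R x0 = (\<lambda>x. mem X x \<^bold>\<and> prec R x x0)"

text \<open>
  The carriers \<open>P\<close> and \<open>Q\<close> are given by their membership formulas, so that they can be sets
  of reals as well as initial segments thereof.
\<close>

definition order_isomorphic :: "(tm \<Rightarrow> fm) \<Rightarrow> tm \<Rightarrow> (tm \<Rightarrow> fm) \<Rightarrow> tm \<Rightarrow> fm" where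
  "order_isomorphic P R Q S = Exists (ty1 \<rightarrow> ty1) (\<lambda>Z.
     Forall ty1 (\<lambda>x. P x \<^bold>\<longrightarrow> Q (Z \<cdot> x)) \<^bold>\<and>
     Forall ty1 (\<lambda>x. Forall ty1 (\<lambda>x'.
       P x \<^bold>\<and> P x' \<^bold>\<longrightarrow> eq_real x x' \<^bold>\<longrightarrow> eq_real (Z \<cdot> x) (Z \<cdot> x'))) \<^bold>\<and>
     Forall ty1 (\<lambda>w. Q w \<^bold>\<longrightarrow> Exists ty1 (\<lambda>x. P x \<^bold>\<and> ord_eq S (Z \<cdot> x) w)) \<^bold>\<and>
     Forall ty1 (\<lambda>x. Forall ty1 (\<lambda>x'.
       P x \<^bold>\<and> P x' \<^bold>\<longrightarrow> (rel R x x' \<^bold>\<longleftrightarrow> rel S (Z \<cdot> x) (Z \<cdot> x')))))"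

definition embeds_initially :: "tm \<Rightarrow> tm \<Rightarrow> tm \<Rightarrow> tm \<Rightarrow> fm" where
  "embeds_initially A R B S =
     (order_isomorphic (mem A) R (mem B) S \<^bold>\<or>
      Exists ty1 (\<lambda>b. mem B b \<^bold>\<and> order_isomorphic (mem A) R (initial_segment B S b) S))"

definition cwo_comparability :: fm where
  "cwo_comparability =
     Forall ty2 (\<lambda>A. Forall (ty1 \<rightarrow> ty1 \<rightarrow> N) (\<lambda>R.
     Forall ty2 (\<lambda>B. Forall (ty1 \<rightarrow> ty1 \<rightarrow> N) (\<lambda>S.
       cwo A R \<^bold>\<and> cwo B S \<^bold>\<longrightarrow> embeds_initially A R B S \<^bold>\<or> embeds_initially B S A R))))"

end

theory Submission
  imports Defs "HOL-Library.Countable"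
begin

text \<open>
  By Henkin's completeness theorem it suffices to compare the truth values of the two formulas in
  an arbitrary extensional model, whose natural numbers may be nonstandard. In such a model,
  \<open>\<exists>\<^sup>2\<close> and quantifier-free choice make all arithmetical predicates with parameters decidable by
  functionals, and yield a functional that picks witnesses of numerical existence statements.

  Comparability implies BOOT: every element of Baire space is coded by a real number, and decoding
  is invariant under equality of reals. Given \<open>Y\<close>, let \<open>A\<close> be the set of codes of pairs \<open>(n, f)\<close> with
  \<open>Y f n = 0\<close>, ordered by \<open>n\<close>, and let \<open>B\<close> be the set of all reals under the same order. In either
  direction, an order-isomorphism onto \<open>A\<close> or from \<open>A\<close> to an initial segment of \<open>B\<close> provides, by
  \<open>QF-AC\<^sup>0\<^sup>,\<^sup>1\<close>, an enumeration of those \<open>n\<close> for which such an \<open>f\<close> exists; \<open>B\<close> cannot be embedded below an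
  element of \<open>A\<close>, as an increasing function on the natural numbers is unbounded.

  BOOT implies comparability: the numbers that index the elements of a cwo form a set by BOOT, and
  \<open>QF-AC\<^sup>0\<^sup>,\<^sup>1\<close> chooses representatives, so that cwos become well-orders on sets of natural numbers.
  For these, BOOT forms the set of all elements whose initial segment is isomorphic to an initial
  segment of the other order, and \<open>QF-AC\<^sup>0\<^sup>,\<^sup>1\<close> glues the isomorphisms together.
\<close>

section \<open>Free variables and substitution\<close>

text \<open>A derivation in the calculus would have to spell out every function as a combinator
  term; in a model, functions and choices are elements of the sets \<open>D \<sigma>\<close>. The
  price is that \<open>D N\<close> may be nonstandard and that function spaces may be small:
  induction holds only for predicates whose characteristic function is an element of the model, and
  a map counts as a function only if some element represents it. The predicates \<open>rep\<close>
  and \<open>dec\<close> record exactly this, and their side conditions are discharged along the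
  syntax.

  The reals cause a second obstacle. Sets and orders must respect equality of reals, so the function
  coded by a real has to be read off independently of the Cauchy sequence. Strict rational cuts do
  this: passing to an equal real moves the approximations by an amount that a finer grid absorbs.

  Ordering the pairs \<open>(n, f)\<close> by \<open>n\<close> alone hides the function quantifier.
  Comparison with the order of all reals, which looks like the natural numbers, extracts one pair
  for each relevant \<open>n\<close>, and the existence of \<open>f\<close> becomes a question about
  numbers that \<exists>^2 decides.\<close>

primrec fv_tm :: "tm \<Rightarrow> (ty \<times> nat) set" where
  "fv_tm (Var \<sigma> n) = {(\<sigma>, n)}"
| "fv_tm Zero = {}"
| "fv_tm Succ = {}"
| "fv_tm Rec0 = {}"
| "fv_tm (CombK \<rho> \<tau>) = {}"
| "fv_tm (CombS \<delta> \<rho> \<tau>) = {}"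
| "fv_tm (s \<cdot> t) = fv_tm s \<union> fv_tm t"

primrec fv :: "fm \<Rightarrow> (ty \<times> nat) set" where
  "fv (s \<doteq> t) = fv_tm s \<union> fv_tm t"
| "fv Falsum = {}"
| "fv (\<phi> \<^bold>\<longrightarrow> \<psi>) = fv \<phi> \<union> fv \<psi>"
| "fv (ForallB \<sigma> \<phi>) = {(\<tau>, n). (\<tau>, if \<tau> = \<sigma> then Suc n else n) \<in> fv \<phi>}"

lemma finite_fv_tm [simp]: "finite (fv_tm t)"
  by (induction t) auto

lemma finite_fv [simp]: "finite (fv \<phi>)"
proof (induction \<phi>)
  case (ForallB \<sigma> \<phi>)
  have "fv (ForallB \<sigma> \<phi>) = (\<lambda>(\<tau>, n). (\<tau>, if \<tau> = \<sigma> then Suc n else n)) -` fv \<phi>"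
    by auto
  moreover have "inj (\<lambda>(\<tau>, n). (\<tau>, if \<tau> = \<sigma> then Suc n else n))"
    by (auto simp: inj_def split: if_splits)
  ultimately show ?case
    using finite_vimageI[OF ForallB] by simp
qed auto

lemma fv_tm_fresh: "(\<tau>, n) \<in> fv_tm t \<Longrightarrow> n < fresh_tm t"
  by (induction t) (auto simp: less_max_iff_disj)

lemma fv_fresh: "(\<tau>, n) \<in> fv \<phi> \<Longrightarrow> n < fresh \<phi>"
proof (induction \<phi> arbitrary: n)
  case (ForallB \<sigma> \<phi>)
  then show ?case
    by (cases "\<tau> = \<sigma>") (auto dest: Suc_lessD)
qed (auto simp: less_max_iff_disj dest: fv_tm_fresh)

section \<open>Composition and agreement of substitutions\<close>

lemma subst_tm_subst_tm:
  "subst_tm \<theta> (subst_tm \<eta> t) = subst_tm (\<lambda>\<sigma> n. subst_tm \<theta> (\<eta> \<sigma> n)) t"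
  by (induction t) auto

lemma under_shift: "subst_tm (under \<sigma> \<theta>) (subst_tm (shift \<sigma>) t) = subst_tm (shift \<sigma>) (subst_tm \<theta> t)"
  by (simp add: subst_tm_subst_tm) (rule arg_cong[where f = "\<lambda>\<theta>. subst_tm \<theta> t"],
      auto simp: fun_eq_iff shift_def under_def)

lemma subst_fm_subst_fm:
  "subst_fm \<theta> (subst_fm \<eta> \<phi>) = subst_fm (\<lambda>\<sigma> n. subst_tm \<theta> (\<eta> \<sigma> n)) \<phi>"
proof (induction \<phi> arbitrary: \<theta> \<eta>)
  case (ForallB \<sigma> \<phi>)
  have "(\<lambda>\<tau> n. subst_tm (under \<sigma> \<theta>) (under \<sigma> \<eta> \<tau> n)) = under \<sigma> (\<lambda>\<tau> n. subst_tm \<theta> (\<eta> \<tau> n))"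
    unfolding under_def[of \<sigma> \<eta>]
    by (auto simp: fun_eq_iff under_shift split: nat.split) (auto simp: under_def split: nat.split)
  then show ?case
    by (simp add: ForallB)
qed (auto simp: subst_tm_subst_tm)

lemma subst_tm_cong: "(\<And>\<sigma> n. (\<sigma>, n) \<in> fv_tm t \<Longrightarrow> \<theta> \<sigma> n = \<eta> \<sigma> n) \<Longrightarrow> subst_tm \<theta> t = subst_tm \<eta> t"
  by (induction t) auto

lemma subst_fm_cong: "(\<And>\<sigma> n. (\<sigma>, n) \<in> fv \<phi> \<Longrightarrow> \<theta> \<sigma> n = \<eta> \<sigma> n) \<Longrightarrow> subst_fm \<theta> \<phi> = subst_fm \<eta> \<phi>"
proof (induction \<phi> arbitrary: \<theta> \<eta>)
  case (ForallB \<sigma> \<phi>)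
  have "subst_fm (under \<sigma> \<theta>) \<phi> = subst_fm (under \<sigma> \<eta>) \<phi>"
  proof (rule ForallB.IH)
    fix \<tau> n assume "(\<tau>, n) \<in> fv \<phi>"
    then show "under \<sigma> \<theta> \<tau> n = under \<sigma> \<eta> \<tau> n"
      using ForallB.prems by (cases n) (auto simp: under_def)
  qed
  then show ?case by simp
next
  case (Imp \<phi> \<psi>)
  have "subst_fm \<theta> \<phi> = subst_fm \<eta> \<phi>"
    by (rule Imp.IH) (simp add: Imp.prems)
  moreover have "subst_fm \<theta> \<psi> = subst_fm \<eta> \<psi>"
    by (rule Imp.IH) (simp add: Imp.prems)
  ultimately show ?case by simp
next
  case (Eq s t)
  have "subst_tm \<theta> s = subst_tm \<eta> s"
    by (rule subst_tm_cong) (simp add: Eq)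
  moreover have "subst_tm \<theta> t = subst_tm \<eta> t"
    by (rule subst_tm_cong) (simp add: Eq)
  ultimately show ?case by simp
qed simp

lemma subst_tm_Var [simp]: "subst_tm Var t = t"
  by (induction t) auto

lemma under_Var [simp]: "under \<sigma> Var = Var"
  by (auto simp: under_def shift_def fun_eq_iff split: nat.split)

lemma subst_fm_Var [simp]: "subst_fm Var \<phi> = \<phi>"
  by (induction \<phi>) auto

lemma subst_fm_ident: "(\<And>\<sigma> n. (\<sigma>, n) \<in> fv \<phi> \<Longrightarrow> \<theta> \<sigma> n = Var \<sigma> n) \<Longrightarrow> subst_fm \<theta> \<phi> = \<phi>"
  using subst_fm_cong[of \<phi> \<theta> Var] by simp

lemma fv_tm_subst: "fv_tm (subst_tm \<theta> t) = (\<Union>(\<sigma>, n)\<in>fv_tm t. fv_tm (\<theta> \<sigma> n))"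
  by (induction t) auto

lemma fv_tm_shift: "(\<tau>, n) \<in> fv_tm (subst_tm (shift \<sigma>) t) \<longleftrightarrow>
    (if \<tau> = \<sigma> then n > 0 \<and> (\<sigma>, n - 1) \<in> fv_tm t else (\<tau>, n) \<in> fv_tm t)"
  by (induction t) (auto simp: shift_def)

lemma fv_subst: "fv (subst_fm \<theta> \<phi>) = (\<Union>(\<sigma>, n)\<in>fv \<phi>. fv_tm (\<theta> \<sigma> n))"
proof (induction \<phi> arbitrary: \<theta>)
  case (ForallB \<sigma> \<phi>)
  \<comment> \<open>Passing below the binder moves indices on both sides, that of the variable
    substituted for and those of the variables in its image. This equivalence undoes both moves at
    once.\<close>
  have *: "(\<tau>, if \<tau> = \<sigma> then Suc n else n) \<in> fv_tm (under \<sigma> \<theta> \<rho> k) \<longleftrightarrow>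
      \<not> (\<rho> = \<sigma> \<and> k = 0) \<and> (\<tau>, n) \<in> fv_tm (\<theta> \<rho> (if \<rho> = \<sigma> then k - 1 else k))" for \<tau> n \<rho> k
    by (cases k) (auto simp: under_def fv_tm_shift)
  show ?case
  proof (intro set_eqI iffI; clarify)
    fix \<tau> n assume "(\<tau>, n) \<in> fv (subst_fm \<theta> (ForallB \<sigma> \<phi>))"
    then obtain \<rho> k where "(\<rho>, k) \<in> fv \<phi>" "\<not> (\<rho> = \<sigma> \<and> k = 0)"
      "(\<tau>, n) \<in> fv_tm (\<theta> \<rho> (if \<rho> = \<sigma> then k - 1 else k))"
      by (auto simp: ForallB * simp del: split_paired_Ex)
    then show "(\<tau>, n) \<in> (\<Union>(\<sigma>', n)\<in>fv (ForallB \<sigma> \<phi>). fv_tm (\<theta> \<sigma>' n))"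
      by (intro UN_I[of "(\<rho>, if \<rho> = \<sigma> then k - 1 else k)"]) auto
  next
    fix \<tau> n \<rho> k assume "(\<rho>, k) \<in> fv (ForallB \<sigma> \<phi>)" and n: "(\<tau>, n) \<in> fv_tm (\<theta> \<rho> k)"
    then have "(\<rho>, if \<rho> = \<sigma> then Suc k else k) \<in> fv \<phi>"
      by simp
    moreover have "(\<tau>, if \<tau> = \<sigma> then Suc n else n) \<in>
        fv_tm (under \<sigma> \<theta> \<rho> (if \<rho> = \<sigma> then Suc k else k))"
      unfolding * using n by auto
    ultimately show "(\<tau>, n) \<in> fv (subst_fm \<theta> (ForallB \<sigma> \<phi>))"
      unfolding subst_fm.simps fv.simps ForallB by blast
  qed
qed (auto simp: fv_tm_subst)

section \<open>Typing of terms and well-formedness of formulas\<close>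

definition typed_subst :: "substitution \<Rightarrow> bool" where
  "typed_subst \<theta> \<longleftrightarrow> (\<forall>\<sigma> n. has_type (\<theta> \<sigma> n) \<sigma>)"

inductive_simps has_type_Var [simp]: "has_type (Var \<sigma> n) \<tau>"
inductive_simps has_type_Zero [simp]: "has_type Zero \<tau>"
inductive_simps has_type_Succ [simp]: "has_type Succ \<tau>"
inductive_simps has_type_Rec0 [simp]: "has_type Rec0 \<tau>"
inductive_simps has_type_CombK [simp]: "has_type (CombK \<rho> \<sigma>) \<tau>"
inductive_simps has_type_CombS [simp]: "has_type (CombS \<delta> \<rho> \<sigma>) \<tau>"
inductive_simps has_type_App: "has_type (s \<cdot> t) \<tau>"

text \<open>Variables and combinators carry their types, so typing is determined by the syntax. The
  classes \<open>cls\<close> of the quotient model, which existentially quantify over a type, rely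
  on this.\<close>

lemma has_type_unique: "has_type t \<sigma> \<Longrightarrow> has_type t \<tau> \<Longrightarrow> \<sigma> = \<tau>"
proof (induction arbitrary: \<tau> rule: has_type.induct)
  case (7 s \<sigma> \<rho> t)
  then show ?case
    by (metis has_type_App ty.inject)
qed auto

lemma has_type_subst: "has_type t \<tau> \<Longrightarrow> typed_subst \<theta> \<Longrightarrow> has_type (subst_tm \<theta> t) \<tau>"
  by (induction rule: has_type.induct) (auto simp: typed_subst_def intro: has_type.intros)

lemma typed_subst_shift [simp]: "typed_subst (shift \<sigma>)"
  by (auto simp: typed_subst_def shift_def)

lemma typed_subst_under: "typed_subst \<theta> \<Longrightarrow> typed_subst (under \<sigma> \<theta>)"
  using has_type_subst[OF _ typed_subst_shift]
  by (auto simp: typed_subst_def under_def split: nat.split)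

lemma wf_subst: "wf_fm \<phi> \<Longrightarrow> typed_subst \<theta> \<Longrightarrow> wf_fm (subst_fm \<theta> \<phi>)"
  by (induction \<phi> arbitrary: \<theta>) (auto intro: has_type_subst typed_subst_under)

lemma wf_inst: "wf_fm \<phi> \<Longrightarrow> has_type t \<sigma> \<Longrightarrow> wf_fm (inst \<sigma> t \<phi>)"
  unfolding inst_def by (rule wf_subst) (auto simp: typed_subst_def split: nat.split)

lemma Neg_simps [simp]:
  "wf_fm (\<^bold>\<not> \<phi>) = wf_fm \<phi>" "fv (\<^bold>\<not> \<phi>) = fv \<phi>" "subst_fm \<theta> (\<^bold>\<not> \<phi>) = \<^bold>\<not> subst_fm \<theta> \<phi>"
  by (auto simp: Neg_def)

lemma Or_simps [simp]:
  "wf_fm (\<phi> \<^bold>\<or> \<psi>) \<longleftrightarrow> wf_fm \<phi> \<and> wf_fm \<psi>" "fv (\<phi> \<^bold>\<or> \<psi>) = fv \<phi> \<union> fv \<psi>"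
  by (auto simp: Or_def)

lemma And_simps [simp]:
  "wf_fm (\<phi> \<^bold>\<and> \<psi>) \<longleftrightarrow> wf_fm \<phi> \<and> wf_fm \<psi>" "fv (\<phi> \<^bold>\<and> \<psi>) = fv \<phi> \<union> fv \<psi>"
  by (auto simp: And_def)

lemma Iff_simps [simp]:
  "wf_fm (\<phi> \<^bold>\<longleftrightarrow> \<psi>) \<longleftrightarrow> wf_fm \<phi> \<and> wf_fm \<psi>" "fv (\<phi> \<^bold>\<longleftrightarrow> \<psi>) = fv \<phi> \<union> fv \<psi>"
  by (auto simp: Iff_def)

lemma fv_ForallV: "fv (ForallV \<sigma> k \<phi>) = fv \<phi> - {(\<sigma>, k)}"
proof -
  have "(\<tau>, n) \<in> fv (ForallV \<sigma> k \<phi>) \<longleftrightarrow> (\<tau>, n) \<in> fv \<phi> - {(\<sigma>, k)}" for \<tau> n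
    by (cases "\<tau> = \<sigma>") (force simp: ForallV_def fv_subst split: if_splits)+
  then show ?thesis by auto
qed

text \<open>The body \<open>\<phi>\<close> is an arbitrary function on terms and could inspect its
  argument. The premise is the uniformity that is required: the name computed from
  \<open>\<phi> Zero\<close> then lies outside \<open>C\<close> for every instance, so no capture
  occurs.\<close>

lemma fv_Forall: 
  assumes "\<And>x. fv (\<phi> x) = fv_tm x \<union> C"
  shows "fv (Forall \<sigma> \<phi>) = C"
  using fv_fresh[of \<sigma> "fresh (\<phi> Zero)" "\<phi> Zero"]
  by (auto simp: Forall_def Let_def fv_ForallV assms)

lemma fv_Exists: 
  assumes "\<And>x. fv (\<phi> x) = fv_tm x \<union> C"
  shows "fv (Exists \<sigma> \<phi>) = C"
  using assms by (simp add: Exists_def fv_Forall)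

lemma wf_ForallV [simp]: "wf_fm \<phi> \<Longrightarrow> wf_fm (ForallV \<sigma> k \<phi>)"
  unfolding ForallV_def wf_fm.simps by (erule wf_subst) (auto simp: typed_subst_def)

lemma wf_ExistsV [simp]: "wf_fm \<phi> \<Longrightarrow> wf_fm (ExistsV \<sigma> k \<phi>)"
  by (simp add: ExistsV_def)

lemma wf_Forall: "(\<And>x. has_type x \<sigma> \<Longrightarrow> wf_fm (\<phi> x)) \<Longrightarrow> wf_fm (Forall \<sigma> \<phi>)"
  by (simp add: Forall_def Let_def)

lemma wf_Exists: "(\<And>x. has_type x \<sigma> \<Longrightarrow> wf_fm (\<phi> x)) \<Longrightarrow> wf_fm (Exists \<sigma> \<phi>)"
  by (simp add: Exists_def wf_Forall)

lemma wf_replace: "wf_fm \<phi> \<Longrightarrow> has_type t \<sigma> \<Longrightarrow> wf_fm (replace \<sigma> k t \<phi>)"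
  unfolding replace_def by (erule wf_subst) (auto simp: typed_subst_def)

lemma wf_eq_at: "has_type s \<sigma> \<Longrightarrow> has_type t \<sigma> \<Longrightarrow> wf_fm (eq_at \<sigma> s t)"
proof (induction \<sigma> arbitrary: s t)
  case (Fn \<sigma> \<tau>)
  then show ?case
    by (auto intro!: wf_Forall Fn.IH has_type.intros(7)[of _ \<sigma>])
qed simp

lemma fv_eq_at [simp]: "fv (eq_at \<sigma> s t) = fv_tm s \<union> fv_tm t"
  by (induction \<sigma> arbitrary: s t) (auto intro!: fv_Forall)


section \<open>Structures for the language\<close>

definition upd :: "(ty \<Rightarrow> nat \<Rightarrow> 'a) \<Rightarrow> ty \<Rightarrow> nat \<Rightarrow> 'a \<Rightarrow> ty \<Rightarrow> nat \<Rightarrow> 'a" where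
  "upd e \<sigma> k d = (\<lambda>\<tau> n. if \<tau> = \<sigma> \<and> n = k then d else e \<tau> n)"

definition push :: "ty \<Rightarrow> 'a \<Rightarrow> (ty \<Rightarrow> nat \<Rightarrow> 'a) \<Rightarrow> ty \<Rightarrow> nat \<Rightarrow> 'a" where
  "push \<sigma> d e = (\<lambda>\<tau> n. if \<tau> = \<sigma> then (case n of 0 \<Rightarrow> d | Suc k \<Rightarrow> e \<sigma> k) else e \<tau> n)"

text \<open>The interpretation \<open>eqN\<close> of the primitive equality need not be identity, so that the
  terms themselves form a structure.\<close>

locale type_structure =
  fixes D :: "ty \<Rightarrow> 'a set" and ap :: "'a \<Rightarrow> 'a \<Rightarrow> 'a"  (infixl "\<bullet>" 100)
    and zero succ recursor :: 'a and combK :: "ty \<Rightarrow> ty \<Rightarrow> 'a" and combS :: "ty \<Rightarrow> ty \<Rightarrow> ty \<Rightarrow> 'a"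
    and eqN :: "'a \<Rightarrow> 'a \<Rightarrow> bool"
  assumes ap_in [simp, intro]: "f \<in> D (\<sigma> \<rightarrow> \<tau>) \<Longrightarrow> x \<in> D \<sigma> \<Longrightarrow> f \<bullet> x \<in> D \<tau>"
    and zero_in [simp]: "zero \<in> D N"
    and succ_in [simp]: "succ \<in> D (N \<rightarrow> N)"
    and recursor_in [simp]: "recursor \<in> D ((N \<rightarrow> N \<rightarrow> N) \<rightarrow> N \<rightarrow> N \<rightarrow> N)"
    and combK_in [simp]: "combK \<rho> \<tau> \<in> D (\<rho> \<rightarrow> \<tau> \<rightarrow> \<rho>)"
    and combS_in [simp]: "combS \<delta> \<rho> \<tau> \<in> D ((\<delta> \<rightarrow> \<rho> \<rightarrow> \<tau>) \<rightarrow> (\<delta> \<rightarrow> \<rho>) \<rightarrow> \<delta> \<rightarrow> \<tau>)"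
begin

definition typed :: "(ty \<Rightarrow> nat \<Rightarrow> 'a) \<Rightarrow> bool" where
  "typed e \<longleftrightarrow> (\<forall>\<sigma> n. e \<sigma> n \<in> D \<sigma>)"

primrec ev :: "(ty \<Rightarrow> nat \<Rightarrow> 'a) \<Rightarrow> tm \<Rightarrow> 'a" where
  "ev e (Var \<sigma> n) = e \<sigma> n"
| "ev e Zero = zero"
| "ev e Succ = succ"
| "ev e Rec0 = recursor"
| "ev e (CombK \<rho> \<tau>) = combK \<rho> \<tau>"
| "ev e (CombS \<delta> \<rho> \<tau>) = combS \<delta> \<rho> \<tau>"
| "ev e (s \<cdot> t) = ev e s \<bullet> ev e t"

primrec sat :: "(ty \<Rightarrow> nat \<Rightarrow> 'a) \<Rightarrow> fm \<Rightarrow> bool" where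
  "sat e (s \<doteq> t) = eqN (ev e s) (ev e t)"
| "sat e Falsum = False"
| "sat e (\<phi> \<^bold>\<longrightarrow> \<psi>) = (sat e \<phi> \<longrightarrow> sat e \<psi>)"
| "sat e (ForallB \<sigma> \<phi>) = (\<forall>d\<in>D \<sigma>. sat (push \<sigma> d e) \<phi>)"

lemma sat_connectives [simp]:
  "sat e (\<^bold>\<not> \<phi>) \<longleftrightarrow> \<not> sat e \<phi>"
  "sat e (\<phi> \<^bold>\<or> \<psi>) \<longleftrightarrow> sat e \<phi> \<or> sat e \<psi>"
  "sat e (\<phi> \<^bold>\<and> \<psi>) \<longleftrightarrow> sat e \<phi> \<and> sat e \<psi>"
  "sat e (\<phi> \<^bold>\<longleftrightarrow> \<psi>) \<longleftrightarrow> (sat e \<phi> \<longleftrightarrow> sat e \<psi>)"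
  by (auto simp: Neg_def Or_def And_def Iff_def)

lemma typed_push [intro]: "typed e \<Longrightarrow> d \<in> D \<sigma> \<Longrightarrow> typed (push \<sigma> d e)"
  by (auto simp: typed_def push_def split: nat.split)

lemma typed_upd [intro]: "typed e \<Longrightarrow> d \<in> D \<sigma> \<Longrightarrow> typed (upd e \<sigma> k d)"
  by (auto simp: typed_def upd_def)

lemma ev_cong: "(\<And>\<sigma> n. (\<sigma>, n) \<in> fv_tm t \<Longrightarrow> e \<sigma> n = e' \<sigma> n) \<Longrightarrow> ev e t = ev e' t"
  by (induction t) auto

lemma sat_cong: "(\<And>\<sigma> n. (\<sigma>, n) \<in> fv \<phi> \<Longrightarrow> e \<sigma> n = e' \<sigma> n) \<Longrightarrow> sat e \<phi> = sat e' \<phi>"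
proof (induction \<phi> arbitrary: e e')
  case (Eq s t)
  have "ev e s = ev e' s"
    by (rule ev_cong) (simp add: Eq)
  moreover have "ev e t = ev e' t"
    by (rule ev_cong) (simp add: Eq)
  ultimately show ?case by simp
next
  case (Imp \<phi> \<psi>)
  have "sat e \<phi> = sat e' \<phi>"
    by (rule Imp.IH) (simp add: Imp.prems)
  moreover have "sat e \<psi> = sat e' \<psi>"
    by (rule Imp.IH) (simp add: Imp.prems)
  ultimately show ?case by simp
next
  case (ForallB \<sigma> \<phi>)
  have "sat (push \<sigma> d e) \<phi> = sat (push \<sigma> d e') \<phi>" for d
  proof (rule ForallB.IH)
    fix \<tau> n assume "(\<tau>, n) \<in> fv \<phi>"
    then show "push \<sigma> d e \<tau> n = push \<sigma> d e' \<tau> n"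
      using ForallB.prems by (cases n) (auto simp: push_def)
  qed
  then show ?case by simp
qed simp

lemma ev_subst: "ev e (subst_tm \<theta> t) = ev (\<lambda>\<sigma> n. ev e (\<theta> \<sigma> n)) t"
  by (induction t) auto

lemma ev_push_shift: "ev (push \<sigma> d e) (subst_tm (shift \<sigma>) t) = ev e t"
  unfolding ev_subst by (rule ev_cong) (auto simp: push_def shift_def)

lemma sat_subst: "sat e (subst_fm \<theta> \<phi>) = sat (\<lambda>\<sigma> n. ev e (\<theta> \<sigma> n)) \<phi>"
proof (induction \<phi> arbitrary: e \<theta>)
  case (ForallB \<sigma> \<phi>)
  have "(\<lambda>\<tau> n. ev (push \<sigma> d e) (under \<sigma> \<theta> \<tau> n)) = push \<sigma> d (\<lambda>\<tau> n. ev e (\<theta> \<tau> n))" for d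
    unfolding under_def by (auto simp: fun_eq_iff ev_push_shift split: nat.split) (auto simp: push_def)
  then show ?case
    by (simp add: ForallB)
qed (auto simp: ev_subst)

lemma sat_replace: "sat e (replace \<sigma> k t \<phi>) = sat (upd e \<sigma> k (ev e t)) \<phi>"
  unfolding replace_def sat_subst by (rule sat_cong) (auto simp: upd_def)

lemma sat_ForallV [simp]: "sat e (ForallV \<sigma> k \<phi>) = (\<forall>d\<in>D \<sigma>. sat (upd e \<sigma> k d) \<phi>)"
  unfolding ForallV_def sat.simps sat_subst
  by (intro ball_cong refl sat_cong) (auto simp: upd_def push_def)

lemma sat_ExistsV [simp]: "sat e (ExistsV \<sigma> k \<phi>) = (\<exists>d\<in>D \<sigma>. sat (upd e \<sigma> k d) \<phi>)"
  by (simp add: ExistsV_def)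

text \<open>Evaluation of the binders with self-chosen names: \<open>C\<close> collects the free variables of the
  body other than the bound one, hence on terms over \<open>C\<close> the updated environment agrees with the
  given one.\<close>

lemma sat_Forall:
  assumes C: "\<And>x. fv (\<phi> x) = fv_tm x \<union> C"
    and \<Phi>: "\<And>e' x. ev e' x \<in> D \<sigma> \<Longrightarrow> (\<And>t. fv_tm t \<subseteq> C \<Longrightarrow> ev e' t = ev e t) \<Longrightarrow> sat e' (\<phi> x) = \<Phi> (ev e' x)"
  shows "sat e (Forall \<sigma> \<phi>) = (\<forall>d\<in>D \<sigma>. \<Phi> d)"
proof -
  define k where "k = fresh (\<phi> Zero)"
  have k: "(\<sigma>, k) \<notin> C"
    using fv_fresh[of \<sigma> k "\<phi> Zero"] by (auto simp: C k_def)
  have "sat (upd e \<sigma> k d) (\<phi> (Var \<sigma> k)) = \<Phi> d" if "d \<in> D \<sigma>" for d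
  proof -
    have "sat (upd e \<sigma> k d) (\<phi> (Var \<sigma> k)) = \<Phi> (ev (upd e \<sigma> k d) (Var \<sigma> k))"
    proof (rule \<Phi>)
      fix t assume "fv_tm t \<subseteq> C"
      then show "ev (upd e \<sigma> k d) t = ev e t"
        using k by (intro ev_cong) (auto simp: upd_def)
    qed (simp add: upd_def that)
    then show ?thesis by (simp add: upd_def)
  qed
  then show ?thesis
    by (simp add: Forall_def Let_def k_def)
qed

lemma sat_Exists:
  assumes "\<And>x. fv (\<phi> x) = fv_tm x \<union> C"
    and "\<And>e' x. ev e' x \<in> D \<sigma> \<Longrightarrow> (\<And>t. fv_tm t \<subseteq> C \<Longrightarrow> ev e' t = ev e t) \<Longrightarrow> sat e' (\<phi> x) = \<Phi> (ev e' x)"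
  shows "sat e (Exists \<sigma> \<phi>) = (\<exists>d\<in>D \<sigma>. \<Phi> d)"
  using assms by (simp add: Exists_def sat_Forall[where \<Phi> = "\<lambda>d. \<not> \<Phi> d"])

end

section \<open>Completeness\<close>

lemma proves_mono: "proves T \<Gamma> \<phi> \<Longrightarrow> \<Gamma> \<subseteq> \<Delta> \<Longrightarrow> proves T \<Delta> \<phi>"
proof (induction arbitrary: \<Delta> rule: proves.induct)
  case (ImpI \<phi> \<Gamma> \<psi>)
  then show ?case by (meson insert_mono proves.ImpI)
next
  case (Classical \<phi> \<Gamma>)
  then show ?case by (meson insert_mono proves.Classical)
next
  case (ForallI \<sigma> \<Gamma> \<phi>)
  then show ?case by (meson image_mono proves.ForallI)
next
  case (EqSubst \<phi> \<Gamma> s t)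
  then show ?case by (blast intro: proves.EqSubst)
next
  case (ForallE \<Gamma> \<sigma> \<phi> t)
  then show ?case by (blast intro: proves.ForallE)
next
  case (ImpE \<Gamma> \<phi> \<psi>)
  then show ?case by (blast intro: proves.ImpE)
qed (auto intro: proves.intros)

text \<open>Every rule uses finitely many assumptions. A rule that discharges an assumption removes
  it from the finite set, and for generalization a finite subset of a shifted context is the shift
  of a finite subset.\<close>

lemma proves_finite: "proves T \<Gamma> \<phi> \<Longrightarrow> \<exists>\<Delta>. finite \<Delta> \<and> \<Delta> \<subseteq> \<Gamma> \<and> proves T \<Delta> \<phi>"
proof (induction rule: proves.induct)
  case (Axiom \<phi> \<Gamma>)
  then show ?case by (intro exI[of _ "{}"]) (auto intro: proves.intros)
next
  case (Assumption \<phi> \<Gamma>)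
  then show ?case by (intro exI[of _ "{\<phi>}"]) (auto intro: proves.intros)
next
  case (ImpI \<phi> \<Gamma> \<psi>)
  then obtain \<Delta> where "finite \<Delta>" "\<Delta> \<subseteq> insert \<phi> \<Gamma>" "proves T \<Delta> \<psi>" by blast
  then show ?case
    using proves.ImpI[OF ImpI(1) proves_mono[of T \<Delta> \<psi> "insert \<phi> (\<Delta> - {\<phi>})"]]
    by (intro exI[of _ "\<Delta> - {\<phi>}"]) blast
next
  case (ImpE \<Gamma> \<phi> \<psi>)
  then obtain \<Delta> \<Delta>' where "finite \<Delta>" "\<Delta> \<subseteq> \<Gamma>" "proves T \<Delta> (\<phi> \<^bold>\<longrightarrow> \<psi>)"
    "finite \<Delta>'" "\<Delta>' \<subseteq> \<Gamma>" "proves T \<Delta>' \<phi>" by blast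
  then show ?case
    using proves.ImpE[of T "\<Delta> \<union> \<Delta>'" \<phi> \<psi>] proves_mono[of T _ _ "\<Delta> \<union> \<Delta>'"]
    by (intro exI[of _ "\<Delta> \<union> \<Delta>'"]) simp
next
  case (Classical \<phi> \<Gamma>)
  then obtain \<Delta> where "finite \<Delta>" "\<Delta> \<subseteq> insert (\<^bold>\<not> \<phi>) \<Gamma>" "proves T \<Delta> Falsum" by blast
  then show ?case
    using proves.Classical[OF Classical(1) proves_mono[of T \<Delta> Falsum "insert (\<^bold>\<not> \<phi>) (\<Delta> - {\<^bold>\<not> \<phi>})"]]
    by (intro exI[of _ "\<Delta> - {\<^bold>\<not> \<phi>}"]) blast
next
  case (ForallI \<sigma> \<Gamma> \<phi>)
  then obtain \<Delta> where "finite \<Delta>" "\<Delta> \<subseteq> subst_fm (shift \<sigma>) ` \<Gamma>" "proves T \<Delta> \<phi>" by blast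
  then show ?case
    by (metis finite_subset_image proves.ForallI)
next
  case (ForallE \<Gamma> \<sigma> \<phi> t)
  then show ?case by (blast intro: proves.ForallE)
next
  case (EqRefl t \<Gamma>)
  then show ?case by (intro exI[of _ "{}"]) (auto intro: proves.intros)
next
  case (EqSubst \<phi> \<Gamma> s t)
  then obtain \<Delta> \<Delta>' where "finite \<Delta>" "\<Delta> \<subseteq> \<Gamma>" "proves T \<Delta> (s \<doteq> t)"
    "finite \<Delta>'" "\<Delta>' \<subseteq> \<Gamma>" "proves T \<Delta>' (inst N s \<phi>)" by blast
  then show ?case
    using proves.EqSubst[OF EqSubst(1), of T "\<Delta> \<union> \<Delta>'" s t] proves_mono[of T _ _ "\<Delta> \<union> \<Delta>'"]
    by (intro exI[of _ "\<Delta> \<union> \<Delta>'"]) simp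
qed

text \<open>Moving a finite context into the formula leaves an empty context, in which variables can
  be replaced freely by generalizing and instantiating.\<close>

lemma proves_foldr_ImpI:
  "proves T (set gs \<union> \<Gamma>) \<phi> \<Longrightarrow> \<forall>g\<in>set gs. wf_fm g \<Longrightarrow> proves T \<Gamma> (foldr Imp gs \<phi>)"
proof (induction gs arbitrary: \<Gamma>)
  case (Cons g gs)
  then have "proves T (insert g \<Gamma>) (foldr Imp gs \<phi>)"
    by (intro Cons.IH) auto
  then show ?case
    using Cons.prems by (auto intro: proves.ImpI)
qed simp

lemma proves_foldr_ImpE:
  "proves T \<Gamma> (foldr Imp gs \<phi>) \<Longrightarrow> set gs \<subseteq> \<Gamma> \<Longrightarrow> proves T \<Gamma> \<phi>"
  by (induction gs) (auto dest: proves.ImpE[OF _ proves.Assumption])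

lemma subst_foldr_Imp: "subst_fm \<theta> (foldr Imp gs \<phi>) = foldr Imp (map (subst_fm \<theta>) gs) (subst_fm \<theta> \<phi>)"
  by (induction gs) auto

text \<open>Instantiation with \<open>t\<close> lowers the indices of the remaining variables of its sort, which is
  compensated for in advance.\<close>

lemma proves_subst_initial:
  assumes "proves T {} \<phi>" "\<And>i. i < K \<Longrightarrow> has_type (t i) \<sigma>"
  shows "proves T {} (subst_fm (\<lambda>\<tau> n. if \<tau> = \<sigma> then if n < K then t n else Var \<sigma> (n - K) else Var \<tau> n) \<phi>)"
  using assms
proof (induction K arbitrary: t \<phi>)
  case 0
  have "(\<lambda>\<tau> n. if \<tau> = \<sigma> then if n < 0 then t n else Var \<sigma> (n - 0) else Var \<tau> n) = Var"
    by (auto simp: fun_eq_iff)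
  with 0 show ?case by simp
next
  case (Suc K)
  let ?l = "\<lambda>\<tau> n. if \<tau> = \<sigma> then Var \<sigma> (n + K) else Var \<tau> n"
  let ?\<theta> = "\<lambda>\<tau> n. if \<tau> = \<sigma> then if n < K then t (Suc n) else Var \<sigma> (n - K) else Var \<tau> n"
  have "typed_subst ?l"
    by (auto simp: typed_subst_def)
  then have "has_type (subst_tm ?l (t 0)) \<sigma>"
    using Suc.prems has_type_subst by blast
  then have "proves T {} (inst \<sigma> (subst_tm ?l (t 0)) \<phi>)"
    using Suc.prems(1) by (intro proves.ForallE proves.ForallI) auto
  then have "proves T {} (subst_fm ?\<theta> (inst \<sigma> (subst_tm ?l (t 0)) \<phi>))"
    using Suc.prems(2) by (intro Suc.IH) auto
  moreover have lift: "subst_tm ?\<theta> (subst_tm ?l u) = u" for u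
  proof -
    have "(\<lambda>\<tau> n. subst_tm ?\<theta> (?l \<tau> n)) = Var"
      by (auto simp: fun_eq_iff)
    then show ?thesis
      unfolding subst_tm_subst_tm by simp
  qed
  moreover have "subst_fm ?\<theta> (inst \<sigma> (subst_tm ?l (t 0)) \<phi>) = subst_fm
      (\<lambda>\<tau> n. if \<tau> = \<sigma> then if n < Suc K then t n else Var \<sigma> (n - Suc K) else Var \<tau> n) \<phi>"
    unfolding inst_def subst_fm_subst_fm
    by (rule subst_fm_cong) (auto simp: lift split: nat.split)
  ultimately show ?case by simp
qed

text \<open>Only the indices below \<open>fresh \<phi>\<close> matter, so an arbitrary renaming of
  one sort agrees on \<open>\<phi>\<close> with a simultaneous instantiation of an initial block of
  variables.\<close>

lemma proves_rename:
  assumes "proves T {} \<phi>"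
  shows "proves T {} (subst_fm (\<lambda>\<tau> n. if \<tau> = \<sigma> then Var \<sigma> (r n) else Var \<tau> n) \<phi>)"
proof -
  have "proves T {} (subst_fm (\<lambda>\<tau> n. if \<tau> = \<sigma> then if n < fresh \<phi> then Var \<sigma> (r n)
      else Var \<sigma> (n - fresh \<phi>) else Var \<tau> n) \<phi>)"
    by (rule proves_subst_initial[OF assms]) auto
  then show ?thesis
    by (rule back_subst) (auto intro!: subst_fm_cong dest: fv_fresh)
qed

text \<open>The rule \<open>ForallI\<close> is stated with shifted indices; this is its form for a
  named fresh variable. With the context moved into the formula, the renaming that sends
  \<open>k\<close> to zero and raises all other indices acts as the shift on
  \<open>\<Gamma>\<close>, where \<open>k\<close> is absent, and undoes the instantiation of
  \<open>\<chi>\<close>.\<close>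

lemma proves_generalize:
  assumes "finite \<Gamma>" "\<forall>\<gamma>\<in>\<Gamma>. wf_fm \<gamma>" "proves T \<Gamma> (inst \<sigma> (Var \<sigma> k) \<chi>)"
    and k: "(\<sigma>, k) \<notin> fv (ForallB \<sigma> \<chi>)" "\<forall>\<gamma>\<in>\<Gamma>. (\<sigma>, k) \<notin> fv \<gamma>"
  shows "proves T \<Gamma> (ForallB \<sigma> \<chi>)"
proof -
  let ?\<rho> = "\<lambda>\<tau> n. if \<tau> = \<sigma> then Var \<sigma> (if n = k then 0 else Suc n) else Var \<tau> n"
  obtain gs where gs: "set gs = \<Gamma>"
    using assms(1) finite_list by blast
  have "proves T {} (foldr Imp gs (inst \<sigma> (Var \<sigma> k) \<chi>))"
    using assms gs by (intro proves_foldr_ImpI) auto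
  then have "proves T {} (foldr Imp (map (subst_fm ?\<rho>) gs) (subst_fm ?\<rho> (inst \<sigma> (Var \<sigma> k) \<chi>)))"
    by (drule_tac proves_rename) (simp only: subst_foldr_Imp)
  moreover have "subst_fm ?\<rho> g = subst_fm (shift \<sigma>) g" if "g \<in> set gs" for g
    by (rule subst_fm_cong) (use that gs k in \<open>auto simp: shift_def\<close>)
  moreover have "subst_fm ?\<rho> (inst \<sigma> (Var \<sigma> k) \<chi>) = \<chi>"
    unfolding inst_def subst_fm_subst_fm
    by (rule subst_fm_ident) (use k in \<open>auto split: nat.split\<close>)
  ultimately have "proves T {} (foldr Imp (map (subst_fm (shift \<sigma>)) gs) \<chi>)"
    by (simp cong: map_cong)
  then have "proves T (subst_fm (shift \<sigma>) ` \<Gamma>) (foldr Imp (map (subst_fm (shift \<sigma>)) gs) \<chi>)"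
    by (rule proves_mono) simp
  then have "proves T (subst_fm (shift \<sigma>) ` \<Gamma>) \<chi>"
    by (rule proves_foldr_ImpE) (simp add: gs)
  then show ?thesis
    by (rule proves.ForallI)
qed

lemma proves_cut:
  "wf_fm \<phi> \<Longrightarrow> proves T (insert \<phi> \<Gamma>) \<psi> \<Longrightarrow> proves T \<Gamma> \<phi> \<Longrightarrow> proves T \<Gamma> \<psi>"
  using proves.ImpE proves.ImpI by blast

section \<open>Maximal consistent sets with witnesses\<close>

definition consistent :: "fm set \<Rightarrow> fm set \<Rightarrow> bool" where
  "consistent T \<Gamma> \<longleftrightarrow> (\<forall>\<gamma>\<in>\<Gamma>. wf_fm \<gamma>) \<and> \<not> proves T \<Gamma> Falsum"

lemma consistent_witness:
  assumes "finite \<Gamma>" "consistent T \<Gamma>" "\<^bold>\<not> ForallB \<sigma> \<chi> \<in> \<Gamma>"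
  obtains k where "consistent T (insert (\<^bold>\<not> inst \<sigma> (Var \<sigma> k) \<chi>) \<Gamma>)"
proof -
  have "finite (snd ` (\<Union>\<gamma>\<in>\<Gamma>. fv \<gamma>))"
    using assms by auto
  then obtain k where k: "k \<notin> snd ` (\<Union>\<gamma>\<in>\<Gamma>. fv \<gamma>)"
    using ex_new_if_finite infinite_UNIV_nat by blast
  have fr: "\<forall>\<gamma>\<in>\<Gamma>. (\<sigma>, k) \<notin> fv \<gamma>"
  proof (intro ballI notI)
    fix \<gamma> assume "\<gamma> \<in> \<Gamma>" "(\<sigma>, k) \<in> fv \<gamma>"
    then have "snd (\<sigma>, k) \<in> snd ` (\<Union>\<gamma>\<in>\<Gamma>. fv \<gamma>)"
      by (intro imageI) auto
    then show False
      using k by simp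
  qed
  have wf: "wf_fm (ForallB \<sigma> \<chi>)" "wf_fm (inst \<sigma> (Var \<sigma> k) \<chi>)"
    using assms by (auto simp: consistent_def intro!: wf_inst)
  have "\<not> proves T (insert (\<^bold>\<not> inst \<sigma> (Var \<sigma> k) \<chi>) \<Gamma>) Falsum"
  proof
    assume "proves T (insert (\<^bold>\<not> inst \<sigma> (Var \<sigma> k) \<chi>) \<Gamma>) Falsum"
    with wf(2) have "proves T \<Gamma> (inst \<sigma> (Var \<sigma> k) \<chi>)"
      by (rule proves.Classical)
    then have "proves T \<Gamma> (ForallB \<sigma> \<chi>)"
      using assms fr by (intro proves_generalize[where k = k]) (auto simp: consistent_def)
    moreover have "proves T \<Gamma> (ForallB \<sigma> \<chi> \<^bold>\<longrightarrow> Falsum)"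
      using assms(3) by (simp add: Neg_def proves.Assumption)
    ultimately show False
      using assms(2) proves.ImpE consistent_def by blast
  qed
  then show ?thesis
    using that wf assms(2) by (auto simp: consistent_def)
qed

instance ty :: countable by countable_datatype
instance tm :: countable by countable_datatype
instance fm :: countable by countable_datatype

locale henkin =
  fixes T H :: "fm set"
  assumes con: "consistent T H"
    and maximal: "wf_fm \<psi> \<Longrightarrow> consistent T (insert \<psi> H) \<Longrightarrow> \<psi> \<in> H"
    and witness: "\<^bold>\<not> ForallB \<sigma> \<chi> \<in> H \<Longrightarrow> \<exists>t. has_type t \<sigma> \<and> \<^bold>\<not> inst \<sigma> t \<chi> \<in> H"

text \<open>Lindenbaum's construction along an enumeration of all formulas. Starting from a finite
  set keeps every stage finite, so that fresh variables never run out; only the union may mention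
  all of them.\<close>

lemma henkin_extension:
  assumes "finite \<Gamma>" "consistent T \<Gamma>"
  obtains H where "henkin T H" "\<Gamma> \<subseteq> H"
proof -
  define P where "P = (\<lambda>(n::nat) \<Delta>. finite \<Delta> \<and> consistent T \<Delta> \<and> \<Gamma> \<subseteq> \<Delta>)"
  \<comment> \<open>Stage \<open>n\<close> treats the \<open>n\<close>-th formula: if it is
    consistent with the stage it is added, and a negated universal formula receives its witness at
    the same time.\<close>
  define Q where "Q = (\<lambda>n \<Delta> \<Delta>'. \<Delta> \<subseteq> \<Delta>' \<and> (\<forall>\<psi>. from_nat n = \<psi> \<longrightarrow> consistent T (insert \<psi> \<Delta>) \<longrightarrow>
      \<psi> \<in> \<Delta>' \<and> (\<forall>\<sigma> \<chi>. \<psi> = \<^bold>\<not> ForallB \<sigma> \<chi> \<longrightarrow> (\<exists>t. has_type t \<sigma> \<and> \<^bold>\<not> inst \<sigma> t \<chi> \<in> \<Delta>'))))"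
  have step: "\<exists>\<Delta>'. P (Suc n) \<Delta>' \<and> Q n \<Delta> \<Delta>'" if P: "P n \<Delta>" for n \<Delta>
  proof (cases "consistent T (insert (from_nat n) \<Delta>)")
    case True
    show ?thesis
    proof (cases "\<exists>\<sigma> \<chi>. from_nat n = \<^bold>\<not> ForallB \<sigma> \<chi>")
      case True
      then obtain \<sigma> \<chi> where \<chi>: "from_nat n = \<^bold>\<not> ForallB \<sigma> \<chi>" by blast
      obtain k where
        "consistent T (insert (\<^bold>\<not> inst \<sigma> (Var \<sigma> k) \<chi>) (insert (from_nat n) \<Delta>))"
        by (rule consistent_witness[of "insert (from_nat n) \<Delta>" T \<sigma> \<chi>])
          (use P \<chi> \<open>consistent T (insert (from_nat n) \<Delta>)\<close> in \<open>auto simp: P_def\<close>)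
      then show ?thesis
        using P \<chi>
        by (intro exI[of _ "insert (\<^bold>\<not> inst \<sigma> (Var \<sigma> k) \<chi>) (insert (from_nat n) \<Delta>)"])
          (auto simp: P_def Q_def Neg_def intro!: exI[of _ "Var \<sigma> k"])
    next
      case False
      then show ?thesis
        using P True by (intro exI[of _ "insert (from_nat n) \<Delta>"]) (auto simp: P_def Q_def)
    qed
  next
    case False
    then show ?thesis
      using P by (intro exI[of _ \<Delta>]) (auto simp: P_def Q_def)
  qed
  have "\<exists>\<Delta>. P 0 \<Delta>"
    using assms by (auto simp: P_def)
  then obtain G where G: "\<And>n. P n (G n)" "\<And>n. Q n (G n) (G (Suc n))"
    using dependent_nat_choice[of P Q] step by metis
  have mono: "m \<le> n \<Longrightarrow> G m \<subseteq> G n" for m n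
    using G(2) lift_Suc_mono_le[of G] by (simp add: Q_def)
  define H where "H = (\<Union>n. G n)"
  have fin: "\<exists>n. \<Delta> \<subseteq> G n" if "finite \<Delta>" "\<Delta> \<subseteq> H" for \<Delta>
    using that
  proof (induction rule: finite_induct)
    case (insert x \<Delta>)
    then obtain m n where "x \<in> G m" "\<Delta> \<subseteq> G n"
      by (auto simp: H_def)
    then show ?case
      using mono[of m "max m n"] mono[of n "max m n"] by (intro exI[of _ "max m n"]) auto
  qed simp
  have con: "consistent T H"
    unfolding consistent_def
  proof (intro conjI notI)
    show "\<forall>\<gamma>\<in>H. wf_fm \<gamma>"
      using G(1) by (auto simp: H_def P_def consistent_def)
    assume "proves T H Falsum"
    then obtain n where "proves T (G n) Falsum"
      using proves_finite fin proves_mono by metis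
    then show False
      using G(1) by (auto simp: P_def consistent_def)
  qed
  \<comment> \<open>Consistency with the union passes down to each stage, so a formula consistent
    with \<open>H\<close> was accepted at its own stage.\<close>
  have add: "consistent T (insert \<psi> (G n))" if "consistent T (insert \<psi> H)" for \<psi> n
    using that proves_mono[of T "insert \<psi> (G n)" Falsum "insert \<psi> H"]
    by (auto simp: consistent_def H_def)
  have "henkin T H"
  proof
    show "consistent T H" by fact
  next
    fix \<psi> assume "consistent T (insert \<psi> H)"
    from add[OF this, of "to_nat \<psi>"] have "\<psi> \<in> G (Suc (to_nat \<psi>))"
      using G(2)[of "to_nat \<psi>"] by (auto simp: Q_def)
    then show "\<psi> \<in> H"
      by (auto simp: H_def)
  next
    fix \<sigma> \<chi> assume *: "\<^bold>\<not> ForallB \<sigma> \<chi> \<in> H"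
    let ?n = "to_nat (\<^bold>\<not> ForallB \<sigma> \<chi>)"
    \<comment> \<open>A negated universal formula that lies in \<open>H\<close> may have entered
      early. Its own stage treats it again and supplies the witness.\<close>
    have "consistent T (insert (\<^bold>\<not> ForallB \<sigma> \<chi>) H)"
      using * con by (simp add: insert_absorb)
    from add[OF this, of ?n] have "\<exists>t. has_type t \<sigma> \<and> \<^bold>\<not> inst \<sigma> t \<chi> \<in> G (Suc ?n)"
      using G(2)[of ?n] by (auto simp: Q_def)
    then show "\<exists>t. has_type t \<sigma> \<and> \<^bold>\<not> inst \<sigma> t \<chi> \<in> H"
      by (auto simp: H_def)
  qed
  moreover have "\<Gamma> \<subseteq> H"
    using G(1)[of 0] by (auto simp: H_def P_def)
  ultimately show ?thesis
    using that by blast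
qed

context type_structure
begin

text \<open>The semantic counterpart of \<open>eq_at\<close>, defined without assuming that
  application respects it. That it is a congruence depends on the axiom of extensionality.\<close>

primrec eqv :: "ty \<Rightarrow> 'a \<Rightarrow> 'a \<Rightarrow> bool" where
  "eqv N x y = eqN x y"
| "eqv (\<sigma> \<rightarrow> \<tau>) x y = (\<forall>d\<in>D \<sigma>. eqv \<tau> (x \<bullet> d) (y \<bullet> d))"

lemma sat_eq_at_eqv: "sat e (eq_at \<sigma> s t) = eqv \<sigma> (ev e s) (ev e t)"
proof (induction \<sigma> arbitrary: e s t)
  case (Fn \<sigma> \<tau>)
  show ?case
    unfolding eq_at.simps eqv.simps
    by (rule sat_Forall[where C = "fv_tm s \<union> fv_tm t"]) (auto simp: Fn.IH)
qed simp

lemma sat_Extensionality: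
  "sat e (Forall (\<rho> \<rightarrow> \<tau>) (\<lambda>f. Forall \<rho> (\<lambda>x. Forall \<rho> (\<lambda>y.
      eq_at \<rho> x y \<^bold>\<longrightarrow> eq_at \<tau> (f \<cdot> x) (f \<cdot> y))))) \<longleftrightarrow>
    (\<forall>f\<in>D (\<rho> \<rightarrow> \<tau>). \<forall>x\<in>D \<rho>. \<forall>y\<in>D \<rho>. eqv \<rho> x y \<longrightarrow> eqv \<tau> (f \<bullet> x) (f \<bullet> y))"
proof (rule sat_Forall[where C = "{}"], goal_cases)
  case (1 f)
  then show ?case
    by (auto intro!: fv_Forall[where C = "fv_tm f"] fv_Forall)
next
  case (2 e f)
  show ?case
  proof (rule sat_Forall[where C = "fv_tm f"], goal_cases)
    case (1 x)
    then show ?case by (auto intro!: fv_Forall)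
  next
    case (2 e' x)
    then show ?case
      by (intro sat_Forall[where C = "fv_tm f \<union> fv_tm x"]) (auto simp: sat_eq_at_eqv)
  qed
qed

end

section \<open>The term model and its truth lemma\<close>

context henkin
begin

lemma wf_H: "\<phi> \<in> H \<Longrightarrow> wf_fm \<phi>"
  using con by (auto simp: consistent_def)

lemma H_closed: 
  assumes "proves T H \<phi>" "wf_fm \<phi>"
  shows "\<phi> \<in> H"
proof (rule maximal)
  show "consistent T (insert \<phi> H)"
    using con assms proves_cut by (auto simp: consistent_def)
qed fact

lemma H_mem: "\<phi> \<in> H \<Longrightarrow> proves T H \<phi>"
  by (rule proves.Assumption)

lemma Falsum_H: "Falsum \<notin> H"
  using con H_mem by (auto simp: consistent_def)

lemma Imp_H:
  assumes "wf_fm \<phi>" "wf_fm \<psi>"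
  shows "(\<phi> \<^bold>\<longrightarrow> \<psi>) \<in> H \<longleftrightarrow> (\<phi> \<in> H \<longrightarrow> \<psi> \<in> H)"
proof
  assume "(\<phi> \<^bold>\<longrightarrow> \<psi>) \<in> H"
  then show "\<phi> \<in> H \<longrightarrow> \<psi> \<in> H"
    using assms by (blast intro: H_closed proves.ImpE[OF H_mem H_mem])
next
  assume *: "\<phi> \<in> H \<longrightarrow> \<psi> \<in> H"
  show "(\<phi> \<^bold>\<longrightarrow> \<psi>) \<in> H"
  proof (cases "\<phi> \<in> H")
    case True
    with * have "proves T (insert \<phi> H) \<psi>"
      by (auto intro: proves.Assumption)
    then show ?thesis
      using assms by (auto intro: H_closed proves.ImpI)
  next
    case False
    then have "proves T (insert \<phi> H) Falsum"
      using maximal[OF assms(1)] con assms(1) by (auto simp: consistent_def)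
    then have "proves T (insert (\<^bold>\<not> \<psi>) (insert \<phi> H)) Falsum"
      by (rule proves_mono) auto
    then have "proves T (insert \<phi> H) \<psi>"
      by (rule proves.Classical[OF assms(2)])
    then show ?thesis
      using assms by (auto intro: H_closed proves.ImpI)
  qed
qed

lemma ForallB_H:
  assumes "wf_fm \<phi>"
  shows "ForallB \<sigma> \<phi> \<in> H \<longleftrightarrow> (\<forall>t. has_type t \<sigma> \<longrightarrow> inst \<sigma> t \<phi> \<in> H)"
proof
  assume "ForallB \<sigma> \<phi> \<in> H"
  then show "\<forall>t. has_type t \<sigma> \<longrightarrow> inst \<sigma> t \<phi> \<in> H"
    using assms by (auto intro: H_closed wf_inst proves.ForallE[OF H_mem])
next
  assume *: "\<forall>t. has_type t \<sigma> \<longrightarrow> inst \<sigma> t \<phi> \<in> H"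
  show "ForallB \<sigma> \<phi> \<in> H"
  proof (rule ccontr)
    assume "ForallB \<sigma> \<phi> \<notin> H"
    then have "\<^bold>\<not> ForallB \<sigma> \<phi> \<in> H"
      using assms by (simp add: Neg_def Imp_H)
    then obtain t where "has_type t \<sigma>" "\<^bold>\<not> inst \<sigma> t \<phi> \<in> H"
      using witness by blast
    then show False
      using * assms Falsum_H wf_inst[OF assms] by (simp add: Neg_def Imp_H)
  qed
qed

sublocale term_model: type_structure "\<lambda>\<sigma>. {t. has_type t \<sigma>}" App Zero Succ Rec0 CombK CombS
    "\<lambda>s t. (s \<doteq> t) \<in> H"
  by unfold_locales (auto intro: has_type.intros)

lemma typed_term_model: "term_model.typed \<theta> \<longleftrightarrow> typed_subst \<theta>"
  by (simp add: term_model.typed_def typed_subst_def)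

lemma ev_term_model: "term_model.ev \<theta> t = subst_tm \<theta> t"
  by (induction t) auto

text \<open>An environment of the term model is a substitution, and pushing a value corresponds to
  instantiating the bound variable. The quantifier step is therefore \<open>ForallB_H\<close>, which
  rests on the witnesses.\<close>

lemma sat_term_model: "typed_subst \<theta> \<Longrightarrow> wf_fm \<phi> \<Longrightarrow> term_model.sat \<theta> \<phi> \<longleftrightarrow> subst_fm \<theta> \<phi> \<in> H"
proof (induction \<phi> arbitrary: \<theta>)
  case (ForallB \<sigma> \<phi>)
  have "inst \<sigma> t (subst_fm (under \<sigma> \<theta>) \<phi>) = subst_fm (push \<sigma> t \<theta>) \<phi>" for t
  proof -
    have *: "subst_tm (\<lambda>\<tau> n. if \<tau> = \<sigma> then case n of 0 \<Rightarrow> t | Suc k \<Rightarrow> Var \<sigma> k else Var \<tau> n)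
        (subst_tm (shift \<sigma>) u) = u" for u
    proof -
      have "(\<lambda>\<tau> n. subst_tm (\<lambda>\<tau> n. if \<tau> = \<sigma> then case n of 0 \<Rightarrow> t | Suc k \<Rightarrow> Var \<sigma> k else Var \<tau> n)
          (shift \<sigma> \<tau> n)) = Var"
        by (auto simp: fun_eq_iff shift_def)
      then show ?thesis
        unfolding subst_tm_subst_tm by simp
    qed
    show ?thesis
      unfolding inst_def subst_fm_subst_fm
      by (rule subst_fm_cong) (auto simp: under_def push_def * split: nat.split)
  qed
  moreover have "typed_subst (push \<sigma> t \<theta>)" if "has_type t \<sigma>" for t
    using that ForallB.prems term_model.typed_push[of \<theta> t \<sigma>] by (simp add: typed_term_model)
  ultimately show ?case
    using ForallB by (simp add: ForallB_H wf_subst typed_subst_under)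
qed (auto simp: ev_term_model Falsum_H Imp_H wf_subst)

text \<open>Free variables of axioms are universal. As a formula provable from \<open>T\<close> alone may be
  generalized, we proceed by recursion on the indices of its free variables.\<close>

lemma sat_proved:
  assumes "proves T {} \<phi>" "wf_fm \<phi>" "typed_subst \<theta>"
  shows "term_model.sat \<theta> \<phi>"
  using assms
proof (induction "\<Sum>x\<in>fv \<phi>. Suc (snd x)" arbitrary: \<phi> \<theta> rule: less_induct)
  case less
  have typed_Var: "typed_subst Var"
    by (simp add: typed_subst_def)
  show ?case
  proof (cases "fv \<phi> = {}")
    case True
    have "proves T H \<phi>"
      using less.prems(1) by (rule proves_mono) simp
    then have "term_model.sat Var \<phi>"
      using H_closed sat_term_model[OF typed_Var] less.prems by simp
    then show ?thesis
      using term_model.sat_cong[of \<phi> Var \<theta>] True by simp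
  next
    case False
    then obtain \<sigma> k where k: "(\<sigma>, k) \<in> fv \<phi>"
      by auto
    let ?f = "\<lambda>(\<tau>, n). (\<tau>, if \<tau> = \<sigma> then Suc n else n)"
    have inj: "inj ?f"
      by (auto simp: inj_def split: if_splits)
    have img: "?f ` fv (ForallB \<sigma> \<phi>) = fv \<phi> - {(\<sigma>, 0)}"
    proof
      show "fv \<phi> - {(\<sigma>, 0)} \<subseteq> ?f ` fv (ForallB \<sigma> \<phi>)"
      proof
        fix x assume "x \<in> fv \<phi> - {(\<sigma>, 0)}"
        then show "x \<in> ?f ` fv (ForallB \<sigma> \<phi>)"
          by (intro image_eqI[of _ _ "(fst x, if fst x = \<sigma> then snd x - 1 else snd x)"])
            (cases x; auto)+
      qed
    qed auto
    have reindex: "(\<Sum>x\<in>fv (ForallB \<sigma> \<phi>). Suc (snd (?f x))) = (\<Sum>x\<in>fv \<phi> - {(\<sigma>, 0)}. Suc (snd x))"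
      unfolding img[symmetric] using inj_on_subset[OF inj subset_UNIV]
      by (subst sum.reindex) (simp_all add: o_def)
    \<comment> \<open>Prefixing the quantifier either absorbs the variable with index zero or, if it
      is absent, lowers the index of the occurring variable \<open>k\<close>. Both make the sum
      strictly smaller.\<close>
    have "(\<Sum>x\<in>fv (ForallB \<sigma> \<phi>). Suc (snd x)) < (\<Sum>x\<in>fv \<phi>. Suc (snd x))"
    proof (cases "(\<sigma>, 0) \<in> fv \<phi>")
      case True
      have "(\<Sum>x\<in>fv (ForallB \<sigma> \<phi>). Suc (snd x)) \<le> (\<Sum>x\<in>fv (ForallB \<sigma> \<phi>). Suc (snd (?f x)))"
        by (rule sum_mono) auto
      also have "\<dots> < (\<Sum>x\<in>fv \<phi>. Suc (snd x))"
        unfolding reindex using True by (subst sum.remove[of "fv \<phi>" "(\<sigma>, 0)"]) auto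
      finally show ?thesis .
    next
      case False
      then have "(\<sigma>, k - 1) \<in> fv (ForallB \<sigma> \<phi>)"
        using k by (cases k) auto
      then have "(\<Sum>x\<in>fv (ForallB \<sigma> \<phi>). Suc (snd x)) < (\<Sum>x\<in>fv (ForallB \<sigma> \<phi>). Suc (snd (?f x)))"
        by (intro sum_strict_mono_ex1 bexI[of _ "(\<sigma>, k - 1)"] finite_fv) auto
      also have "\<dots> = (\<Sum>x\<in>fv \<phi>. Suc (snd x))"
        unfolding reindex using False by simp
      finally show ?thesis .
    qed
    moreover have "proves T {} (ForallB \<sigma> \<phi>)"
      using less.prems(1) by (intro proves.ForallI) simp
    moreover have "typed_subst (\<lambda>\<tau> n. \<theta> \<tau> (if \<tau> = \<sigma> then Suc n else n))"
      using less.prems(3) by (simp add: typed_subst_def)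
    ultimately have "term_model.sat (\<lambda>\<tau> n. \<theta> \<tau> (if \<tau> = \<sigma> then Suc n else n)) (ForallB \<sigma> \<phi>)"
      using less.prems(2) by (intro less.hyps) simp_all
    moreover have "has_type (\<theta> \<sigma> 0) \<sigma>"
      using less.prems(3) by (simp add: typed_subst_def)
    ultimately have "term_model.sat (push \<sigma> (\<theta> \<sigma> 0) (\<lambda>\<tau> n. \<theta> \<tau> (if \<tau> = \<sigma> then Suc n else n))) \<phi>"
      by simp
    moreover have "push \<sigma> (\<theta> \<sigma> 0) (\<lambda>\<tau> n. \<theta> \<tau> (if \<tau> = \<sigma> then Suc n else n)) = \<theta>"
      by (auto simp: push_def fun_eq_iff split: nat.split)
    ultimately show ?thesis by simp
  qed
qed

end

lemma wf_RCA0\<omega>: "\<phi> \<in> RCA0\<omega> \<Longrightarrow> wf_fm \<phi>"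
proof (induction rule: RCA0\<omega>.induct)
  case (QF_IND \<phi> n)
  then show ?case
    by (auto simp: has_type_App intro!: wf_replace wf_ForallV)
next
  case (QF_AC_1_0 \<phi> Y f n)
  then show ?case
    by (auto intro!: wf_replace wf_ForallV wf_ExistsV intro: has_type.intros)
qed (auto simp: has_type_App intro!: wf_Forall wf_eq_at, blast+)

section \<open>The extensional quotient of the term model\<close>

locale henkin_RCA = henkin +
  assumes RCA: "RCA0\<omega> \<subseteq> T"
begin

abbreviation "eqv \<equiv> term_model.eqv"

lemma eqv_N_refl: "has_type s N \<Longrightarrow> eqv N s s"
  by (simp add: H_closed proves.EqRefl)

lemma eqN_subst:
  assumes "(s \<doteq> t) \<in> H" "inst N s \<phi> \<in> H" "wf_fm \<phi>" "has_type t N"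
  shows "inst N t \<phi> \<in> H"
  using assms by (blast intro: H_closed proves.EqSubst[OF _ H_mem H_mem] wf_inst)

text \<open>These are equations with one marked place for replacement. The fixed side is shifted
  beforehand so that instantiation leaves it alone; symmetry and transitivity are then instances of
  \<open>eqN_subst\<close>.\<close>

lemma inst_eqs: "inst N u (Var N 0 \<doteq> subst_tm (shift N) s) = (u \<doteq> s)"
  "inst N u (subst_tm (shift N) s \<doteq> Var N 0) = (s \<doteq> u)"
proof -
  have "subst_tm (\<lambda>\<tau> n. if \<tau> = N then case n of 0 \<Rightarrow> u | Suc k \<Rightarrow> Var N k else Var \<tau> n) (subst_tm (shift N) s) = s"
    unfolding subst_tm_subst_tm
    by (rule trans[OF subst_tm_cong[of _ _ Var] subst_tm_Var]) (auto simp: shift_def)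
  then show "inst N u (Var N 0 \<doteq> subst_tm (shift N) s) = (u \<doteq> s)"
    "inst N u (subst_tm (shift N) s \<doteq> Var N 0) = (s \<doteq> u)"
    by (simp_all add: inst_def)
qed

lemma eqN_sym:
  assumes "(s \<doteq> t) \<in> H" 
  shows "(t \<doteq> s) \<in> H"
proof -
  have "has_type s N" "has_type t N"
    using wf_H[OF assms] by auto
  then show ?thesis
    using eqN_subst[of s t "Var N 0 \<doteq> subst_tm (shift N) s"] eqv_N_refl[of s] assms
    by (simp add: inst_eqs has_type_subst)
qed

lemma eqN_trans:
  assumes "(s \<doteq> t) \<in> H" "(t \<doteq> u) \<in> H"
  shows "(s \<doteq> u) \<in> H"
proof -
  have "has_type s N" "has_type t N" "has_type u N"
    using wf_H[OF assms(1)] wf_H[OF assms(2)] by auto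
  then show ?thesis
    using eqN_subst[of t u "subst_tm (shift N) s \<doteq> Var N 0"] assms
    by (simp add: inst_eqs has_type_subst)
qed

lemma eqv_refl: "has_type s \<sigma> \<Longrightarrow> eqv \<sigma> s s"
  by (induction \<sigma> arbitrary: s) (auto simp: eqv_N_refl[simplified] intro: has_type.intros)

lemma eqv_sym: "eqv \<sigma> s t \<Longrightarrow> eqv \<sigma> t s"
  by (induction \<sigma> arbitrary: s t) (auto simp: eqN_sym)

lemma eqv_trans: "eqv \<sigma> s t \<Longrightarrow> eqv \<sigma> t u \<Longrightarrow> eqv \<sigma> s u"
proof (induction \<sigma> arbitrary: s t u)
  case (Fn \<sigma> \<tau>)
  then show ?case by (simp, blast)
qed (use eqN_trans in simp)

text \<open>Changing the function is harmless by the definition of \<open>eqv\<close> at arrow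
  types. Changing the argument is exactly what the axiom of extensionality permits.\<close>

lemma eqv_App:
  assumes "has_type s (\<sigma> \<rightarrow> \<tau>)" "has_type s' (\<sigma> \<rightarrow> \<tau>)" "eqv (\<sigma> \<rightarrow> \<tau>) s s'"
    and "has_type t \<sigma>" "has_type t' \<sigma>" "eqv \<sigma> t t'"
  shows "eqv \<tau> (s \<cdot> t) (s' \<cdot> t')"
proof -
  have typed_Var: "typed_subst Var"
    by (simp add: typed_subst_def)
  let ?ext = "Forall (\<sigma> \<rightarrow> \<tau>) (\<lambda>f. Forall \<sigma> (\<lambda>x. Forall \<sigma> (\<lambda>y.
    eq_at \<sigma> x y \<^bold>\<longrightarrow> eq_at \<tau> (f \<cdot> x) (f \<cdot> y))))"
  have "?ext \<in> RCA0\<omega>"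
    by (rule RCA0\<omega>.Extensionality)
  then have "proves T {} ?ext"
    using RCA by (blast intro: proves.Axiom)
  then have "term_model.sat Var ?ext"
    using \<open>?ext \<in> RCA0\<omega>\<close> typed_Var by (intro sat_proved wf_RCA0\<omega>)
  then have "eqv \<tau> (s' \<cdot> t) (s' \<cdot> t')"
    unfolding term_model.sat_Extensionality using assms by blast
  moreover have "eqv \<tau> (s \<cdot> t) (s' \<cdot> t)"
    using assms by simp
  ultimately show ?thesis
    using eqv_trans by blast
qed

definition cls :: "tm \<Rightarrow> tm set" where
  "cls t = {t'. \<exists>\<sigma>. has_type t \<sigma> \<and> has_type t' \<sigma> \<and> eqv \<sigma> t t'}"

text \<open>The representatives are arbitrary; \<open>eqv_App\<close> makes the result independent
  of them.\<close>

definition ap_cls :: "tm set \<Rightarrow> tm set \<Rightarrow> tm set" where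
  "ap_cls X Y = cls ((SOME s. s \<in> X) \<cdot> (SOME t. t \<in> Y))"

definition D_cls :: "ty \<Rightarrow> tm set set" where
  "D_cls \<sigma> = cls ` {t. has_type t \<sigma>}"

lemma cls_eq_iff: "has_type s \<sigma> \<Longrightarrow> has_type t \<sigma> \<Longrightarrow> cls s = cls t \<longleftrightarrow> eqv \<sigma> s t"
proof
  assume "has_type s \<sigma>" "has_type t \<sigma>" "cls s = cls t"
  then have "t \<in> cls s"
    using eqv_refl by (auto simp: cls_def)
  then show "eqv \<sigma> s t"
    using \<open>has_type s \<sigma>\<close> has_type_unique by (auto simp: cls_def)
next
  assume "has_type s \<sigma>" "has_type t \<sigma>" "eqv \<sigma> s t"
  then show "cls s = cls t"
    using has_type_unique eqv_sym eqv_trans unfolding cls_def by (smt (verit) Collect_cong)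
qed

lemma some_cls:
  assumes "has_type t \<sigma>"
  shows "has_type (SOME s. s \<in> cls t) \<sigma>" "eqv \<sigma> (SOME s. s \<in> cls t) t"
proof -
  have "(SOME s. s \<in> cls t) \<in> cls t"
    by (rule someI[of _ t]) (use assms eqv_refl in \<open>auto simp: cls_def\<close>)
  then obtain \<tau> where "has_type t \<tau>" "has_type (SOME s. s \<in> cls t) \<tau>" "eqv \<tau> t (SOME s. s \<in> cls t)"
    unfolding cls_def by blast
  then show "has_type (SOME s. s \<in> cls t) \<sigma>" "eqv \<sigma> (SOME s. s \<in> cls t) t"
    using assms has_type_unique eqv_sym by metis+
qed

lemma ap_cls:
  assumes "has_type s (\<sigma> \<rightarrow> \<tau>)" "has_type t \<sigma>"
  shows "ap_cls (cls s) (cls t) = cls (s \<cdot> t)"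
  unfolding ap_cls_def using some_cls[OF assms(1)] some_cls[OF assms(2)] assms
  by (subst cls_eq_iff[of _ \<tau>]) (blast intro: eqv_App has_type.intros)+

sublocale quotient: type_structure D_cls ap_cls "cls Zero" "cls Succ" "cls Rec0"
    "\<lambda>\<rho> \<tau>. cls (CombK \<rho> \<tau>)" "\<lambda>\<delta> \<rho> \<tau>. cls (CombS \<delta> \<rho> \<tau>)" "(=)"
  by unfold_locales (auto simp: D_cls_def ap_cls intro!: imageI intro: has_type.intros)

text \<open>Agreement on all classes of arguments is, for the representatives, the definition of
  \<open>eqv\<close> at an arrow type, and equivalent terms have the same class.\<close>

lemma quotient_extensional:
  assumes "f \<in> D_cls (\<sigma> \<rightarrow> \<tau>)" "g \<in> D_cls (\<sigma> \<rightarrow> \<tau>)" "\<forall>x\<in>D_cls \<sigma>. ap_cls f x = ap_cls g x"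
  shows "f = g"
proof -
  obtain s t where st: "has_type s (\<sigma> \<rightarrow> \<tau>)" "f = cls s" "has_type t (\<sigma> \<rightarrow> \<tau>)" "g = cls t"
    using assms by (auto simp: D_cls_def)
  then have "eqv \<tau> (s \<cdot> d) (t \<cdot> d)" if "has_type d \<sigma>" for d
    using that assms(3) cls_eq_iff[of "s \<cdot> d" \<tau> "t \<cdot> d"]
    by (auto simp: D_cls_def ap_cls has_type.intros)
  then show ?thesis
    using st by (simp add: cls_eq_iff)
qed

lemma ball_D_cls: "(\<forall>d\<in>D_cls \<sigma>. P d) \<longleftrightarrow> (\<forall>t. has_type t \<sigma> \<longrightarrow> P (cls t))"
  by (auto simp: D_cls_def)

lemma ev_quotient:
  "has_type t \<tau> \<Longrightarrow> typed_subst \<theta> \<Longrightarrow> quotient.ev (\<lambda>\<sigma> n. cls (\<theta> \<sigma> n)) t = cls (subst_tm \<theta> t)"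
proof (induction rule: has_type.induct)
  case (7 s \<sigma> \<tau> t)
  then show ?case
    using ap_cls[of "subst_tm \<theta> s" \<sigma> \<tau> "subst_tm \<theta> t"] by (simp add: has_type_subst)
qed auto

lemma sat_quotient:
  "wf_fm \<phi> \<Longrightarrow> typed_subst \<theta> \<Longrightarrow> quotient.sat (\<lambda>\<sigma> n. cls (\<theta> \<sigma> n)) \<phi> = term_model.sat \<theta> \<phi>"
proof (induction \<phi> arbitrary: \<theta>)
  case (Eq s t)
  then show ?case
    by (simp add: ev_quotient[of _ N] cls_eq_iff[of _ N] has_type_subst ev_term_model)
next
  case (ForallB \<sigma> \<phi>)
  have "push \<sigma> (cls t) (\<lambda>\<tau> n. cls (\<theta> \<tau> n)) = (\<lambda>\<tau> n. cls (push \<sigma> t \<theta> \<tau> n))" for t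
    by (auto simp: push_def fun_eq_iff split: nat.split)
  moreover have "typed_subst (push \<sigma> t \<theta>)" if "has_type t \<sigma>" for t
    using that ForallB.prems term_model.typed_push[of \<theta> t \<sigma>] by (simp add: typed_term_model)
  ultimately show ?case
    using ForallB by (simp add: ball_D_cls)
qed auto

lemma quotient_typed:
  assumes "quotient.typed e"
  obtains \<theta> where "typed_subst \<theta>" "e = (\<lambda>\<sigma> n. cls (\<theta> \<sigma> n))"
proof -
  have "\<forall>\<sigma> n. \<exists>t. has_type t \<sigma> \<and> e \<sigma> n = cls t"
    using assms unfolding quotient.typed_def D_cls_def by blast
  then obtain \<theta> where "\<forall>\<sigma> n. has_type (\<theta> \<sigma> n) \<sigma> \<and> e \<sigma> n = cls (\<theta> \<sigma> n)"
    by metis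
  then show ?thesis
    by (intro that[of \<theta>]) (auto simp: typed_subst_def fun_eq_iff)
qed

end

text \<open>In the quotient, equality of numbers is identity and functions are determined by their
  values, so equations of the formal system become equations of HOL. The axioms hold under all typed
  environments, because their free variables act as parameters; \<open>e0\<close> supplies one such
  environment.\<close>

locale model = type_structure D ap zero succ recursor combK combS "(=)"
  for D :: "ty \<Rightarrow> 'a set" and ap :: "'a \<Rightarrow> 'a \<Rightarrow> 'a"  (infixl "\<bullet>" 100)
    and zero succ recursor :: 'a and combK :: "ty \<Rightarrow> ty \<Rightarrow> 'a" and combS :: "ty \<Rightarrow> ty \<Rightarrow> ty \<Rightarrow> 'a" +
  fixes T :: "fm set" and e0 :: "ty \<Rightarrow> nat \<Rightarrow> 'a"
  assumes extensional: "f \<in> D (\<sigma> \<rightarrow> \<tau>) \<Longrightarrow> g \<in> D (\<sigma> \<rightarrow> \<tau>) \<Longrightarrow> (\<And>x. x \<in> D \<sigma> \<Longrightarrow> f \<bullet> x = g \<bullet> x) \<Longrightarrow> f = g"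
    and sat_axiom: "\<phi> \<in> T \<Longrightarrow> typed e \<Longrightarrow> sat e \<phi>"
    and typed_e0: "typed e0"
    and RCA: "RCA0\<omega> \<subseteq> T"

text \<open>The countermodel is the quotient for a Henkin extension of the negated formula. The
  environment sends each variable to its own class, so that membership of the negation in
  \<open>H\<close> reads as falsity.\<close>

theorem completeness:
  assumes "RCA0\<omega> \<subseteq> T" "\<forall>\<phi>\<in>T. wf_fm \<phi>" "wf_fm \<phi>" "\<not> proves T {} \<phi>"
  obtains D ap zero succ recursor combK combS and e :: "ty \<Rightarrow> nat \<Rightarrow> tm set"
  where "model D ap zero succ recursor combK combS T e"
    "\<not> type_structure.sat D ap zero succ recursor combK combS (=) e \<phi>"
proof -
  have "consistent T {\<^bold>\<not> \<phi>}"
    using assms proves.Classical[of \<phi> T "{}"] by (auto simp: consistent_def)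
  then obtain H where "henkin T H" and H: "{\<^bold>\<not> \<phi>} \<subseteq> H"
    using henkin_extension[of "{\<^bold>\<not> \<phi>}" T] by blast
  then interpret henkin T H by simp
  interpret henkin_RCA T H
    by unfold_locales fact
  have Var: "typed_subst Var"
    by (simp add: typed_subst_def)
  have "model D_cls ap_cls (cls Zero) (cls Succ) (cls Rec0) (\<lambda>\<rho> \<tau>. cls (CombK \<rho> \<tau>))
      (\<lambda>\<delta> \<rho> \<tau>. cls (CombS \<delta> \<rho> \<tau>)) T (\<lambda>\<sigma> n. cls (Var \<sigma> n))"
  proof unfold_locales
    fix \<psi> e assume "\<psi> \<in> T" "quotient.typed e"
    then obtain \<theta> where \<theta>: "typed_subst \<theta>" "e = (\<lambda>\<sigma> n. cls (\<theta> \<sigma> n))"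
      using quotient_typed by blast
    show "quotient.sat e \<psi>"
      using \<theta> \<open>\<psi> \<in> T\<close> assms(2) by (simp add: sat_quotient sat_proved proves.Axiom)
  next
    show "quotient.typed (\<lambda>\<sigma> n. cls (Var \<sigma> n))"
      by (auto simp: quotient.typed_def D_cls_def)
  qed (use quotient_extensional assms in auto)
  moreover have "\<not> quotient.sat (\<lambda>\<sigma> n. cls (Var \<sigma> n)) \<phi>"
    using H Var assms(3) sat_term_model[of Var "\<^bold>\<not> \<phi>"] by (simp add: sat_quotient)
  ultimately show ?thesis
    using that by blast
qed

section \<open>Semantics of the defined notions\<close>

text \<open>Since \<open>Zero\<close> has no variables, the set \<open>C\<close> of
  \<open>fv_Forall\<close> can be recovered as \<open>fv (\<phi> Zero)\<close>. In this form the
  simplifier needs no guess for it.\<close>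

lemma fv_Forall_simp:
  "(\<And>x. fv (\<phi> x) = fv_tm x \<union> fv (\<phi> Zero)) \<Longrightarrow> fv (Forall \<sigma> \<phi>) = fv (\<phi> Zero)"
  by (rule fv_Forall)

lemma fv_Exists_simp:
  "(\<And>x. fv (\<phi> x) = fv_tm x \<union> fv (\<phi> Zero)) \<Longrightarrow> fv (Exists \<sigma> \<phi>) = fv (\<phi> Zero)"
  by (rule fv_Exists)

lemma fv_arith [simp]:
  "fv_tm (iterate g m) = fv_tm g \<union> fv_tm m" "fv_tm (m \<oplus> n) = fv_tm m \<union> fv_tm n"
  "fv_tm (m \<otimes> n) = fv_tm m \<union> fv_tm n" "fv_tm (m \<ominus> n) = fv_tm m \<union> fv_tm n"
  "fv_tm two = {}" "fv_tm (pow2 n) = fv_tm n" "fv_tm (absdiff m n) = fv_tm m \<union> fv_tm n"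
  "fv_tm (pos_part x n) = fv_tm x \<union> fv_tm n" "fv_tm (neg_part x n) = fv_tm x \<union> fv_tm n"
  "fv_tm (denom x n) = fv_tm x \<union> fv_tm n"
  "fv_tm (dist_num x n y m) = fv_tm x \<union> fv_tm n \<union> fv_tm y \<union> fv_tm m"
  "fv (le_tm m n) = fv_tm m \<union> fv_tm n" "fv (less_tm m n) = fv_tm m \<union> fv_tm n"
  by (auto simp: iterate_def plus_tm_def times_tm_def monus_tm_def two_def pow2_def absdiff_def
      pos_part_def neg_part_def denom_def dist_num_def le_tm_def less_tm_def)

lemmas fv_rules = fv_Forall_simp fv_Exists_simp Un_ac

lemma fv_is_real [simp]: "fv (is_real x) = fv_tm x"
  by (simp add: is_real_def fv_rules)

lemma fv_eq_real [simp]: "fv (eq_real x y) = fv_tm x \<union> fv_tm y"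
  by (simp add: eq_real_def fv_rules)

lemma fv_ForallR_simp:
  assumes "\<And>x. fv (\<phi> x) = fv_tm x \<union> fv (\<phi> Zero)"
  shows "fv (ForallR \<phi>) = fv (\<phi> Zero)"
  unfolding ForallR_def by (rule fv_Forall, subst fv.simps, subst assms) auto

lemma fv_rel [simp]: "fv (rel R x y) = fv_tm R \<union> fv_tm x \<union> fv_tm y"
  "fv (ord_eq R x y) = fv_tm R \<union> fv_tm x \<union> fv_tm y" "fv (prec R x y) = fv_tm R \<union> fv_tm x \<union> fv_tm y"
  "fv (mem X x) = fv_tm X \<union> fv_tm x"
  by (auto simp: rel_def ord_eq_def prec_def mem_def)

lemma fv_real_fun_nat [simp]: "fv (real_fun_nat Y) = fv_tm Y"
  by (simp add: real_fun_nat_def fv_rules fv_ForallR_simp)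

lemma fv_real_set [simp]: "fv (real_set X) = fv_tm X"
  by (simp add: real_set_def fv_rules fv_ForallR_simp)

lemma fv_real_rel [simp]: "fv (real_rel R) = fv_tm R"
  by (simp add: real_rel_def fv_rules fv_ForallR_simp)

lemma fv_linear_order [simp]: "fv (linear_order X R) = fv_tm X \<union> fv_tm R"
  by (simp add: linear_order_def fv_rules)

lemma fv_well_ordering [simp]: "fv (well_ordering X R) = fv_tm X \<union> fv_tm R"
  by (simp add: well_ordering_def fv_rules)

lemma fv_cwo [simp]: "fv (cwo X R) = fv_tm X \<union> fv_tm R"
  by (simp add: cwo_def fv_rules)

lemma fv_order_isomorphic:
  assumes "\<And>x. fv (P x) = fv_tm x \<union> A" "\<And>x. fv (Q x) = fv_tm x \<union> B"
  shows "fv (order_isomorphic P R Q S) = A \<union> fv_tm R \<union> B \<union> fv_tm S"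
  by (simp add: order_isomorphic_def fv_rules assms)

lemma fv_initial_segment: "fv (initial_segment X R y x) = fv_tm x \<union> (fv_tm X \<union> fv_tm R \<union> fv_tm y)"
  by (auto simp: initial_segment_def)

lemma fv_mem: "fv (mem X x) = fv_tm x \<union> fv_tm X"
  by auto

lemma fv_embeds [simp]: "fv (embeds_initially A R B S) = fv_tm A \<union> fv_tm R \<union> fv_tm B \<union> fv_tm S"
proof -
  have 1: "fv (order_isomorphic (mem A) R (mem B) S) = fv_tm A \<union> fv_tm R \<union> fv_tm B \<union> fv_tm S"
    by (rule fv_order_isomorphic) (auto simp: fv_mem)
  have 2: "fv (order_isomorphic (mem A) R (initial_segment B S b) S) =
      fv_tm A \<union> fv_tm R \<union> (fv_tm B \<union> fv_tm S \<union> fv_tm b) \<union> fv_tm S" for b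
    by (rule fv_order_isomorphic) (auto simp: fv_initial_segment)
  have "fv (Exists ty1 (\<lambda>b. mem B b \<^bold>\<and> order_isomorphic (mem A) R (initial_segment B S b) S)) =
      fv_tm A \<union> fv_tm R \<union> fv_tm B \<union> fv_tm S"
    by (rule fv_Exists) (auto simp: 2)
  then show ?thesis
    by (simp add: embeds_initially_def 1)
qed

section \<open>Well-formedness of the axioms and of the two statements\<close>

lemma has_type_App_simps [simp]:
  "has_type s (N \<rightarrow> \<tau>) \<Longrightarrow> has_type t N \<Longrightarrow> has_type (s \<cdot> t) \<tau>"
  "has_type s (ty1 \<rightarrow> \<tau>) \<Longrightarrow> has_type t ty1 \<Longrightarrow> has_type (s \<cdot> t) \<tau>"
  by (auto simp: has_type_App)

lemma wf_BOOT: "wf_fm BOOT"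
  unfolding BOOT_def by (auto intro!: wf_Forall wf_Exists)

lemma wf_exists2: "wf_fm exists2"
  unfolding exists2_def by (auto intro!: wf_Forall wf_Exists)

lemma wf_Sigma_IND: "wf_fm Sigma_IND"
  unfolding Sigma_IND_def by (auto intro!: wf_Forall wf_Exists)

lemma wf_QF_AC_0_1: "\<phi> \<in> QF_AC_0_1 \<Longrightarrow> wf_fm \<phi>"
  unfolding QF_AC_0_1_def
  by (auto intro!: wf_replace wf_ForallV wf_ExistsV)

lemma has_type_arith [simp]:
  "has_type (iterate g m) \<tau> \<longleftrightarrow> \<tau> = N \<rightarrow> N \<and> has_type g (N \<rightarrow> N) \<and> has_type m N"
  "has_type (m \<oplus> n) \<tau> \<longleftrightarrow> \<tau> = N \<and> has_type m N \<and> has_type n N"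
  "has_type (m \<otimes> n) \<tau> \<longleftrightarrow> \<tau> = N \<and> has_type m N \<and> has_type n N"
  "has_type (m \<ominus> n) \<tau> \<longleftrightarrow> \<tau> = N \<and> has_type m N \<and> has_type n N"
  "has_type two \<tau> \<longleftrightarrow> \<tau> = N"
  "has_type (pow2 n) \<tau> \<longleftrightarrow> \<tau> = N \<and> has_type n N"
  "has_type (absdiff m n) \<tau> \<longleftrightarrow> \<tau> = N \<and> has_type m N \<and> has_type n N"
  by (auto simp: iterate_def plus_tm_def times_tm_def monus_tm_def two_def pow2_def absdiff_def has_type_App)

lemma has_type_parts [simp]:
  assumes "has_type x ty1" "has_type n N"
  shows "has_type (pos_part x n) N" "has_type (neg_part x n) N" "has_type (denom x n) N"
  using assms by (auto simp: pos_part_def neg_part_def denom_def has_type_App)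

lemma wf_is_real [simp]: "has_type x ty1 \<Longrightarrow> wf_fm (is_real x)"
  by (auto intro!: wf_Forall simp: is_real_def less_tm_def le_tm_def dist_num_def has_type_App)

lemma wf_eq_real [simp]: "has_type x ty1 \<Longrightarrow> has_type y ty1 \<Longrightarrow> wf_fm (eq_real x y)"
  by (auto intro!: wf_Forall simp: eq_real_def le_tm_def dist_num_def has_type_App)

lemma wf_ForallR: "(\<And>x. has_type x ty1 \<Longrightarrow> wf_fm (\<phi> x)) \<Longrightarrow> wf_fm (ForallR \<phi>)"
  by (auto intro!: wf_Forall simp: ForallR_def)

lemma wf_rel [simp]:
  assumes "has_type R (ty1 \<rightarrow> ty1 \<rightarrow> N)" "has_type x ty1" "has_type y ty1"
  shows "wf_fm (rel R x y)" "wf_fm (ord_eq R x y)" "wf_fm (prec R x y)"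
  using assms by (auto simp: rel_def ord_eq_def prec_def has_type_App)

lemma wf_mem [simp]: "has_type X ty2 \<Longrightarrow> has_type x ty1 \<Longrightarrow> wf_fm (mem X x)"
  by (auto simp: mem_def has_type_App)

lemma wf_linear_order [simp]:
  "has_type X ty2 \<Longrightarrow> has_type R (ty1 \<rightarrow> ty1 \<rightarrow> N) \<Longrightarrow> wf_fm (linear_order X R)"
  by (auto intro!: wf_Forall wf_ForallR
      simp: linear_order_def real_set_def real_fun_nat_def real_rel_def)

lemma wf_cwo [simp]: "has_type X ty2 \<Longrightarrow> has_type R (ty1 \<rightarrow> ty1 \<rightarrow> N) \<Longrightarrow> wf_fm (cwo X R)"
  by (auto intro!: wf_Forall wf_Exists wf_ForallR
      simp: cwo_def well_ordering_def real_fun_nat_def)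

lemma wf_order_isomorphic:
  assumes "\<And>x. has_type x ty1 \<Longrightarrow> wf_fm (P x)" "\<And>x. has_type x ty1 \<Longrightarrow> wf_fm (Q x)"
    "has_type R (ty1 \<rightarrow> ty1 \<rightarrow> N)" "has_type S (ty1 \<rightarrow> ty1 \<rightarrow> N)"
  shows "wf_fm (order_isomorphic P R Q S)"
  using assms by (auto intro!: wf_Forall wf_Exists simp: order_isomorphic_def)

lemma wf_embeds [simp]:
  assumes "has_type A ty2" "has_type R (ty1 \<rightarrow> ty1 \<rightarrow> N)" "has_type B ty2" "has_type S (ty1 \<rightarrow> ty1 \<rightarrow> N)"
  shows "wf_fm (embeds_initially A R B S)"
  using assms by (auto intro!: wf_Exists wf_order_isomorphic simp: embeds_initially_def initial_segment_def)

lemma wf_cwo_comparability: "wf_fm cwo_comparability"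
  by (auto intro!: wf_Forall simp: cwo_comparability_def)

context type_structure
begin

lemma sat_Imp_rule: "sat e \<phi> = P \<Longrightarrow> sat e \<psi> = Q \<Longrightarrow> sat e (\<phi> \<^bold>\<longrightarrow> \<psi>) = (P \<longrightarrow> Q)"
  by simp

lemma sat_Neg_rule: "sat e \<phi> = P \<Longrightarrow> sat e (\<^bold>\<not> \<phi>) = (\<not> P)"
  by simp

lemma sat_And_rule: "sat e \<phi> = P \<Longrightarrow> sat e \<psi> = Q \<Longrightarrow> sat e (\<phi> \<^bold>\<and> \<psi>) = (P \<and> Q)"
  by simp

lemma sat_Or_rule: "sat e \<phi> = P \<Longrightarrow> sat e \<psi> = Q \<Longrightarrow> sat e (\<phi> \<^bold>\<or> \<psi>) = (P \<or> Q)"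
  by simp

lemma sat_Iff_rule: "sat e \<phi> = P \<Longrightarrow> sat e \<psi> = Q \<Longrightarrow> sat e (\<phi> \<^bold>\<longleftrightarrow> \<psi>) = (P \<longleftrightarrow> Q)"
  by simp

text \<open>Applied backwards along the syntax, rules of this kind produce the HOL reading of a
  formula. The premise on \<open>e'\<close> says that terms over the outer variables keep their
  values, which is how nested quantifiers see the variables bound outside.\<close>

lemma sat_Forall_rule:
  assumes "\<And>e' x. ev e' x \<in> D \<sigma> \<Longrightarrow> (\<And>t. fv_tm t \<subseteq> fv (\<phi> Zero) \<Longrightarrow> ev e' t = ev e t) \<Longrightarrow>
      sat e' (\<phi> x) = \<Phi> (ev e' x)"
    and "\<And>x. fv (\<phi> x) = fv_tm x \<union> fv (\<phi> Zero)"
  shows "sat e (Forall \<sigma> \<phi>) = (\<forall>d\<in>D \<sigma>. \<Phi> d)"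
  by (rule sat_Forall[OF assms(2,1)])

lemma sat_Exists_rule:
  assumes "\<And>e' x. ev e' x \<in> D \<sigma> \<Longrightarrow> (\<And>t. fv_tm t \<subseteq> fv (\<phi> Zero) \<Longrightarrow> ev e' t = ev e t) \<Longrightarrow>
      sat e' (\<phi> x) = \<Phi> (ev e' x)"
    and "\<And>x. fv (\<phi> x) = fv_tm x \<union> fv (\<phi> Zero)"
  shows "sat e (Exists \<sigma> \<phi>) = (\<exists>d\<in>D \<sigma>. \<Phi> d)"
  by (rule sat_Exists[OF assms(2,1)])

lemmas sat_rules = sat_Imp_rule sat_Neg_rule sat_And_rule sat_Or_rule sat_Iff_rule
  sat_Forall_rule sat_Exists_rule

lemma Un_subset_simps: "A \<subseteq> B \<Longrightarrow> A \<subseteq> B \<union> C" "A \<subseteq> C \<Longrightarrow> A \<subseteq> B \<union> C"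
  by auto

lemmas fv_simps = fv_rules fv_ForallR_simp Un_subset_simps

end

section \<open>Arithmetic, reals and well-orderings as evaluated in a model\<close>

context model
begin

text \<open>The operations copy the defining terms literally, so that evaluation follows by
  unfolding. Their algebraic laws are statements about possibly nonstandard numbers and require
  induction inside the model.\<close>

definition add :: "'a \<Rightarrow> 'a \<Rightarrow> 'a"  (infixl "\<^bold>+" 65) where
  "m \<^bold>+ n = recursor \<bullet> (combK ty1 N \<bullet> succ) \<bullet> m \<bullet> n"

definition mul :: "'a \<Rightarrow> 'a \<Rightarrow> 'a"  (infixl "\<^bold>*" 70) where
  "m \<^bold>* n = recursor \<bullet> (combK ty1 N \<bullet> (recursor \<bullet> (combK ty1 N \<bullet> succ) \<bullet> m)) \<bullet> zero \<bullet> n"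

definition sub :: "'a \<Rightarrow> 'a \<Rightarrow> 'a"  (infixl "\<^bold>-" 65) where
  "m \<^bold>- n = recursor \<bullet> (combK ty1 N \<bullet> (recursor \<bullet> combK N N \<bullet> zero)) \<bullet> m \<bullet> n"

definition expt :: "'a \<Rightarrow> 'a" where
  "expt n = recursor \<bullet> (combK ty1 N \<bullet> (recursor \<bullet> (combK ty1 N \<bullet> (recursor \<bullet> (combK ty1 N \<bullet> succ)
     \<bullet> (succ \<bullet> (succ \<bullet> zero)))) \<bullet> zero)) \<bullet> (succ \<bullet> zero) \<bullet> n"

definition le :: "'a \<Rightarrow> 'a \<Rightarrow> bool"  (infix "\<^bold>\<le>" 50) where
  "m \<^bold>\<le> n \<longleftrightarrow> m \<^bold>- n = zero"

definition numer :: "'a \<Rightarrow> 'a \<Rightarrow> 'a" where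
  "numer x n = x \<bullet> (n \<^bold>+ n \<^bold>+ n)"

definition numer' :: "'a \<Rightarrow> 'a \<Rightarrow> 'a" where
  "numer' x n = x \<bullet> (succ \<bullet> (n \<^bold>+ n \<^bold>+ n))"

definition den :: "'a \<Rightarrow> 'a \<Rightarrow> 'a" where
  "den x n = succ \<bullet> (x \<bullet> (succ \<bullet> (succ \<bullet> (n \<^bold>+ n \<^bold>+ n))))"

definition dist :: "'a \<Rightarrow> 'a \<Rightarrow> 'a \<Rightarrow> 'a \<Rightarrow> 'a" where
  "dist x n y m =
    (let a = numer x n \<^bold>* den y m \<^bold>+ numer' y m \<^bold>* den x n;
         b = numer y m \<^bold>* den x n \<^bold>+ numer' x n \<^bold>* den y m
     in (a \<^bold>- b) \<^bold>+ (b \<^bold>- a))"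

lemma ev_arith [simp]:
  "ev e (m \<oplus> n) = ev e m \<^bold>+ ev e n" "ev e (m \<otimes> n) = ev e m \<^bold>* ev e n"
  "ev e (m \<ominus> n) = ev e m \<^bold>- ev e n" "ev e (pow2 n) = expt (ev e n)"
  "ev e two = succ \<bullet> (succ \<bullet> zero)"
  by (simp_all add: iterate_def plus_tm_def times_tm_def monus_tm_def two_def pow2_def
      add_def mul_def sub_def expt_def)

lemma ev_real [simp]:
  "ev e (denom x n) = den (ev e x) (ev e n)"
  "ev e (dist_num x n y m) = dist (ev e x) (ev e n) (ev e y) (ev e m)"
  by (simp_all add: absdiff_def pos_part_def neg_part_def denom_def dist_num_def numer_def
      numer'_def den_def dist_def Let_def)

lemma sat_le [simp]: "sat e (le_tm s t) \<longleftrightarrow> ev e s \<^bold>\<le> ev e t" "sat e (less_tm s t) \<longleftrightarrow> succ \<bullet> ev e s \<^bold>\<le> ev e t"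
  by (auto simp: le_tm_def less_tm_def le_def)

definition is_re :: "'a \<Rightarrow> bool" where
  "is_re x \<longleftrightarrow> (\<forall>n\<in>D N. \<forall>i\<in>D N. succ \<bullet> (dist x n x (n \<^bold>+ i) \<^bold>* expt n) \<^bold>\<le> den x n \<^bold>* den x (n \<^bold>+ i))"

definition eq_re :: "'a \<Rightarrow> 'a \<Rightarrow> bool" where
  "eq_re x y \<longleftrightarrow> (\<forall>n\<in>D N. dist x n y n \<^bold>* expt n \<^bold>\<le> (succ \<bullet> (succ \<bullet> zero)) \<^bold>* (den x n \<^bold>* den y n))"

definition Re :: "'a set" where
  "Re = {x \<in> D ty1. is_re x}"

lemma sat_is_real [simp]: "sat e (is_real x) \<longleftrightarrow> is_re (ev e x)"
  unfolding is_real_def is_re_def by (intro sat_rules) (simp_all add: fv_simps)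

lemma sat_eq_real [simp]: "sat e (eq_real x y) \<longleftrightarrow> eq_re (ev e x) (ev e y)"
  unfolding eq_real_def eq_re_def by (intro sat_rules) (simp_all add: fv_simps)

lemma sat_ForallR_rule:
  assumes "\<And>e' x. ev e' x \<in> D ty1 \<Longrightarrow> (\<And>t. fv_tm t \<subseteq> fv (\<phi> Zero) \<Longrightarrow> ev e' t = ev e t) \<Longrightarrow>
      sat e' (\<phi> x) = \<Phi> (ev e' x)"
    and "\<And>x. fv (\<phi> x) = fv_tm x \<union> fv (\<phi> Zero)"
  shows "sat e (ForallR \<phi>) = (\<forall>d\<in>Re. \<Phi> d)"
proof -
  have "sat e (ForallR \<phi>) = (\<forall>d\<in>D ty1. is_re d \<longrightarrow> \<Phi> d)"
    unfolding ForallR_def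
  proof (rule sat_Forall[where C = "fv (\<phi> Zero)"])
    show "fv (is_real x \<^bold>\<longrightarrow> \<phi> x) = fv_tm x \<union> fv (\<phi> Zero)" for x
      by (subst fv.simps, subst assms(2)) auto
  next
    fix e' x assume "ev e' x \<in> D ty1" "\<And>t. fv_tm t \<subseteq> fv (\<phi> Zero) \<Longrightarrow> ev e' t = ev e t"
    then show "sat e' (is_real x \<^bold>\<longrightarrow> \<phi> x) = (is_re (ev e' x) \<longrightarrow> \<Phi> (ev e' x))"
      using assms(1)[of e' x] by simp
  qed
  then show ?thesis
    by (auto simp: Re_def)
qed

definition real_invariant :: "'a \<Rightarrow> bool" where
  "real_invariant Y \<longleftrightarrow> (\<forall>x\<in>Re. \<forall>y\<in>Re. eq_re x y \<longrightarrow> Y \<bullet> x = Y \<bullet> y)"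

definition In :: "'a \<Rightarrow> 'a set" where
  "In X = {x \<in> Re. X \<bullet> x = succ \<bullet> zero}"

definition Rel :: "'a \<Rightarrow> 'a \<Rightarrow> 'a \<Rightarrow> bool" where
  "Rel R x y \<longleftrightarrow> R \<bullet> x \<bullet> y = succ \<bullet> zero"

definition Linear :: "'a \<Rightarrow> 'a \<Rightarrow> bool" where
  "Linear X R \<longleftrightarrow>
    (real_invariant X \<and> (\<forall>x\<in>Re. X \<bullet> x = zero \<or> X \<bullet> x = succ \<bullet> zero)) \<and>
    ((\<forall>x\<in>Re. \<forall>x'\<in>Re. \<forall>y\<in>Re. \<forall>y'\<in>Re. eq_re x x' \<and> eq_re y y' \<longrightarrow> R \<bullet> x \<bullet> y = R \<bullet> x' \<bullet> y') \<and>
     (\<forall>x\<in>Re. \<forall>y\<in>Re. R \<bullet> x \<bullet> y = zero \<or> R \<bullet> x \<bullet> y = succ \<bullet> zero)) \<and>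
    (\<forall>x\<in>D ty1. \<forall>y\<in>D ty1. \<forall>z\<in>D ty1. x \<in> In X \<and> y \<in> In X \<and> z \<in> In X \<longrightarrow> Rel R x y \<and> Rel R y z \<longrightarrow> Rel R x z) \<and>
    (\<forall>x\<in>D ty1. \<forall>y\<in>D ty1. x \<in> In X \<and> y \<in> In X \<longrightarrow> Rel R x y \<or> Rel R y x)"

definition Cwo :: "'a \<Rightarrow> 'a \<Rightarrow> bool" where
  "Cwo X R \<longleftrightarrow>
    (Linear X R \<and>
     \<not> (\<exists>s\<in>D (N \<rightarrow> ty1). \<forall>n\<in>D N. s \<bullet> n \<in> In X \<and>
         (Rel R (s \<bullet> (succ \<bullet> n)) (s \<bullet> n) \<and> \<not> (Rel R (s \<bullet> (succ \<bullet> n)) (s \<bullet> n) \<and> Rel R (s \<bullet> n) (s \<bullet> (succ \<bullet> n)))))) \<and>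
    (\<exists>Y\<in>D ty2. real_invariant Y \<and>
      (\<forall>x\<in>D ty1. \<forall>y\<in>D ty1. x \<in> In X \<and> y \<in> In X \<longrightarrow> Y \<bullet> x = Y \<bullet> y \<longrightarrow> Rel R x y \<and> Rel R y x))"

definition Iso :: "'a set \<Rightarrow> 'a \<Rightarrow> 'a set \<Rightarrow> 'a \<Rightarrow> bool" where
  "Iso P R Q S \<longleftrightarrow> (\<exists>Z\<in>D (ty1 \<rightarrow> ty1).
     (\<forall>x\<in>D ty1. x \<in> P \<longrightarrow> Z \<bullet> x \<in> Q) \<and>
     (\<forall>x\<in>D ty1. \<forall>x'\<in>D ty1. x \<in> P \<and> x' \<in> P \<longrightarrow> eq_re x x' \<longrightarrow> eq_re (Z \<bullet> x) (Z \<bullet> x')) \<and>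
     (\<forall>w\<in>D ty1. w \<in> Q \<longrightarrow> (\<exists>x\<in>D ty1. x \<in> P \<and> Rel S (Z \<bullet> x) w \<and> Rel S w (Z \<bullet> x))) \<and>
     (\<forall>x\<in>D ty1. \<forall>x'\<in>D ty1. x \<in> P \<and> x' \<in> P \<longrightarrow> (Rel R x x' \<longleftrightarrow> Rel S (Z \<bullet> x) (Z \<bullet> x'))))"

definition Initial :: "'a \<Rightarrow> 'a \<Rightarrow> 'a \<Rightarrow> 'a set" where
  "Initial X R b = {x \<in> In X. Rel R x b \<and> \<not> Rel R b x}"

definition Embeds :: "'a \<Rightarrow> 'a \<Rightarrow> 'a \<Rightarrow> 'a \<Rightarrow> bool" where
  "Embeds A R B S \<longleftrightarrow> Iso (In A) R (In B) S \<or> (\<exists>b\<in>D ty1. b \<in> In B \<and> Iso (In A) R (Initial B S b) S)"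

lemma sat_mem [simp]: "ev e x \<in> D ty1 \<Longrightarrow> sat e (mem X x) \<longleftrightarrow> ev e x \<in> In (ev e X)"
  by (auto simp: mem_def In_def Re_def)

lemma sat_rel [simp]: "sat e (rel R x y) \<longleftrightarrow> Rel (ev e R) (ev e x) (ev e y)"
  "sat e (ord_eq R x y) \<longleftrightarrow> Rel (ev e R) (ev e x) (ev e y) \<and> Rel (ev e R) (ev e y) (ev e x)"
  by (auto simp: rel_def Rel_def ord_eq_def)

lemma sat_real_fun_nat [simp]: "sat e (real_fun_nat Y) \<longleftrightarrow> real_invariant (ev e Y)"
  unfolding real_fun_nat_def real_invariant_def
  by (intro sat_rules sat_ForallR_rule) (simp_all add: fv_simps)

lemma sat_linear_order [simp]: "sat e (linear_order X R) \<longleftrightarrow> Linear (ev e X) (ev e R)"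
  unfolding linear_order_def Linear_def real_set_def real_rel_def
  by (intro sat_rules sat_ForallR_rule) (simp_all add: fv_simps)

lemma sat_cwo [simp]: "sat e (cwo X R) \<longleftrightarrow> Cwo (ev e X) (ev e R)"
  unfolding cwo_def Cwo_def well_ordering_def prec_def
  by (intro sat_rules sat_ForallR_rule) (simp_all add: fv_simps)

lemma sat_BOOT: "sat e BOOT \<longleftrightarrow> (\<forall>Y\<in>D (ty1 \<rightarrow> N \<rightarrow> N). \<exists>X\<in>D ty1. \<forall>n\<in>D N.
    (X \<bullet> n = zero \<or> X \<bullet> n = succ \<bullet> zero) \<and> (X \<bullet> n = succ \<bullet> zero \<longleftrightarrow> (\<exists>f\<in>D ty1. Y \<bullet> f \<bullet> n = zero)))"
  unfolding BOOT_def
  by (intro sat_rules) (simp_all add: fv_simps)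

lemma sat_exists2: "sat e exists2 \<longleftrightarrow> (\<exists>E\<in>D ty2. \<forall>f\<in>D ty1.
    (E \<bullet> f = zero \<or> E \<bullet> f = succ \<bullet> zero) \<and> (E \<bullet> f = zero \<longleftrightarrow> (\<exists>n\<in>D N. f \<bullet> n = zero)))"
  unfolding exists2_def
  by (intro sat_rules) (simp_all add: fv_simps)

lemma sat_order_isomorphic:
  "sat e (order_isomorphic (mem A) R (mem B) S) \<longleftrightarrow> Iso (In (ev e A)) (ev e R) (In (ev e B)) (ev e S)"
  unfolding order_isomorphic_def Iso_def
  by (intro sat_rules) (simp_all add: fv_simps)

lemma sat_order_isomorphic_initial:
  "ev e b \<in> D ty1 \<Longrightarrow> sat e (order_isomorphic (mem A) R (initial_segment B S b) S) \<longleftrightarrow>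
    Iso (In (ev e A)) (ev e R) (Initial (ev e B) (ev e S) (ev e b)) (ev e S)"
  unfolding order_isomorphic_def Iso_def initial_segment_def prec_def Initial_def
  by (intro sat_rules) (auto simp: fv_simps)

lemma sat_embeds [simp]:
  "sat e (embeds_initially A R B S) \<longleftrightarrow> Embeds (ev e A) (ev e R) (ev e B) (ev e S)"
proof -
  have "fv (order_isomorphic (mem A) R (initial_segment B S b) S) =
      fv_tm A \<union> fv_tm R \<union> (fv_tm B \<union> fv_tm S \<union> fv_tm b) \<union> fv_tm S" for b
    by (rule fv_order_isomorphic) (auto simp: fv_initial_segment)
  then show ?thesis
    unfolding embeds_initially_def Embeds_def
    by (intro sat_rules) (simp_all add: fv_simps sat_order_isomorphic sat_order_isomorphic_initial)
qed

lemma sat_cwo_comparability: "sat e cwo_comparability \<longleftrightarrow>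
    (\<forall>A\<in>D ty2. \<forall>R\<in>D (ty1 \<rightarrow> ty1 \<rightarrow> N). \<forall>B\<in>D ty2. \<forall>S\<in>D (ty1 \<rightarrow> ty1 \<rightarrow> N).
      Cwo A R \<and> Cwo B S \<longrightarrow> Embeds A R B S \<or> Embeds B S A R)"
  unfolding cwo_comparability_def
  by (intro sat_rules) (simp_all add: fv_simps)

section \<open>The axioms as facts about the model\<close>

lemma eqv_iff: "x \<in> D \<sigma> \<Longrightarrow> y \<in> D \<sigma> \<Longrightarrow> eqv \<sigma> x y \<longleftrightarrow> x = y"
proof (induction \<sigma> arbitrary: x y)
  case (Fn \<sigma> \<tau>)
  then show ?case
    using extensional[of x \<sigma> \<tau> y] by auto
qed simp

lemma axiom: "\<phi> \<in> RCA0\<omega> \<Longrightarrow> typed e \<Longrightarrow> sat e \<phi>"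
  using RCA sat_axiom by blast

lemma combK [simp]:
  assumes "x \<in> D \<rho>" "y \<in> D \<tau>"
  shows "combK \<rho> \<tau> \<bullet> x \<bullet> y = x"
proof -
  have "sat e0 (Forall \<rho> (\<lambda>x. Forall \<tau> (\<lambda>y. eq_at \<rho> (CombK \<rho> \<tau> \<cdot> x \<cdot> y) x))) \<longleftrightarrow>
      (\<forall>x\<in>D \<rho>. \<forall>y\<in>D \<tau>. eqv \<rho> (combK \<rho> \<tau> \<bullet> x \<bullet> y) x)"
    by (intro sat_rules) (simp_all add: sat_eq_at_eqv fv_simps)
  then have "eqv \<rho> (combK \<rho> \<tau> \<bullet> x \<bullet> y) x"
    using axiom[OF RCA0\<omega>.CombK typed_e0] assms by blast
  moreover have "combK \<rho> \<tau> \<bullet> x \<bullet> y \<in> D \<rho>"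
    using assms combK_in by blast
  ultimately show ?thesis
    using assms by (simp add: eqv_iff)
qed

lemma combS [simp]:
  assumes "x \<in> D (\<delta> \<rightarrow> \<rho> \<rightarrow> \<tau>)" "y \<in> D (\<delta> \<rightarrow> \<rho>)" "z \<in> D \<delta>"
  shows "combS \<delta> \<rho> \<tau> \<bullet> x \<bullet> y \<bullet> z = x \<bullet> z \<bullet> (y \<bullet> z)"
proof -
  have "sat e0 (Forall (\<delta> \<rightarrow> \<rho> \<rightarrow> \<tau>) (\<lambda>x. Forall (\<delta> \<rightarrow> \<rho>) (\<lambda>y. Forall \<delta> (\<lambda>z.
    eq_at \<tau> (CombS \<delta> \<rho> \<tau> \<cdot> x \<cdot> y \<cdot> z) (x \<cdot> z \<cdot> (y \<cdot> z))))))
    \<longleftrightarrow> (\<forall>x\<in>D (\<delta> \<rightarrow> \<rho> \<rightarrow> \<tau>). \<forall>y\<in>D (\<delta> \<rightarrow> \<rho>). \<forall>z\<in>D \<delta>.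
      eqv \<tau> (combS \<delta> \<rho> \<tau> \<bullet> x \<bullet> y \<bullet> z) (x \<bullet> z \<bullet> (y \<bullet> z)))"
    by (intro sat_rules) (simp_all add: sat_eq_at_eqv fv_simps)
  then have "eqv \<tau> (combS \<delta> \<rho> \<tau> \<bullet> x \<bullet> y \<bullet> z) (x \<bullet> z \<bullet> (y \<bullet> z))"
    using axiom[OF RCA0\<omega>.CombS typed_e0] assms by blast
  moreover have "combS \<delta> \<rho> \<tau> \<bullet> x \<bullet> y \<bullet> z \<in> D \<tau>" "x \<bullet> z \<bullet> (y \<bullet> z) \<in> D \<tau>"
    using assms combS_in by blast+
  ultimately show ?thesis
    by (simp add: eqv_iff)
qed

lemma succ_nonzero [simp]: "n \<in> D N \<Longrightarrow> succ \<bullet> n \<noteq> zero" "n \<in> D N \<Longrightarrow> zero \<noteq> succ \<bullet> n"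
proof -
  have "sat e0 (Forall N (\<lambda>m. \<^bold>\<not> Succ \<cdot> m \<doteq> Zero)) \<longleftrightarrow> (\<forall>m\<in>D N. \<not> (succ \<bullet> m = zero))"
    by (intro sat_rules) (simp_all add: fv_simps)
  then show "n \<in> D N \<Longrightarrow> succ \<bullet> n \<noteq> zero" "n \<in> D N \<Longrightarrow> zero \<noteq> succ \<bullet> n"
    using axiom[OF RCA0\<omega>.Succ_nonzero typed_e0] by metis+
qed

lemma succ_eq_iff [simp]: "m \<in> D N \<Longrightarrow> n \<in> D N \<Longrightarrow> succ \<bullet> m = succ \<bullet> n \<longleftrightarrow> m = n"
proof -
  have "sat e0 (Forall N (\<lambda>m. Forall N (\<lambda>n. Succ \<cdot> m \<doteq> Succ \<cdot> n \<^bold>\<longrightarrow> m \<doteq> n))) \<longleftrightarrow>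
      (\<forall>m\<in>D N. \<forall>n\<in>D N. succ \<bullet> m = succ \<bullet> n \<longrightarrow> m = n)"
    by (intro sat_rules) (simp_all add: fv_simps)
  then show "m \<in> D N \<Longrightarrow> n \<in> D N \<Longrightarrow> succ \<bullet> m = succ \<bullet> n \<longleftrightarrow> m = n"
    using axiom[OF RCA0\<omega>.Succ_inj typed_e0] by metis
qed

lemma recursor_zero [simp]:
  assumes "f \<in> D (N \<rightarrow> N \<rightarrow> N)" "m \<in> D N"
  shows "recursor \<bullet> f \<bullet> m \<bullet> zero = m"
proof -
  have "sat e0 (Forall (N \<rightarrow> N \<rightarrow> N) (\<lambda>f. Forall N (\<lambda>m. Rec0 \<cdot> f \<cdot> m \<cdot> Zero \<doteq> m))) \<longleftrightarrow>
      (\<forall>f\<in>D (N \<rightarrow> N \<rightarrow> N). \<forall>m\<in>D N. recursor \<bullet> f \<bullet> m \<bullet> zero = m)"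
    by (intro sat_rules) (simp_all add: fv_simps)
  then show ?thesis
    using axiom[OF RCA0\<omega>.Rec0_Zero typed_e0] assms by blast
qed

lemma recursor_succ [simp]:
  assumes "f \<in> D (N \<rightarrow> N \<rightarrow> N)" "m \<in> D N" "n \<in> D N"
  shows "recursor \<bullet> f \<bullet> m \<bullet> (succ \<bullet> n) = f \<bullet> n \<bullet> (recursor \<bullet> f \<bullet> m \<bullet> n)"
proof -
  have "sat e0 (Forall (N \<rightarrow> N \<rightarrow> N) (\<lambda>f. Forall N (\<lambda>m. Forall N (\<lambda>n.
      Rec0 \<cdot> f \<cdot> m \<cdot> (Succ \<cdot> n) \<doteq> f \<cdot> n \<cdot> (Rec0 \<cdot> f \<cdot> m \<cdot> n))))) \<longleftrightarrow>
      (\<forall>f\<in>D (N \<rightarrow> N \<rightarrow> N). \<forall>m\<in>D N. \<forall>n\<in>D N.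
        recursor \<bullet> f \<bullet> m \<bullet> (succ \<bullet> n) = f \<bullet> n \<bullet> (recursor \<bullet> f \<bullet> m \<bullet> n))"
    by (intro sat_rules) (simp_all add: fv_simps)
  then show ?thesis
    using axiom[OF RCA0\<omega>.Rec0_Succ typed_e0] assms by blast
qed

text \<open>The parameter \<open>f\<close> enters as the value of a free variable of the induction
  formula. The single formula \<open>f n = 0\<close> suffices, since decidable predicates are given
  by such an \<open>f\<close>.\<close>

lemma induct_zero:
  assumes "f \<in> D ty1" "f \<bullet> zero = zero" "\<And>n. n \<in> D N \<Longrightarrow> f \<bullet> n = zero \<Longrightarrow> f \<bullet> (succ \<bullet> n) = zero"
    and "n \<in> D N"
  shows "f \<bullet> n = zero"
proof -
  let ?\<phi> = "Var ty1 0 \<cdot> Var N 0 \<doteq> Zero" and ?e = "upd e0 ty1 0 f"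
  have "typed ?e"
    using assms typed_e0 by auto
  then have "sat ?e (replace N 0 Zero ?\<phi> \<^bold>\<and> ForallV N 0 (?\<phi> \<^bold>\<longrightarrow> replace N 0 (Succ \<cdot> Var N 0) ?\<phi>)
      \<^bold>\<longrightarrow> ForallV N 0 ?\<phi>)"
    by (intro axiom RCA0\<omega>.QF_IND) auto
  then show ?thesis
    using assms by (auto simp: sat_replace upd_def)
qed

lemma QF_AC_1_0:
  assumes "F \<in> D (ty1 \<rightarrow> N \<rightarrow> N)" "\<And>f. f \<in> D ty1 \<Longrightarrow> \<exists>n\<in>D N. F \<bullet> f \<bullet> n = zero"
  shows "\<exists>Y\<in>D ty2. \<forall>f\<in>D ty1. F \<bullet> f \<bullet> (Y \<bullet> f) = zero"
proof -
  let ?\<phi> = "Var (ty1 \<rightarrow> N \<rightarrow> N) 0 \<cdot> Var ty1 0 \<cdot> Var N 0 \<doteq> Zero" and ?e = "upd e0 (ty1 \<rightarrow> N \<rightarrow> N) 0 F"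
  have "typed ?e"
    using assms typed_e0 by auto
  then have "sat ?e (ForallV ty1 0 (ExistsV N 0 ?\<phi>)
    \<^bold>\<longrightarrow> ExistsV ty2 1 (ForallV ty1 0 (replace N 0 (Var ty2 1 \<cdot> Var ty1 0) ?\<phi>)))"
    by (intro axiom RCA0\<omega>.QF_AC_1_0) auto
  then show ?thesis
    using assms by (auto simp: sat_replace upd_def)
qed

text \<open>Quantifier-free choice turns the primitive equality into a decision functional.\<close>

lemma equality_test:
  "\<exists>Y\<in>D ty2. \<forall>f\<in>D ty1. Y \<bullet> f = (if f \<bullet> zero = f \<bullet> (succ \<bullet> zero) then zero else succ \<bullet> zero)"
proof -
  let ?a = "Var ty1 0 \<cdot> Zero \<doteq> Var ty1 0 \<cdot> one"
  let ?\<phi> = "(?a \<^bold>\<longrightarrow> Var N 0 \<doteq> Zero) \<^bold>\<and> (\<^bold>\<not> ?a \<^bold>\<longrightarrow> Var N 0 \<doteq> one)"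
  have "fresh ?\<phi> \<le> 1"
    by (simp add: And_def Neg_def)
  then have "sat e0 (ForallV ty1 0 (ExistsV N 0 ?\<phi>)
    \<^bold>\<longrightarrow> ExistsV ty2 1 (ForallV ty1 0 (replace N 0 (Var ty2 1 \<cdot> Var ty1 0) ?\<phi>)))"
    using typed_e0 by (intro axiom RCA0\<omega>.QF_AC_1_0) (auto simp: And_def Neg_def)
  then have "(\<forall>f\<in>D ty1. \<exists>n\<in>D N. (f \<bullet> zero = f \<bullet> (succ \<bullet> zero) \<longrightarrow> n = zero) \<and>
      (f \<bullet> zero \<noteq> f \<bullet> (succ \<bullet> zero) \<longrightarrow> n = succ \<bullet> zero)) \<longrightarrow>
    (\<exists>Y\<in>D ty2. \<forall>f\<in>D ty1. (f \<bullet> zero = f \<bullet> (succ \<bullet> zero) \<longrightarrow> Y \<bullet> f = zero) \<and>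
      (f \<bullet> zero \<noteq> f \<bullet> (succ \<bullet> zero) \<longrightarrow> Y \<bullet> f = succ \<bullet> zero))"
    by (simp add: sat_replace upd_def)
  moreover have "succ \<bullet> zero \<in> D N"
    using ap_in succ_in zero_in by blast
  ultimately show ?thesis
    by (metis zero_in)
qed


section \<open>Definable functions\<close>

definition ctx :: "ty list \<Rightarrow> 'a list \<Rightarrow> bool" where
  "ctx \<Gamma> xs \<longleftrightarrow> list_all2 (\<lambda>\<sigma> x. x \<in> D \<sigma>) \<Gamma> xs"

lemma ctx_simps [simp]: "ctx [] xs \<longleftrightarrow> xs = []" "ctx (\<sigma> # \<Gamma>) (x # xs) \<longleftrightarrow> x \<in> D \<sigma> \<and> ctx \<Gamma> xs"
  "ctx (\<sigma> # \<Gamma>) [] \<longleftrightarrow> False"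
  by (auto simp: ctx_def)

lemma ctx_Cons: "ctx (\<sigma> # \<Gamma>) xs \<longleftrightarrow> (\<exists>y ys. xs = y # ys \<and> y \<in> D \<sigma> \<and> ctx \<Gamma> ys)"
  by (cases xs) auto

text \<open>Combinatory completeness is phrased for maps on argument lists: the list is an
  environment for the context \<open>\<Gamma>\<close>, with the innermost variable at its head, and
  an element of the curried type must realize the map on well-typed lists.\<close>

definition rep :: "ty list \<Rightarrow> ty \<Rightarrow> ('a list \<Rightarrow> 'a) \<Rightarrow> bool" where
  "rep \<Gamma> \<tau> F \<longleftrightarrow> (\<exists>f\<in>D (foldr Fn \<Gamma> \<tau>). \<forall>xs. ctx \<Gamma> xs \<longrightarrow> foldl (\<bullet>) f xs = F xs)"

lemma foldl_in: "f \<in> D (foldr Fn \<Gamma> \<tau>) \<Longrightarrow> ctx \<Gamma> xs \<Longrightarrow> foldl (\<bullet>) f xs \<in> D \<tau>"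
  by (induction \<Gamma> arbitrary: f xs) (auto simp: ctx_Cons)

lemma rep_in: "rep \<Gamma> \<tau> F \<Longrightarrow> ctx \<Gamma> xs \<Longrightarrow> F xs \<in> D \<tau>"
  unfolding rep_def using foldl_in by metis

lemma rep_cong: "(\<And>xs. ctx \<Gamma> xs \<Longrightarrow> F xs = G xs) \<Longrightarrow> rep \<Gamma> \<tau> F \<longleftrightarrow> rep \<Gamma> \<tau> G"
  by (simp add: rep_def)

lemma identity_comb: "\<exists>i\<in>D (\<sigma> \<rightarrow> \<sigma>). \<forall>x\<in>D \<sigma>. i \<bullet> x = x"
proof (intro bexI ballI)
  show i: "combS \<sigma> (\<sigma> \<rightarrow> \<sigma>) \<sigma> \<bullet> combK \<sigma> (\<sigma> \<rightarrow> \<sigma>) \<bullet> combK \<sigma> \<sigma> \<in> D (\<sigma> \<rightarrow> \<sigma>)"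
    using combS_in combK_in ap_in by blast
  fix x assume "x \<in> D \<sigma>"
  then show "combS \<sigma> (\<sigma> \<rightarrow> \<sigma>) \<sigma> \<bullet> combK \<sigma> (\<sigma> \<rightarrow> \<sigma>) \<bullet> combK \<sigma> \<sigma> \<bullet> x = x"
    using combS[of "combK \<sigma> (\<sigma> \<rightarrow> \<sigma>)" \<sigma> "\<sigma> \<rightarrow> \<sigma>" \<sigma> "combK \<sigma> \<sigma>" x] ap_in[OF combK_in, of x \<sigma> \<sigma>]
    by simp
qed

text \<open>The combinator K for a whole context, composed from one K for each of its types.\<close>

lemma const_comb: "\<exists>k\<in>D (\<sigma> \<rightarrow> foldr Fn \<Gamma> \<sigma>). \<forall>x xs. x \<in> D \<sigma> \<longrightarrow> ctx \<Gamma> xs \<longrightarrow> foldl (\<bullet>) (k \<bullet> x) xs = x"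
proof (induction \<Gamma>)
  case Nil
  then show ?case
    using identity_comb[of \<sigma>] by auto
next
  case (Cons \<rho> \<Gamma>)
  let ?\<tau> = "foldr Fn \<Gamma> \<sigma>"
  from Cons obtain k where k: "k \<in> D (\<sigma> \<rightarrow> ?\<tau>)"
    "\<And>x xs. x \<in> D \<sigma> \<Longrightarrow> ctx \<Gamma> xs \<Longrightarrow> foldl (\<bullet>) (k \<bullet> x) xs = x" by blast
  have KK: "combK (?\<tau> \<rightarrow> \<rho> \<rightarrow> ?\<tau>) \<sigma> \<bullet> combK ?\<tau> \<rho> \<in> D (\<sigma> \<rightarrow> ?\<tau> \<rightarrow> \<rho> \<rightarrow> ?\<tau>)"
    using combK_in ap_in by blast
  let ?k = "combS \<sigma> ?\<tau> (\<rho> \<rightarrow> ?\<tau>) \<bullet> (combK (?\<tau> \<rightarrow> \<rho> \<rightarrow> ?\<tau>) \<sigma> \<bullet> combK ?\<tau> \<rho>) \<bullet> k"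
  have "?k \<in> D (\<sigma> \<rightarrow> \<rho> \<rightarrow> ?\<tau>)"
    using combS_in KK k ap_in by blast
  moreover have "?k \<bullet> x \<bullet> y = k \<bullet> x" if "x \<in> D \<sigma>" "y \<in> D \<rho>" for x y
    using that KK k combK_in by (simp add: ap_in[OF k(1)])
  ultimately show ?case
    using k by (intro bexI[of _ ?k]) (auto simp: ctx_Cons)
qed

text \<open>The combinator S for a whole context: application is carried below
  \<open>\<Gamma>\<close> one type at a time. If \<open>c\<close> does this for the tail, the
  element \<open>c'\<close> with \<open>c' f g x = c (f x) (g x)\<close> does it for the longer
  context.\<close>

lemma ap_comb: "\<exists>c\<in>D (foldr Fn \<Gamma> (\<rho> \<rightarrow> \<tau>) \<rightarrow> foldr Fn \<Gamma> \<rho> \<rightarrow> foldr Fn \<Gamma> \<tau>). \<forall>f g xs.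
    f \<in> D (foldr Fn \<Gamma> (\<rho> \<rightarrow> \<tau>)) \<longrightarrow> g \<in> D (foldr Fn \<Gamma> \<rho>) \<longrightarrow> ctx \<Gamma> xs \<longrightarrow>
    foldl (\<bullet>) (c \<bullet> f \<bullet> g) xs = foldl (\<bullet>) f xs \<bullet> foldl (\<bullet>) g xs"
proof (induction \<Gamma>)
  case Nil
  then show ?case
    using identity_comb[of "\<rho> \<rightarrow> \<tau>"] by force
next
  case (Cons \<sigma> \<Gamma>)
  define A B C where "A = foldr Fn \<Gamma> (\<rho> \<rightarrow> \<tau>)" and "B = foldr Fn \<Gamma> \<rho>" and "C = foldr Fn \<Gamma> \<tau>"
  from Cons obtain c where c: "c \<in> D (A \<rightarrow> B \<rightarrow> C)" "\<And>f g xs. f \<in> D A \<Longrightarrow> g \<in> D B \<Longrightarrow> ctx \<Gamma> xs \<Longrightarrow>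
      foldl (\<bullet>) (c \<bullet> f \<bullet> g) xs = foldl (\<bullet>) f xs \<bullet> foldl (\<bullet>) g xs"
    unfolding A_def B_def C_def by blast
  define s where "s = combS \<sigma> B C"
  have s: "s \<in> D ((\<sigma> \<rightarrow> B \<rightarrow> C) \<rightarrow> (\<sigma> \<rightarrow> B) \<rightarrow> \<sigma> \<rightarrow> C)"
    by (simp add: s_def)
  define ks where "ks = combK ((\<sigma> \<rightarrow> B \<rightarrow> C) \<rightarrow> (\<sigma> \<rightarrow> B) \<rightarrow> \<sigma> \<rightarrow> C) (\<sigma> \<rightarrow> A) \<bullet> s"
  have ks: "ks \<in> D ((\<sigma> \<rightarrow> A) \<rightarrow> (\<sigma> \<rightarrow> B \<rightarrow> C) \<rightarrow> (\<sigma> \<rightarrow> B) \<rightarrow> \<sigma> \<rightarrow> C)"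
    unfolding ks_def using combK_in s ap_in by blast
  define kc where "kc = combK (A \<rightarrow> B \<rightarrow> C) \<sigma> \<bullet> c"
  have kc: "kc \<in> D (\<sigma> \<rightarrow> A \<rightarrow> B \<rightarrow> C)"
    unfolding kc_def using combK_in c ap_in by blast
  define skc where "skc = combS \<sigma> A (B \<rightarrow> C) \<bullet> kc"
  have skc: "skc \<in> D ((\<sigma> \<rightarrow> A) \<rightarrow> \<sigma> \<rightarrow> B \<rightarrow> C)"
    unfolding skc_def using combS_in kc ap_in by blast
  define c' where "c' = combS (\<sigma> \<rightarrow> A) (\<sigma> \<rightarrow> B \<rightarrow> C) ((\<sigma> \<rightarrow> B) \<rightarrow> \<sigma> \<rightarrow> C) \<bullet> ks \<bullet> skc"
  have c': "c' \<in> D ((\<sigma> \<rightarrow> A) \<rightarrow> (\<sigma> \<rightarrow> B) \<rightarrow> \<sigma> \<rightarrow> C)"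
    unfolding c'_def using combS_in ks skc ap_in by blast
  have "c' \<bullet> f \<bullet> g \<bullet> x = c \<bullet> (f \<bullet> x) \<bullet> (g \<bullet> x)"
    if "f \<in> D (\<sigma> \<rightarrow> A)" "g \<in> D (\<sigma> \<rightarrow> B)" "x \<in> D \<sigma>" for f g x
  proof -
    have "c' \<bullet> f = ks \<bullet> f \<bullet> (skc \<bullet> f)"
      unfolding c'_def using ks skc that by simp
    also have "ks \<bullet> f = s"
      unfolding ks_def using s that by simp
    also have "s \<bullet> (skc \<bullet> f) \<bullet> g \<bullet> x = skc \<bullet> f \<bullet> x \<bullet> (g \<bullet> x)"
      unfolding s_def using skc that by (intro combS) auto
    also have "skc \<bullet> f \<bullet> x = kc \<bullet> x \<bullet> (f \<bullet> x)"
      unfolding skc_def using kc that by simp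
    also have "kc \<bullet> x = c"
      unfolding kc_def using c that by simp
    finally show ?thesis by simp
  qed
  then show ?case
    using c' c by (auto simp: ctx_Cons A_def B_def C_def intro!: bexI[of _ c'])
qed

lemma rep_const: "c \<in> D \<tau> \<Longrightarrow> rep \<Gamma> \<tau> (\<lambda>_. c)"
  using const_comb[of \<tau> \<Gamma>] unfolding rep_def by blast

lemma rep_ap: "rep \<Gamma> (\<rho> \<rightarrow> \<tau>) F \<Longrightarrow> rep \<Gamma> \<rho> G \<Longrightarrow> rep \<Gamma> \<tau> (\<lambda>xs. F xs \<bullet> G xs)"
proof -
  assume "rep \<Gamma> (\<rho> \<rightarrow> \<tau>) F" "rep \<Gamma> \<rho> G"
  then obtain f g where "f \<in> D (foldr Fn \<Gamma> (\<rho> \<rightarrow> \<tau>))" "\<And>xs. ctx \<Gamma> xs \<Longrightarrow> foldl (\<bullet>) f xs = F xs"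
    "g \<in> D (foldr Fn \<Gamma> \<rho>)" "\<And>xs. ctx \<Gamma> xs \<Longrightarrow> foldl (\<bullet>) g xs = G xs"
    unfolding rep_def by blast
  moreover obtain c where "c\<in>D (foldr Fn \<Gamma> (\<rho> \<rightarrow> \<tau>) \<rightarrow> foldr Fn \<Gamma> \<rho> \<rightarrow> foldr Fn \<Gamma> \<tau>)"
    "\<And>f g xs. f \<in> D (foldr Fn \<Gamma> (\<rho> \<rightarrow> \<tau>)) \<Longrightarrow> g \<in> D (foldr Fn \<Gamma> \<rho>) \<Longrightarrow> ctx \<Gamma> xs \<Longrightarrow>
    foldl (\<bullet>) (c \<bullet> f \<bullet> g) xs = foldl (\<bullet>) f xs \<bullet> foldl (\<bullet>) g xs"
    using ap_comb by meson
  ultimately show ?thesis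
    unfolding rep_def by (intro bexI[of _ "c \<bullet> f \<bullet> g"]) auto
qed

lemma rep_hd: "rep (\<sigma> # \<Gamma>) \<sigma> (\<lambda>xs. hd xs)"
proof -
  obtain k where "k \<in> D (\<sigma> \<rightarrow> foldr Fn \<Gamma> \<sigma>)"
    "\<And>x xs. x \<in> D \<sigma> \<Longrightarrow> ctx \<Gamma> xs \<Longrightarrow> foldl (\<bullet>) (k \<bullet> x) xs = x"
    using const_comb by meson
  then show ?thesis
    unfolding rep_def by (intro bexI[of _ k]) (auto simp: ctx_Cons)
qed

lemma rep_tl: "rep \<Gamma> \<tau> F \<Longrightarrow> rep (\<sigma> # \<Gamma>) \<tau> (\<lambda>xs. F (tl xs))"
proof -
  assume "rep \<Gamma> \<tau> F"
  then obtain f where f: "f \<in> D (foldr Fn \<Gamma> \<tau>)" "\<And>xs. ctx \<Gamma> xs \<Longrightarrow> foldl (\<bullet>) f xs = F xs"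
    unfolding rep_def by blast
  then have "combK (foldr Fn \<Gamma> \<tau>) \<sigma> \<bullet> f \<in> D (\<sigma> \<rightarrow> foldr Fn \<Gamma> \<tau>)"
    using combK_in ap_in by blast
  then show ?thesis
    using f unfolding rep_def
    by (intro bexI[of _ "combK (foldr Fn \<Gamma> \<tau>) \<sigma> \<bullet> f"]) (auto simp: ctx_Cons)
qed

lemmas rep_vars = rep_hd rep_hd[THEN rep_tl] rep_hd[THEN rep_tl, THEN rep_tl]
  rep_hd[THEN rep_tl, THEN rep_tl, THEN rep_tl] rep_hd[THEN rep_tl, THEN rep_tl, THEN rep_tl, THEN rep_tl]
  rep_hd[THEN rep_tl, THEN rep_tl, THEN rep_tl, THEN rep_tl, THEN rep_tl]
  rep_hd[THEN rep_tl, THEN rep_tl, THEN rep_tl, THEN rep_tl, THEN rep_tl, THEN rep_tl]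
  rep_hd[THEN rep_tl, THEN rep_tl, THEN rep_tl, THEN rep_tl, THEN rep_tl, THEN rep_tl, THEN rep_tl]

lemma rep_nth: "i < length \<Gamma> \<Longrightarrow> rep \<Gamma> (\<Gamma> ! i) (\<lambda>xs. xs ! i)"
proof (induction \<Gamma> arbitrary: i)
  case (Cons \<sigma> \<Gamma>)
  show ?case
  proof (cases i)
    case 0
    have "rep (\<sigma> # \<Gamma>) \<sigma> (\<lambda>xs. xs ! 0) \<longleftrightarrow> rep (\<sigma> # \<Gamma>) \<sigma> hd"
      by (rule rep_cong) (auto simp: ctx_Cons)
    then show ?thesis
      using 0 rep_hd by simp
  next
    case (Suc j)
    have "rep (\<sigma> # \<Gamma>) (\<Gamma> ! j) (\<lambda>xs. xs ! Suc j) \<longleftrightarrow> rep (\<sigma> # \<Gamma>) (\<Gamma> ! j) (\<lambda>xs. tl xs ! j)"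
      by (rule rep_cong) (auto simp: ctx_Cons)
    then show ?thesis
      using Suc Cons rep_tl[of \<Gamma> "\<Gamma> ! j" "\<lambda>xs. xs ! j" \<sigma>] by simp
  qed
qed simp

lemma rep_foldl:
  assumes "list_all2 (rep \<Delta>) \<Gamma> Gs" "rep \<Delta> (foldr Fn \<Gamma> \<tau>) F"
  shows "rep \<Delta> \<tau> (\<lambda>xs. foldl (\<bullet>) (F xs) (map (\<lambda>G. G xs) Gs))"
  using assms
proof (induction arbitrary: F rule: list_all2_induct)
  case (Cons \<sigma> \<Gamma> G Gs)
  then show ?case
    using Cons.IH[OF rep_ap[of \<Delta> \<sigma> _ F G]] by simp
qed simp

lemma ctx_length: "ctx \<Gamma> xs \<Longrightarrow> length xs = length \<Gamma>"
  by (simp add: ctx_def list_all2_lengthD)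

lemma ctx_append: "ctx \<Gamma> xs \<Longrightarrow> y \<in> D \<sigma> \<Longrightarrow> ctx (\<Gamma> @ [\<sigma>]) (xs @ [y])"
  by (simp add: ctx_def list_all2_appendI)

lemma ctx_appendE:
  assumes "ctx (\<Gamma> @ [\<sigma>]) zs"
  obtains xs y where "zs = xs @ [y]" "ctx \<Gamma> xs" "y \<in> D \<sigma>"
  using assms unfolding ctx_def list_all2_append1 by (auto simp: list_all2_Cons1)

text \<open>Currying makes the head of the context the first argument, whereas abstraction needs the
  bound variable to be the last one. All variables are projections, so the element can be reapplied
  to them in the other order.\<close>

lemma rep_rotate:
  assumes "rep (\<sigma> # \<Gamma>) \<tau> F"
  shows "rep (\<Gamma> @ [\<sigma>]) \<tau> (\<lambda>zs. F (last zs # butlast zs))"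
proof -
  let ?\<Delta> = "\<Gamma> @ [\<sigma>]" and ?Gs = "(\<lambda>zs. zs ! length \<Gamma>) # map (\<lambda>i zs. zs ! i) [0..<length \<Gamma>]"
  from assms obtain f where f: "f \<in> D (foldr Fn (\<sigma> # \<Gamma>) \<tau>)"
    "\<And>xs. ctx (\<sigma> # \<Gamma>) xs \<Longrightarrow> foldl (\<bullet>) f xs = F xs"
    unfolding rep_def by blast
  have "list_all2 (rep ?\<Delta>) (\<sigma> # \<Gamma>) ?Gs"
    unfolding list_all2_conv_all_nth
  proof (intro conjI allI impI)
    fix i assume "i < length (\<sigma> # \<Gamma>)"
    then show "rep ?\<Delta> ((\<sigma> # \<Gamma>) ! i) (?Gs ! i)"
      using rep_nth[of "case i of 0 \<Rightarrow> length \<Gamma> | Suc j \<Rightarrow> j" ?\<Delta>]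
      by (cases i) (auto simp: nth_append)
  qed simp
  then have "rep ?\<Delta> \<tau> (\<lambda>xs. foldl (\<bullet>) f (map (\<lambda>G. G xs) ?Gs))"
    by (rule rep_foldl) (rule rep_const[OF f(1)])
  moreover have "foldl (\<bullet>) f (map (\<lambda>G. G zs) ?Gs) = F (last zs # butlast zs)" if "ctx ?\<Delta> zs" for zs
  proof -
    obtain xs y where zs: "zs = xs @ [y]" "ctx \<Gamma> xs" "y \<in> D \<sigma>"
      using \<open>ctx ?\<Delta> zs\<close> by (rule ctx_appendE)
    have "map (\<lambda>G. G zs) ?Gs = y # xs"
      using zs ctx_length[OF zs(2)] by (auto simp: nth_append intro!: nth_equalityI)
    then show ?thesis
      using zs f(2)[of "y # xs"] by simp
  qed
  ultimately show ?thesis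
    by (subst rep_cong[of ?\<Delta> _ "\<lambda>xs. foldl (\<bullet>) f (map (\<lambda>G. G xs) ?Gs)"]) simp
qed

text \<open>By extensionality at most one element represents \<open>F\<close>, so the choice is
  harmless whenever \<open>F\<close> is representable.\<close>

definition LAM :: "ty \<Rightarrow> ty \<Rightarrow> ('a \<Rightarrow> 'a) \<Rightarrow> 'a" where
  "LAM \<sigma> \<tau> F = (SOME f. f \<in> D (\<sigma> \<rightarrow> \<tau>) \<and> (\<forall>x\<in>D \<sigma>. f \<bullet> x = F x))"

lemma LAM_eqI:
  assumes "f \<in> D (\<sigma> \<rightarrow> \<tau>)" "\<And>x. x \<in> D \<sigma> \<Longrightarrow> f \<bullet> x = F x"
  shows "LAM \<sigma> \<tau> F = f"
proof -
  have "LAM \<sigma> \<tau> F \<in> D (\<sigma> \<rightarrow> \<tau>) \<and> (\<forall>x\<in>D \<sigma>. LAM \<sigma> \<tau> F \<bullet> x = F x)"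
    unfolding LAM_def by (rule someI[of _ f]) (use assms in auto)
  then show ?thesis
    using assms by (rule_tac extensional[of _ \<sigma> \<tau>]) auto
qed

lemma rep_LAM:
  assumes "rep (\<sigma> # \<Gamma>) \<tau> (\<lambda>xs. F (tl xs) (hd xs))"
  shows "rep \<Gamma> (\<sigma> \<rightarrow> \<tau>) (\<lambda>xs. LAM \<sigma> \<tau> (F xs))"
proof -
  have "rep (\<Gamma> @ [\<sigma>]) \<tau> (\<lambda>zs. F (butlast zs) (last zs))"
    using rep_rotate[OF assms] by simp
  then obtain f where f: "f \<in> D (foldr Fn (\<Gamma> @ [\<sigma>]) \<tau>)"
    "\<And>xs. ctx (\<Gamma> @ [\<sigma>]) xs \<Longrightarrow> foldl (\<bullet>) f xs = F (butlast xs) (last xs)"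
    unfolding rep_def by blast
  have "foldl (\<bullet>) f xs = LAM \<sigma> \<tau> (F xs)" if "ctx \<Gamma> xs" for xs
  proof -
    have "foldl (\<bullet>) f xs \<bullet> y = F xs y" if "y \<in> D \<sigma>" for y
      using f(2)[OF ctx_append[OF \<open>ctx \<Gamma> xs\<close> that]] by simp
    then show ?thesis
      using f(1) foldl_in[of f \<Gamma> "\<sigma> \<rightarrow> \<tau>" xs] that by (subst LAM_eqI[of "foldl (\<bullet>) f xs"]) auto
  qed
  then show ?thesis
    unfolding rep_def using f(1) by (intro bexI[of _ f]) auto
qed

lemma rep_fun1:
  assumes "rep [\<sigma>] \<tau> (\<lambda>xs. F (hd xs))"
  shows "\<exists>f\<in>D (\<sigma> \<rightarrow> \<tau>). \<forall>x\<in>D \<sigma>. f \<bullet> x = F x"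
proof -
  from assms obtain f where "f \<in> D (\<sigma> \<rightarrow> \<tau>)" and f: "\<forall>xs. ctx [\<sigma>] xs \<longrightarrow> foldl (\<bullet>) f xs = F (hd xs)"
    unfolding rep_def by auto
  moreover have "f \<bullet> x = F x" if "x \<in> D \<sigma>" for x
    using f[rule_format, of "[x]"] that by simp
  ultimately show ?thesis by blast
qed

lemma rep_fun2:
  assumes "rep [\<sigma>, \<rho>] \<tau> (\<lambda>xs. F (hd xs) (hd (tl xs)))"
  shows "\<exists>f\<in>D (\<sigma> \<rightarrow> \<rho> \<rightarrow> \<tau>). \<forall>x\<in>D \<sigma>. \<forall>y\<in>D \<rho>. f \<bullet> x \<bullet> y = F x y"
proof -
  from assms obtain f where "f \<in> D (\<sigma> \<rightarrow> \<rho> \<rightarrow> \<tau>)"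
    and f: "\<forall>xs. ctx [\<sigma>, \<rho>] xs \<longrightarrow> foldl (\<bullet>) f xs = F (hd xs) (hd (tl xs))"
    unfolding rep_def by auto
  moreover have "f \<bullet> x \<bullet> y = F x y" if "x \<in> D \<sigma>" "y \<in> D \<rho>" for x y
    using f[rule_format, of "[x, y]"] that by simp
  ultimately show ?thesis by blast
qed

lemma LAM:
  assumes "rep [\<sigma>] \<tau> (\<lambda>xs. F (hd xs))"
  shows "LAM \<sigma> \<tau> F \<in> D (\<sigma> \<rightarrow> \<tau>)" "x \<in> D \<sigma> \<Longrightarrow> LAM \<sigma> \<tau> F \<bullet> x = F x"
  using rep_fun1[OF assms] LAM_eqI by force+

section \<open>Decidable predicates and induction\<close>

lemma ap_in_simps [simp]:
  "f \<in> D (N \<rightarrow> \<tau>) \<Longrightarrow> n \<in> D N \<Longrightarrow> f \<bullet> n \<in> D \<tau>"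
  "f \<in> D (ty1 \<rightarrow> \<tau>) \<Longrightarrow> x \<in> D ty1 \<Longrightarrow> f \<bullet> x \<in> D \<tau>"
  by auto

lemma succ_closed [simp]: "n \<in> D N \<Longrightarrow> succ \<bullet> n \<in> D N"
  by simp

text \<open>Zero stands for truth, so that a decidable predicate becomes an equation with zero, the
  form in which induction and choice are available.\<close>

definition dec :: "ty list \<Rightarrow> ('a list \<Rightarrow> bool) \<Rightarrow> bool" where
  "dec \<Gamma> P \<longleftrightarrow> rep \<Gamma> N (\<lambda>xs. if P xs then zero else succ \<bullet> zero)"

lemma dec_cong: "(\<And>xs. ctx \<Gamma> xs \<Longrightarrow> P xs = Q xs) \<Longrightarrow> dec \<Gamma> P = dec \<Gamma> Q"
  unfolding dec_def by (rule rep_cong) simp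

lemma const_fun:
  assumes "b \<in> D N"
  shows "combK ty1 N \<bullet> (combK N N \<bullet> b) \<in> D (N \<rightarrow> ty1)"
    "m \<in> D N \<Longrightarrow> n \<in> D N \<Longrightarrow> combK ty1 N \<bullet> (combK N N \<bullet> b) \<bullet> m \<bullet> n = b"
proof -
  have *: "combK N N \<bullet> b \<in> D ty1"
    using combK_in assms ap_in by blast
  then show "combK ty1 N \<bullet> (combK N N \<bullet> b) \<in> D (N \<rightarrow> ty1)"
    using combK_in ap_in by blast
  show "m \<in> D N \<Longrightarrow> n \<in> D N \<Longrightarrow> combK ty1 N \<bullet> (combK N N \<bullet> b) \<bullet> m \<bullet> n = b"
    using * assms by simp
qed

text \<open>Recursion with a constant step is a case distinction: the value is that of
  \<open>F\<close> at zero and that of \<open>G\<close> at every successor.\<close>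

lemma rep_cases:
  assumes "rep \<Gamma> N F" "rep \<Gamma> N G"
  shows "rep \<Gamma> ty1 (\<lambda>xs. recursor \<bullet> (combK ty1 N \<bullet> (combK N N \<bullet> G xs)) \<bullet> F xs)"
  by (rule rep_ap rep_const recursor_in combK_in assms)+

lemma rep_if:
  assumes "dec \<Gamma> P" "rep \<Gamma> N F" "rep \<Gamma> N G"
  shows "rep \<Gamma> N (\<lambda>xs. if P xs then F xs else G xs)"
proof -
  have "rep \<Gamma> N (\<lambda>xs. recursor \<bullet> (combK ty1 N \<bullet> (combK N N \<bullet> G xs)) \<bullet> F xs \<bullet>
      (if P xs then zero else succ \<bullet> zero))"
    using assms unfolding dec_def by (intro rep_ap[OF rep_cases])
  then show ?thesis
    by (subst rep_cong) (auto simp: const_fun rep_in[OF assms(2)] rep_in[OF assms(3)])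
qed

lemma rep_zero: "rep \<Gamma> N (\<lambda>_. zero)"
  by (simp add: rep_const)

lemma rep_succ: "rep \<Gamma> N F \<Longrightarrow> rep \<Gamma> N (\<lambda>xs. succ \<bullet> F xs)"
  by (rule rep_ap[OF rep_const]) simp_all

lemma dec_const: "dec \<Gamma> (\<lambda>_. b)"
  by (cases b) (simp_all add: dec_def rep_zero rep_succ)

lemma dec_if:
  assumes "dec \<Gamma> P" "dec \<Gamma> Q" "dec \<Gamma> R"
  shows "dec \<Gamma> (\<lambda>xs. if P xs then Q xs else R xs)"
proof -
  have "rep \<Gamma> N (\<lambda>xs. if P xs then (if Q xs then zero else succ \<bullet> zero) else (if R xs then zero else succ \<bullet> zero))"
    by (rule rep_if assms(1) assms(2,3)[unfolded dec_def])+
  then show ?thesis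
    unfolding dec_def by (rule rep_cong[THEN iffD1, rotated]) simp
qed

lemma dec_not: "dec \<Gamma> P \<Longrightarrow> dec \<Gamma> (\<lambda>xs. \<not> P xs)"
  by (rule dec_cong[THEN iffD1, rotated, OF dec_if[OF _ dec_const[of _ False] dec_const[of _ True]]]) auto

lemma dec_and: "dec \<Gamma> P \<Longrightarrow> dec \<Gamma> Q \<Longrightarrow> dec \<Gamma> (\<lambda>xs. P xs \<and> Q xs)"
  by (rule dec_cong[THEN iffD1, rotated, OF dec_if[OF _ _ dec_const[of _ False], of _ P Q]]) auto

lemma dec_or: "dec \<Gamma> P \<Longrightarrow> dec \<Gamma> Q \<Longrightarrow> dec \<Gamma> (\<lambda>xs. P xs \<or> Q xs)"
  using dec_not[OF dec_and[OF dec_not dec_not]] by simp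

lemma dec_imp: "dec \<Gamma> P \<Longrightarrow> dec \<Gamma> Q \<Longrightarrow> dec \<Gamma> (\<lambda>xs. P xs \<longrightarrow> Q xs)"
  using dec_not[OF dec_and[OF _ dec_not]] by simp

lemma dec_iff: "dec \<Gamma> P \<Longrightarrow> dec \<Gamma> Q \<Longrightarrow> dec \<Gamma> (\<lambda>xs. P xs \<longleftrightarrow> Q xs)"
  using dec_and[OF dec_imp dec_imp, of \<Gamma> P Q Q P] by (simp add: iff_conv_conj_imp)

lemma dec_eq:
  assumes "rep \<Gamma> N F" "rep \<Gamma> N G"
  shows "dec \<Gamma> (\<lambda>xs. F xs = G xs)"
proof -
  obtain Y where Y: "Y \<in> D ty2" "\<And>f. f \<in> D ty1 \<Longrightarrow> Y \<bullet> f = (if f \<bullet> zero = f \<bullet> (succ \<bullet> zero) then zero else succ \<bullet> zero)"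
    using equality_test by blast
  \<comment> \<open>The functional of \<open>equality_test\<close> compares the values of one
    function at zero and one, so the two sides are packed into such a function.\<close>
  have *: "rep \<Gamma> ty1 (\<lambda>xs. recursor \<bullet> (combK ty1 N \<bullet> (combK N N \<bullet> G xs)) \<bullet> F xs)"
    using assms by (rule rep_cases)
  have "rep \<Gamma> N (\<lambda>xs. Y \<bullet> (recursor \<bullet> (combK ty1 N \<bullet> (combK N N \<bullet> G xs)) \<bullet> F xs))"
    by (rule rep_ap[OF rep_const[OF Y(1)] *])
  then show ?thesis
    unfolding dec_def
    by (subst rep_cong) (auto simp: Y(2)[OF rep_in[OF *]] const_fun rep_in[OF assms(1)] rep_in[OF assms(2)])
qed

lemma dec_compose:
  assumes "dec [N] (\<lambda>xs. P (hd xs))" "rep \<Gamma> N F"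
  shows "dec \<Gamma> (\<lambda>xs. P (F xs))"
proof -
  obtain p where p: "p \<in> D ty1" "\<And>n. n \<in> D N \<Longrightarrow> p \<bullet> n = (if P n then zero else succ \<bullet> zero)"
    using rep_fun1[OF assms(1)[unfolded dec_def]] by blast
  have "rep \<Gamma> N (\<lambda>xs. p \<bullet> F xs)"
    by (rule rep_ap[OF rep_const[OF p(1)] assms(2)])
  then show ?thesis
    unfolding dec_def by (rule rep_cong[THEN iffD1, rotated]) (simp add: p(2) rep_in[OF assms(2)])
qed

lemma IND:
  assumes "dec [N] (\<lambda>xs. P (hd xs))" "P zero" "\<And>n. n \<in> D N \<Longrightarrow> P n \<Longrightarrow> P (succ \<bullet> n)" "n \<in> D N"
  shows "P n"
proof -
  obtain f where f: "f \<in> D ty1" "\<And>n. n \<in> D N \<Longrightarrow> f \<bullet> n = (if P n then zero else succ \<bullet> zero)"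
    using rep_fun1[OF assms(1)[unfolded dec_def]] by blast
  have "f \<bullet> n = zero"
    by (rule induct_zero) (use f assms in \<open>auto split: if_splits\<close>)
  then show ?thesis
    using f assms(4) by (auto split: if_splits)
qed

end

section \<open>Number quantifiers and selection of numerical witnesses\<close>

locale aca_model = model +
  assumes exists2_in: "exists2 \<in> T" and QF_AC_in: "QF_AC_0_1 \<subseteq> T"
begin

lemma QF_AC_0_1:
  assumes "F \<in> D (ty1 \<rightarrow> N \<rightarrow> N)" "\<And>n. n \<in> D N \<Longrightarrow> \<exists>f\<in>D ty1. F \<bullet> f \<bullet> n = zero"
  shows "\<exists>s\<in>D (N \<rightarrow> ty1). \<forall>n\<in>D N. F \<bullet> (s \<bullet> n) \<bullet> n = zero"
proof -
  let ?\<phi> = "Var (ty1 \<rightarrow> N \<rightarrow> N) 0 \<cdot> Var ty1 0 \<cdot> Var N 0 \<doteq> Zero" and ?e = "upd e0 (ty1 \<rightarrow> N \<rightarrow> N) 0 F"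
  have "wf_fm ?\<phi>" "quantifier_free ?\<phi>" "fresh ?\<phi> \<le> 1"
    by simp_all
  then have "(ForallV N 0 (ExistsV ty1 0 ?\<phi>)
    \<^bold>\<longrightarrow> ExistsV (N \<rightarrow> ty1) 1 (ForallV N 0 (replace ty1 0 (Var (N \<rightarrow> ty1) 1 \<cdot> Var N 0) ?\<phi>))) \<in> QF_AC_0_1"
    unfolding QF_AC_0_1_def by blast
  moreover have "typed ?e"
    using assms typed_e0 by auto
  ultimately have "sat ?e (ForallV N 0 (ExistsV ty1 0 ?\<phi>)
    \<^bold>\<longrightarrow> ExistsV (N \<rightarrow> ty1) 1 (ForallV N 0 (replace ty1 0 (Var (N \<rightarrow> ty1) 1 \<cdot> Var N 0) ?\<phi>)))"
    using QF_AC_in sat_axiom by blast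
  then show ?thesis
    using assms by (auto simp: sat_replace upd_def)
qed

lemma choice_sequence:
  assumes "dec [ty1, N] (\<lambda>xs. P (hd xs) (hd (tl xs)))" "\<And>n. n \<in> D N \<Longrightarrow> \<exists>f\<in>D ty1. P f n"
  shows "\<exists>s\<in>D (N \<rightarrow> ty1). \<forall>n\<in>D N. P (s \<bullet> n) n"
proof -
  obtain F where F: "F \<in> D (ty1 \<rightarrow> N \<rightarrow> N)"
    "\<And>f n. f \<in> D ty1 \<Longrightarrow> n \<in> D N \<Longrightarrow> F \<bullet> f \<bullet> n = (if P f n then zero else succ \<bullet> zero)"
    using rep_fun2[OF assms(1)[unfolded dec_def]] by blast
  then have "\<exists>f\<in>D ty1. F \<bullet> f \<bullet> n = zero" if "n \<in> D N" for n
    using assms(2)[OF that] that by auto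
  then obtain s where s: "s \<in> D (N \<rightarrow> ty1)" "\<And>n. n \<in> D N \<Longrightarrow> F \<bullet> (s \<bullet> n) \<bullet> n = zero"
    using QF_AC_0_1[OF F(1)] by blast
  have "P (s \<bullet> n) n" if "n \<in> D N" for n
    using F(2)[of "s \<bullet> n" n] s that by (auto split: if_splits)
  then show ?thesis
    using s by blast
qed

lemma ex_functional: "\<exists>E\<in>D ty2. \<forall>f\<in>D ty1.
    (E \<bullet> f = zero \<or> E \<bullet> f = succ \<bullet> zero) \<and> (E \<bullet> f = zero \<longleftrightarrow> (\<exists>n\<in>D N. f \<bullet> n = zero))"
  using sat_axiom[OF exists2_in typed_e0] by (simp only: sat_exists2)

definition Ex2 :: 'a where
  "Ex2 = (SOME E. E \<in> D ty2 \<and> (\<forall>f\<in>D ty1. (E \<bullet> f = zero \<or> E \<bullet> f = succ \<bullet> zero) \<and>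
    (E \<bullet> f = zero \<longleftrightarrow> (\<exists>n\<in>D N. f \<bullet> n = zero))))"

lemma Ex2: "Ex2 \<in> D ty2" "f \<in> D ty1 \<Longrightarrow> Ex2 \<bullet> f = (if \<exists>n\<in>D N. f \<bullet> n = zero then zero else succ \<bullet> zero)"
proof -
  have "Ex2 \<in> D ty2 \<and> (\<forall>f\<in>D ty1. (Ex2 \<bullet> f = zero \<or> Ex2 \<bullet> f = succ \<bullet> zero) \<and>
    (Ex2 \<bullet> f = zero \<longleftrightarrow> (\<exists>n\<in>D N. f \<bullet> n = zero)))"
    unfolding Ex2_def by (rule someI_ex) (use ex_functional in blast)
  then show "Ex2 \<in> D ty2" "f \<in> D ty1 \<Longrightarrow> Ex2 \<bullet> f = (if \<exists>n\<in>D N. f \<bullet> n = zero then zero else succ \<bullet> zero)"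
    by auto
qed

definition char_fun :: "('a \<Rightarrow> bool) \<Rightarrow> 'a" where
  "char_fun P = LAM N N (\<lambda>n. if P n then zero else succ \<bullet> zero)"

lemma rep_char_fun: "dec (N # \<Gamma>) (\<lambda>xs. P (tl xs) (hd xs)) \<Longrightarrow> rep \<Gamma> ty1 (\<lambda>xs. char_fun (P xs))"
  unfolding char_fun_def dec_def by (rule rep_LAM)

lemma char_fun:
  assumes "dec [N] (\<lambda>xs. P (hd xs))"
  shows "char_fun P \<in> D ty1" "n \<in> D N \<Longrightarrow> char_fun P \<bullet> n = (if P n then zero else succ \<bullet> zero)"
  unfolding char_fun_def using LAM[OF assms[unfolded dec_def]] by simp_all

text \<open>Fixing the remaining arguments turns them into constants. The facts on
  \<open>char_fun\<close> concern one variable, while the rules for quantifiers work in a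
  context.\<close>

lemma dec_param:
  assumes "dec (\<sigma> # \<Gamma>) (\<lambda>xs. P (tl xs) (hd xs))" "ctx \<Gamma> xs"
  shows "dec [\<sigma>] (\<lambda>ys. P xs (hd ys))"
proof -
  obtain f where f: "f \<in> D (foldr Fn (\<sigma> # \<Gamma>) N)"
    "\<And>xs. ctx (\<sigma> # \<Gamma>) xs \<Longrightarrow> foldl (\<bullet>) f xs = (if P (tl xs) (hd xs) then zero else succ \<bullet> zero)"
    using assms(1) unfolding dec_def rep_def by blast
  have "list_all2 (rep [\<sigma>]) (\<sigma> # \<Gamma>) (hd # map (\<lambda>c _. c) xs)"
    using assms(2) rep_hd[of \<sigma> "[]"] unfolding ctx_def
    by (simp add: list_all2_map2 rep_const list_all2_mono)
  then have "rep [\<sigma>] N (\<lambda>ys. foldl (\<bullet>) f (map (\<lambda>G. G ys) (hd # map (\<lambda>c _. c) xs)))"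
    by (rule rep_foldl) (rule rep_const[OF f(1)])
  then show ?thesis
    unfolding dec_def
  proof (rule rep_cong[THEN iffD1, rotated])
    fix ys assume "ctx [\<sigma>] ys"
    then have "ctx (\<sigma> # \<Gamma>) (hd ys # xs)"
      using assms(2) by (cases ys) auto
    then show "foldl (\<bullet>) f (map (\<lambda>G. G ys) (hd # map (\<lambda>c _. c) xs)) = (if P xs (hd ys) then zero else succ \<bullet> zero)"
      using f(2)[of "hd ys # xs"] by (simp add: o_def)
  qed
qed

text \<open>The functional of \<exists>^2 is applied to the characteristic function of the body.
  Together with the connectives, this makes every arithmetical predicate with parameters
  decidable.\<close>

lemma dec_ex:
  assumes "dec (N # \<Gamma>) (\<lambda>xs. P (tl xs) (hd xs))"
  shows "dec \<Gamma> (\<lambda>xs. \<exists>n\<in>D N. P xs n)"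
proof -
  have "rep \<Gamma> N (\<lambda>xs. Ex2 \<bullet> char_fun (P xs))"
    by (rule rep_ap rep_const Ex2(1) rep_char_fun assms)+
  moreover have "Ex2 \<bullet> char_fun (P xs) = (if \<exists>n\<in>D N. P xs n then zero else succ \<bullet> zero)" if "ctx \<Gamma> xs" for xs
    using char_fun[OF dec_param[OF assms that]] by (auto simp: Ex2)
  ultimately show ?thesis
    unfolding dec_def by (subst rep_cong[symmetric]) auto
qed

lemma dec_all:
  assumes "dec (N # \<Gamma>) (\<lambda>xs. P (tl xs) (hd xs))"
  shows "dec \<Gamma> (\<lambda>xs. \<forall>n\<in>D N. P xs n)"
  using dec_not[OF dec_ex[OF dec_not[OF assms]]] by simp

text \<open>This is Feferman's mu operator without minimality. The implication from
  \<open>Ex2 f = 0\<close> to \<open>f n = 0\<close> is decidable and always has a witness, any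
  number at all if \<open>f\<close> has no zero, so choice over Baire space applies.\<close>

lemma choice_functional: "\<exists>Y\<in>D ty2. \<forall>f\<in>D ty1. (\<exists>n\<in>D N. f \<bullet> n = zero) \<longrightarrow> f \<bullet> (Y \<bullet> f) = zero"
proof -
  have "dec [ty1, N] (\<lambda>xs. Ex2 \<bullet> hd xs = zero \<longrightarrow> hd xs \<bullet> hd (tl xs) = zero)"
    by (intro dec_imp dec_eq rep_ap[OF rep_const[OF Ex2(1)]] rep_ap[OF rep_vars(1)] rep_vars rep_zero)
  then obtain F where F: "F \<in> D (ty1 \<rightarrow> N \<rightarrow> N)" "\<And>f n. f \<in> D ty1 \<Longrightarrow> n \<in> D N \<Longrightarrow>
      F \<bullet> f \<bullet> n = (if Ex2 \<bullet> f = zero \<longrightarrow> f \<bullet> n = zero then zero else succ \<bullet> zero)"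
    using rep_fun2[of ty1 N N "\<lambda>f n. if Ex2 \<bullet> f = zero \<longrightarrow> f \<bullet> n = zero then zero else succ \<bullet> zero"]
    unfolding dec_def by blast
  have "\<exists>n\<in>D N. F \<bullet> f \<bullet> n = zero" if "f \<in> D ty1" for f
  proof (cases "\<exists>n\<in>D N. f \<bullet> n = zero")
    case False
    then show ?thesis
      using that by (intro bexI[of _ zero]) (auto simp: F Ex2)
  qed (use that in \<open>auto simp: F\<close>)
  then obtain Y where Y: "Y \<in> D ty2" "\<And>f. f \<in> D ty1 \<Longrightarrow> F \<bullet> f \<bullet> (Y \<bullet> f) = zero"
    using QF_AC_1_0[OF F(1)] by blast
  show ?thesis
  proof (intro bexI[of _ Y] ballI impI)
    fix f assume f: "f \<in> D ty1" and "\<exists>n\<in>D N. f \<bullet> n = zero"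
    then have "Ex2 \<bullet> f = zero"
      by (simp add: Ex2)
    moreover have "Y \<bullet> f \<in> D N"
      using Y f by simp
    ultimately show "f \<bullet> (Y \<bullet> f) = zero"
      using F(2)[OF f] Y(2)[OF f] by (metis succ_nonzero(1) zero_in)
  qed fact
qed

definition Ch2 :: 'a where
  "Ch2 = (SOME Y. Y \<in> D ty2 \<and> (\<forall>f\<in>D ty1. (\<exists>n\<in>D N. f \<bullet> n = zero) \<longrightarrow> f \<bullet> (Y \<bullet> f) = zero))"

lemma Ch2: "Ch2 \<in> D ty2" "f \<in> D ty1 \<Longrightarrow> \<exists>n\<in>D N. f \<bullet> n = zero \<Longrightarrow> f \<bullet> (Ch2 \<bullet> f) = zero"
proof -
  have "Ch2 \<in> D ty2 \<and> (\<forall>f\<in>D ty1. (\<exists>n\<in>D N. f \<bullet> n = zero) \<longrightarrow> f \<bullet> (Ch2 \<bullet> f) = zero)"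
    unfolding Ch2_def by (rule someI_ex) (use choice_functional in blast)
  then show "Ch2 \<in> D ty2" "f \<in> D ty1 \<Longrightarrow> \<exists>n\<in>D N. f \<bullet> n = zero \<Longrightarrow> f \<bullet> (Ch2 \<bullet> f) = zero"
    by auto
qed

text \<open>The selected witness need not be least, and it is an arbitrary number if there is none.
  It depends on the extension of the predicate only.\<close>

definition CH :: "('a \<Rightarrow> bool) \<Rightarrow> 'a" where
  "CH P = Ch2 \<bullet> char_fun P"

lemma rep_CH: "dec (N # \<Gamma>) (\<lambda>xs. P (tl xs) (hd xs)) \<Longrightarrow> rep \<Gamma> N (\<lambda>xs. CH (P xs))"
  unfolding CH_def by (rule rep_ap rep_const Ch2(1) rep_char_fun | assumption)+

lemma CH:
  assumes "dec [N] (\<lambda>xs. P (hd xs))"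
  shows "CH P \<in> D N" "\<exists>n\<in>D N. P n \<Longrightarrow> P (CH P)"
proof -
  show *: "CH P \<in> D N"
    unfolding CH_def using char_fun[OF assms] Ch2 by auto
  assume "\<exists>n\<in>D N. P n"
  then have "char_fun P \<bullet> CH P = zero"
    unfolding CH_def using char_fun[OF assms] by (intro Ch2) auto
  then show "P (CH P)"
    using char_fun[OF assms] * by (auto split: if_splits)
qed

lemmas dec_rules = dec_not dec_and dec_or dec_imp dec_iff dec_ex dec_all dec_eq
lemmas rep_rules = rep_zero rep_succ rep_if rep_LAM rep_CH rep_vars


section \<open>Arithmetic\<close>

lemma add_simps [simp]:
  assumes "m \<in> D N" "n \<in> D N"
  shows "m \<^bold>+ n \<in> D N" "m \<^bold>+ succ \<bullet> n = succ \<bullet> (m \<^bold>+ n)"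
proof -
  have f: "combK ty1 N \<bullet> succ \<in> D (N \<rightarrow> ty1)"
    using combK_in succ_in ap_in by blast
  then show *: "m \<^bold>+ n \<in> D N"
    unfolding add_def using recursor_in assms ap_in by blast
  show "m \<^bold>+ succ \<bullet> n = succ \<bullet> (m \<^bold>+ n)"
    using f assms * by (simp_all add: add_def)
qed

lemma add_zero [simp]: "m \<in> D N \<Longrightarrow> m \<^bold>+ zero = m"
  using recursor_zero[of "combK ty1 N \<bullet> succ" m] combK_in succ_in ap_in unfolding add_def by blast

lemma rep_add: "rep \<Gamma> N F \<Longrightarrow> rep \<Gamma> N G \<Longrightarrow> rep \<Gamma> N (\<lambda>xs. F xs \<^bold>+ G xs)"
  unfolding add_def by (rule rep_ap, rule rep_ap, rule rep_const)
    (use combK_in succ_in recursor_in ap_in in blast)+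

lemma mul_simps [simp]:
  assumes "m \<in> D N" "n \<in> D N"
  shows "m \<^bold>* n \<in> D N" "m \<^bold>* (succ \<bullet> n) = m \<^bold>+ m \<^bold>* n"
proof -
  have "recursor \<bullet> (combK ty1 N \<bullet> succ) \<bullet> m \<in> D ty1"
    using combK_in succ_in recursor_in assms ap_in by blast
  moreover from this have "combK ty1 N \<bullet> (recursor \<bullet> (combK ty1 N \<bullet> succ) \<bullet> m) \<in> D (N \<rightarrow> ty1)"
    using combK_in ap_in by blast
  ultimately show *: "m \<^bold>* n \<in> D N" "m \<^bold>* (succ \<bullet> n) = m \<^bold>+ m \<^bold>* n"
    unfolding mul_def add_def using assms ap_in[OF ap_in[OF recursor_in]] by simp_all
qed

lemma mul_zero [simp]: "m \<in> D N \<Longrightarrow> m \<^bold>* zero = zero"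
  using recursor_zero[of "combK ty1 N \<bullet> (recursor \<bullet> (combK ty1 N \<bullet> succ) \<bullet> m)" zero]
    combK_in succ_in recursor_in zero_in ap_in unfolding mul_def by blast

lemma rep_mul: "rep \<Gamma> N F \<Longrightarrow> rep \<Gamma> N G \<Longrightarrow> rep \<Gamma> N (\<lambda>xs. F xs \<^bold>* G xs)"
  unfolding mul_def by (intro rep_ap[OF rep_ap[OF rep_ap[OF rep_const[OF recursor_in]]]]
      rep_ap[OF rep_const[OF combK_in]] rep_ap[OF rep_const] rep_zero) (use recursor_in combK_in succ_in ap_in in blast)+

definition pred :: "'a \<Rightarrow> 'a" where
  "pred n = recursor \<bullet> combK N N \<bullet> zero \<bullet> n"

lemma pred_simps [simp]: "n \<in> D N \<Longrightarrow> pred n \<in> D N" "pred zero = zero" "n \<in> D N \<Longrightarrow> pred (succ \<bullet> n) = n"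
proof -
  have *: "recursor \<bullet> combK N N \<bullet> zero \<in> D ty1"
    using recursor_in combK_in zero_in ap_in by blast
  then show "n \<in> D N \<Longrightarrow> pred n \<in> D N" "pred zero = zero" "n \<in> D N \<Longrightarrow> pred (succ \<bullet> n) = n"
    by (simp_all add: pred_def)
qed

lemma sub_simps [simp]:
  assumes "m \<in> D N" "n \<in> D N"
  shows "m \<^bold>- n \<in> D N" "m \<^bold>- (succ \<bullet> n) = pred (m \<^bold>- n)"
proof -
  have "recursor \<bullet> combK N N \<bullet> zero \<in> D ty1"
    using recursor_in combK_in zero_in ap_in by blast
  moreover from this have "combK ty1 N \<bullet> (recursor \<bullet> combK N N \<bullet> zero) \<in> D (N \<rightarrow> ty1)"
    using combK_in ap_in by blast
  ultimately show *: "m \<^bold>- n \<in> D N" "m \<^bold>- (succ \<bullet> n) = pred (m \<^bold>- n)"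
    unfolding sub_def pred_def using assms ap_in[OF ap_in[OF recursor_in]] by simp_all
qed

lemma sub_zero [simp]: "m \<in> D N \<Longrightarrow> m \<^bold>- zero = m"
  using recursor_zero[of "combK ty1 N \<bullet> (recursor \<bullet> combK N N \<bullet> zero)" m]
    combK_in recursor_in zero_in ap_in unfolding sub_def by blast

lemma rep_sub: "rep \<Gamma> N F \<Longrightarrow> rep \<Gamma> N G \<Longrightarrow> rep \<Gamma> N (\<lambda>xs. F xs \<^bold>- G xs)"
  unfolding sub_def by (rule rep_ap, rule rep_ap, rule rep_const)
    (use combK_in zero_in recursor_in ap_in in blast)+

lemma rep_pred: "rep \<Gamma> N F \<Longrightarrow> rep \<Gamma> N (\<lambda>xs. pred (F xs))"
  unfolding pred_def by (rule rep_ap, rule rep_const)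
    (use combK_in zero_in recursor_in ap_in in blast)+

lemma dec_le: "rep \<Gamma> N F \<Longrightarrow> rep \<Gamma> N G \<Longrightarrow> dec \<Gamma> (\<lambda>xs. F xs \<^bold>\<le> G xs)"
  unfolding le_def by (intro dec_eq rep_sub rep_zero)

text \<open>Used as introduction rules, these establish decidability along the shape of a predicate,
  which is the first goal of each application of \<open>IND\<close>.\<close>

lemmas arith_rules = dec_rules dec_le rep_rules rep_add rep_mul rep_sub rep_pred

lemma nat_cases:
  assumes "n \<in> D N"
  obtains "n = zero" | m where "m \<in> D N" "n = succ \<bullet> m"
proof -
  have "n = zero \<or> (\<exists>m\<in>D N. n = succ \<bullet> m)"
    by (rule IND[of "\<lambda>n. n = zero \<or> (\<exists>m\<in>D N. n = succ \<bullet> m)", OF _ _ _ assms])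
      (intro arith_rules, auto)
  then show ?thesis
    using that by blast
qed

lemma zero_add [simp]: "n \<in> D N \<Longrightarrow> zero \<^bold>+ n = n"
  by (rule IND[of "\<lambda>n. zero \<^bold>+ n = n"]) (intro arith_rules, auto)

lemma succ_add [simp]: "m \<in> D N \<Longrightarrow> n \<in> D N \<Longrightarrow> succ \<bullet> m \<^bold>+ n = succ \<bullet> (m \<^bold>+ n)"
  by (rule IND[of "\<lambda>n. succ \<bullet> m \<^bold>+ n = succ \<bullet> (m \<^bold>+ n)"])
    (intro arith_rules rep_const, auto)

lemma add_comm: "m \<in> D N \<Longrightarrow> n \<in> D N \<Longrightarrow> m \<^bold>+ n = n \<^bold>+ m"
  by (rule IND[of "\<lambda>n. m \<^bold>+ n = n \<^bold>+ m"]) (intro arith_rules rep_const, auto)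

lemma add_assoc: "k \<in> D N \<Longrightarrow> m \<in> D N \<Longrightarrow> n \<in> D N \<Longrightarrow> k \<^bold>+ m \<^bold>+ n = k \<^bold>+ (m \<^bold>+ n)"
  by (rule IND[of "\<lambda>n. k \<^bold>+ m \<^bold>+ n = k \<^bold>+ (m \<^bold>+ n)"]) (intro arith_rules rep_const, auto)

lemma add_left_comm: "k \<in> D N \<Longrightarrow> m \<in> D N \<Longrightarrow> n \<in> D N \<Longrightarrow> k \<^bold>+ (m \<^bold>+ n) = m \<^bold>+ (k \<^bold>+ n)"
  by (simp add: add_assoc[symmetric] add_comm[of k m])

lemmas add_ac = add_assoc add_comm add_left_comm

lemma zero_mul [simp]: "n \<in> D N \<Longrightarrow> zero \<^bold>* n = zero"
  by (rule IND[of "\<lambda>n. zero \<^bold>* n = zero"]) (intro arith_rules, auto)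

lemma succ_mul [simp]: "m \<in> D N \<Longrightarrow> n \<in> D N \<Longrightarrow> succ \<bullet> m \<^bold>* n = n \<^bold>+ m \<^bold>* n"
  by (rule IND[of "\<lambda>n. succ \<bullet> m \<^bold>* n = n \<^bold>+ m \<^bold>* n"])
    (intro arith_rules rep_const, auto simp: add_ac)

lemma mul_comm: "m \<in> D N \<Longrightarrow> n \<in> D N \<Longrightarrow> m \<^bold>* n = n \<^bold>* m"
  by (rule IND[of "\<lambda>n. m \<^bold>* n = n \<^bold>* m"]) (intro arith_rules rep_const, auto)

lemma distrib_left: "k \<in> D N \<Longrightarrow> m \<in> D N \<Longrightarrow> n \<in> D N \<Longrightarrow> k \<^bold>* (m \<^bold>+ n) = k \<^bold>* m \<^bold>+ k \<^bold>* n"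
  by (rule IND[of "\<lambda>n. k \<^bold>* (m \<^bold>+ n) = k \<^bold>* m \<^bold>+ k \<^bold>* n"])
    (intro arith_rules rep_const, auto simp: add_ac)

lemma distrib_right: "k \<in> D N \<Longrightarrow> m \<in> D N \<Longrightarrow> n \<in> D N \<Longrightarrow> (m \<^bold>+ n) \<^bold>* k = m \<^bold>* k \<^bold>+ n \<^bold>* k"
  by (simp add: mul_comm[of _ k] distrib_left)

lemma mul_assoc: "k \<in> D N \<Longrightarrow> m \<in> D N \<Longrightarrow> n \<in> D N \<Longrightarrow> k \<^bold>* m \<^bold>* n = k \<^bold>* (m \<^bold>* n)"
  by (rule IND[of "\<lambda>n. k \<^bold>* m \<^bold>* n = k \<^bold>* (m \<^bold>* n)"])
    (intro arith_rules rep_const, auto simp: distrib_left)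

lemma mul_left_comm: "k \<in> D N \<Longrightarrow> m \<in> D N \<Longrightarrow> n \<in> D N \<Longrightarrow> k \<^bold>* (m \<^bold>* n) = m \<^bold>* (k \<^bold>* n)"
  by (simp add: mul_assoc[symmetric] mul_comm[of k m])

lemmas mul_ac = mul_assoc mul_comm mul_left_comm

lemma zero_sub [simp]: "n \<in> D N \<Longrightarrow> zero \<^bold>- n = zero"
  by (rule IND[of "\<lambda>n. zero \<^bold>- n = zero"]) (intro arith_rules, auto)

lemma succ_sub_succ [simp]: "m \<in> D N \<Longrightarrow> n \<in> D N \<Longrightarrow> succ \<bullet> m \<^bold>- succ \<bullet> n = m \<^bold>- n"
  by (rule IND[of "\<lambda>n. succ \<bullet> m \<^bold>- succ \<bullet> n = m \<^bold>- n"]) (intro arith_rules rep_const, auto)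

lemma le_simps [simp]:
  "n \<in> D N \<Longrightarrow> zero \<^bold>\<le> n" "n \<in> D N \<Longrightarrow> n \<^bold>\<le> zero \<longleftrightarrow> n = zero"
  "m \<in> D N \<Longrightarrow> n \<in> D N \<Longrightarrow> succ \<bullet> m \<^bold>\<le> succ \<bullet> n \<longleftrightarrow> m \<^bold>\<le> n"
  by (simp_all add: le_def del: sub_simps(2)) 

text \<open>The induction is on \<open>m\<close> for all \<open>n\<close> simultaneously. Such
  quantified induction statements are admissible because number quantifiers preserve
  decidability.\<close>

lemma le_iff_add:
  assumes "m \<in> D N" "n \<in> D N"
  shows "m \<^bold>\<le> n \<longleftrightarrow> (\<exists>k\<in>D N. n = m \<^bold>+ k)"
proof -
  have "\<forall>n\<in>D N. m \<^bold>\<le> n \<longleftrightarrow> (\<exists>k\<in>D N. n = m \<^bold>+ k)"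
  proof (rule IND[of "\<lambda>m. \<forall>n\<in>D N. m \<^bold>\<le> n \<longleftrightarrow> (\<exists>k\<in>D N. n = m \<^bold>+ k)", OF _ _ _ assms(1)])
    show "dec [N] (\<lambda>xs. \<forall>n\<in>D N. hd xs \<^bold>\<le> n \<longleftrightarrow> (\<exists>k\<in>D N. n = hd xs \<^bold>+ k))"
      by (intro arith_rules)
  next
    fix m assume m: "m \<in> D N" and IH: "\<forall>n\<in>D N. m \<^bold>\<le> n \<longleftrightarrow> (\<exists>k\<in>D N. n = m \<^bold>+ k)"
    show "\<forall>n\<in>D N. succ \<bullet> m \<^bold>\<le> n \<longleftrightarrow> (\<exists>k\<in>D N. n = succ \<bullet> m \<^bold>+ k)"
    proof
      fix n assume "n \<in> D N"
      then show "succ \<bullet> m \<^bold>\<le> n \<longleftrightarrow> (\<exists>k\<in>D N. n = succ \<bullet> m \<^bold>+ k)"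
        by (cases rule: nat_cases) (use m IH in auto)
    qed
  qed auto
  then show ?thesis
    using assms by blast
qed

lemma add_right_cancel [simp]: "m \<in> D N \<Longrightarrow> n \<in> D N \<Longrightarrow> k \<in> D N \<Longrightarrow> m \<^bold>+ k = n \<^bold>+ k \<longleftrightarrow> m = n"
  by (rule IND[of "\<lambda>k. m \<^bold>+ k = n \<^bold>+ k \<longleftrightarrow> m = n"]) (intro arith_rules rep_const, auto)

lemma add_left_cancel [simp]: "m \<in> D N \<Longrightarrow> n \<in> D N \<Longrightarrow> k \<in> D N \<Longrightarrow> k \<^bold>+ m = k \<^bold>+ n \<longleftrightarrow> m = n"
  by (simp add: add_comm[of k])

lemma self_eq_add: "m \<in> D N \<Longrightarrow> k \<in> D N \<Longrightarrow> m = m \<^bold>+ k \<longleftrightarrow> k = zero"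
  using add_left_cancel[of zero k m] by auto

lemma add_eq_zero: "m \<in> D N \<Longrightarrow> k \<in> D N \<Longrightarrow> m \<^bold>+ k = zero \<longleftrightarrow> m = zero \<and> k = zero"
  by (cases m rule: nat_cases) auto

lemma le_add [simp]: "m \<in> D N \<Longrightarrow> n \<in> D N \<Longrightarrow> m \<^bold>\<le> m \<^bold>+ n" "m \<in> D N \<Longrightarrow> n \<in> D N \<Longrightarrow> n \<^bold>\<le> m \<^bold>+ n"
  by (auto simp: le_iff_add intro: add_comm)

lemma le_refl [simp]: "m \<in> D N \<Longrightarrow> m \<^bold>\<le> m"
  using le_add(1)[of m zero] by simp

lemma le_trans: "m \<^bold>\<le> n \<Longrightarrow> n \<^bold>\<le> k \<Longrightarrow> m \<in> D N \<Longrightarrow> n \<in> D N \<Longrightarrow> k \<in> D N \<Longrightarrow> m \<^bold>\<le> k"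
  by (auto simp: le_iff_add add_assoc)

lemma le_antisym: "m \<^bold>\<le> n \<Longrightarrow> n \<^bold>\<le> m \<Longrightarrow> m \<in> D N \<Longrightarrow> n \<in> D N \<Longrightarrow> m = n"
  by (auto simp: le_iff_add add_assoc self_eq_add add_eq_zero)

lemma not_le:
  assumes "m \<in> D N" "n \<in> D N"
  shows "\<not> m \<^bold>\<le> n \<longleftrightarrow> succ \<bullet> n \<^bold>\<le> m"
proof -
  have "\<forall>n\<in>D N. \<not> m \<^bold>\<le> n \<longleftrightarrow> succ \<bullet> n \<^bold>\<le> m"
  proof (rule IND[of "\<lambda>m. \<forall>n\<in>D N. \<not> m \<^bold>\<le> n \<longleftrightarrow> succ \<bullet> n \<^bold>\<le> m", OF _ _ _ assms(1)])
    show "dec [N] (\<lambda>xs. \<forall>n\<in>D N. \<not> hd xs \<^bold>\<le> n \<longleftrightarrow> succ \<bullet> n \<^bold>\<le> hd xs)"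
      by (intro arith_rules)
    fix m assume m: "m \<in> D N" and IH: "\<forall>n\<in>D N. \<not> m \<^bold>\<le> n \<longleftrightarrow> succ \<bullet> n \<^bold>\<le> m"
    show "\<forall>n\<in>D N. \<not> succ \<bullet> m \<^bold>\<le> n \<longleftrightarrow> succ \<bullet> n \<^bold>\<le> succ \<bullet> m"
    proof
      fix n assume "n \<in> D N"
      then show "\<not> succ \<bullet> m \<^bold>\<le> n \<longleftrightarrow> succ \<bullet> n \<^bold>\<le> succ \<bullet> m"
        by (cases rule: nat_cases) (use m IH in auto)
    qed
  qed auto
  then show ?thesis
    using assms by blast
qed

lemma le_succ: "m \<^bold>\<le> n \<Longrightarrow> m \<in> D N \<Longrightarrow> n \<in> D N \<Longrightarrow> m \<^bold>\<le> succ \<bullet> n"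
  using add_simps(2)[of m] by (auto simp: le_iff_add) (metis add_simps(2) succ_closed)

lemma le_linear: "m \<in> D N \<Longrightarrow> n \<in> D N \<Longrightarrow> m \<^bold>\<le> n \<or> n \<^bold>\<le> m"
  using not_le[of m n] le_succ[of "n" "n"] le_trans[of n "succ \<bullet> n" m] by auto

lemma add_le_cancel: "m \<in> D N \<Longrightarrow> n \<in> D N \<Longrightarrow> k \<in> D N \<Longrightarrow> m \<^bold>+ k \<^bold>\<le> n \<^bold>+ k \<longleftrightarrow> m \<^bold>\<le> n"
  by (rule IND[of "\<lambda>k. m \<^bold>+ k \<^bold>\<le> n \<^bold>+ k \<longleftrightarrow> m \<^bold>\<le> n"]) (intro arith_rules rep_const, auto)

lemma add_mono:
  assumes "k \<^bold>\<le> l" "m \<^bold>\<le> n" "k \<in> D N" "l \<in> D N" "m \<in> D N" "n \<in> D N"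
  shows "k \<^bold>+ m \<^bold>\<le> l \<^bold>+ n"
  using assms add_le_cancel[of k l m] add_le_cancel[of m n l] le_trans[of "k \<^bold>+ m" "l \<^bold>+ m" "l \<^bold>+ n"]
  by (simp add: add_comm)

lemma mul_mono:
  assumes "m \<^bold>\<le> n" "k \<in> D N" "m \<in> D N" "n \<in> D N"
  shows "m \<^bold>* k \<^bold>\<le> n \<^bold>* k" "k \<^bold>* m \<^bold>\<le> k \<^bold>* n"
  using assms by (auto simp: le_iff_add distrib_right distrib_left)

lemma mul_le_cancel:
  assumes "k \<^bold>* m \<^bold>\<le> k \<^bold>* n" "k \<noteq> zero" "k \<in> D N" "m \<in> D N" "n \<in> D N"
  shows "m \<^bold>\<le> n"
proof (rule ccontr)
  assume "\<not> m \<^bold>\<le> n"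
  then have "k \<^bold>* (succ \<bullet> n) \<^bold>\<le> k \<^bold>* m"
    using assms by (simp add: not_le mul_mono del: mul_simps(2))
  then have "k \<^bold>* (succ \<bullet> n) \<^bold>\<le> k \<^bold>* n"
    using assms le_trans[of "k \<^bold>* (succ \<bullet> n)" "k \<^bold>* m" "k \<^bold>* n"] by (simp del: mul_simps(2))
  then have "k \<^bold>+ k \<^bold>* n \<^bold>\<le> zero \<^bold>+ k \<^bold>* n"
    using assms by simp
  then show False
    using assms by (subst (asm) add_le_cancel) auto
qed

lemma sub_add: "n \<^bold>\<le> m \<Longrightarrow> m \<in> D N \<Longrightarrow> n \<in> D N \<Longrightarrow> n \<^bold>+ (m \<^bold>- n) = m"
proof -
  have *: "n \<^bold>+ k \<^bold>- n = k" if "n \<in> D N" "k \<in> D N" for n k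
    by (rule IND[of "\<lambda>n. n \<^bold>+ k \<^bold>- n = k", OF _ _ _ that(1)])
      (intro arith_rules rep_const, use that in \<open>auto simp del: sub_simps(2)\<close>)
  assume "n \<^bold>\<le> m" "m \<in> D N" "n \<in> D N"
  then show ?thesis
    by (auto simp: le_iff_add *)
qed

lemma le_absdiff:
  assumes "m \<in> D N" "n \<in> D N"
  shows "m \<^bold>\<le> n \<^bold>+ ((m \<^bold>- n) \<^bold>+ (n \<^bold>- m))"
proof (cases "n \<^bold>\<le> m")
  case True
  then show ?thesis
    using assms sub_add[OF True] le_add(1)[of m "n \<^bold>- m"] by (simp add: add_assoc[symmetric])
next
  case False
  then have "m \<^bold>\<le> n"
    using assms le_linear by blast
  then show ?thesis
    using assms le_trans[of m n] by simp
qed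

lemmas ring_simps = distrib_left distrib_right add_ac mul_ac

section \<open>Powers of two and four\<close>

lemma expt_simps [simp]:
  "n \<in> D N \<Longrightarrow> expt n \<in> D N" "expt zero = succ \<bullet> zero" "n \<in> D N \<Longrightarrow> expt (succ \<bullet> n) = expt n \<^bold>+ expt n"
proof -
  let ?two = "succ \<bullet> (succ \<bullet> zero)"
  let ?f = "recursor \<bullet> (combK ty1 N \<bullet> (recursor \<bullet> (combK ty1 N \<bullet> succ) \<bullet> ?two)) \<bullet> zero"
  have "recursor \<bullet> (combK ty1 N \<bullet> succ) \<bullet> ?two \<in> D ty1"
    using combK_in succ_in recursor_in zero_in ap_in by blast
  then have f: "?f \<in> D ty1"
    using combK_in recursor_in zero_in ap_in by blast
  then have kf: "combK ty1 N \<bullet> ?f \<in> D (N \<rightarrow> ty1)"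
    using combK_in ap_in by blast
  have e: "expt n = recursor \<bullet> (combK ty1 N \<bullet> ?f) \<bullet> (succ \<bullet> zero) \<bullet> n" for n
    by (simp add: expt_def)
  have "recursor \<bullet> (combK ty1 N \<bullet> ?f) \<bullet> (succ \<bullet> zero) \<in> D ty1"
    using kf recursor_in succ_closed zero_in ap_in by blast
  then show *: "n \<in> D N \<Longrightarrow> expt n \<in> D N" for n
    using e by simp
  show "expt zero = succ \<bullet> zero"
    unfolding e using kf by simp
  assume n: "n \<in> D N"
  have "expt (succ \<bullet> n) = combK ty1 N \<bullet> ?f \<bullet> n \<bullet> expt n"
    unfolding e using kf n by simp
  also have "\<dots> = ?two \<^bold>* expt n"
    using f n by (simp add: mul_def)
  finally show "expt (succ \<bullet> n) = expt n \<^bold>+ expt n"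
    using n * by simp
qed

lemma rep_expt: "rep \<Gamma> N F \<Longrightarrow> rep \<Gamma> N (\<lambda>xs. expt (F xs))"
proof -
  assume F: "rep \<Gamma> N F"
  let ?two = "succ \<bullet> (succ \<bullet> zero)"
  have "recursor \<bullet> (combK ty1 N \<bullet> succ) \<bullet> ?two \<in> D ty1"
    using combK_in succ_in recursor_in zero_in ap_in by blast
  then have "recursor \<bullet> (combK ty1 N \<bullet> (recursor \<bullet> (combK ty1 N \<bullet> succ) \<bullet> ?two)) \<bullet> zero \<in> D ty1"
    using combK_in recursor_in zero_in ap_in by blast
  then have "recursor \<bullet> (combK ty1 N \<bullet> (recursor \<bullet> (combK ty1 N \<bullet> (recursor \<bullet> (combK ty1 N \<bullet> succ)
     \<bullet> (succ \<bullet> (succ \<bullet> zero)))) \<bullet> zero)) \<bullet> (succ \<bullet> zero) \<in> D ty1"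
    using combK_in recursor_in zero_in succ_closed ap_in by blast
  then show ?thesis
    unfolding expt_def by (rule rep_ap[OF rep_const F])
qed

lemma expt_add: "m \<in> D N \<Longrightarrow> n \<in> D N \<Longrightarrow> expt (m \<^bold>+ n) = expt m \<^bold>* expt n"
  by (rule IND[of "\<lambda>n. expt (m \<^bold>+ n) = expt m \<^bold>* expt n"])
    (intro arith_rules rep_expt rep_const, auto simp: distrib_left)

lemma less_expt: "n \<in> D N \<Longrightarrow> succ \<bullet> n \<^bold>\<le> expt n"
proof (rule IND[of "\<lambda>n. succ \<bullet> n \<^bold>\<le> expt n"])
  fix n assume "n \<in> D N" "succ \<bullet> n \<^bold>\<le> expt n"
  then have "succ \<bullet> n \<^bold>+ succ \<bullet> n \<^bold>\<le> expt n \<^bold>+ expt n"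
    by (intro add_mono) auto
  moreover have "succ \<bullet> (succ \<bullet> n) \<^bold>\<le> succ \<bullet> n \<^bold>+ succ \<bullet> n"
    using \<open>n \<in> D N\<close> by simp
  ultimately show "succ \<bullet> (succ \<bullet> n) \<^bold>\<le> expt (succ \<bullet> n)"
    using \<open>n \<in> D N\<close> le_trans[of "succ \<bullet> (succ \<bullet> n)" "succ \<bullet> n \<^bold>+ succ \<bullet> n" "expt n \<^bold>+ expt n"]
    by simp
qed (intro arith_rules rep_expt, auto)

lemma le_expt: "n \<in> D N \<Longrightarrow> n \<^bold>\<le> expt n"
  using less_expt[of n] le_succ[of n n] le_trans[of n "succ \<bullet> n" "expt n"] by simp

lemma expt_nonzero [simp]: "n \<in> D N \<Longrightarrow> expt n \<noteq> zero"
  using less_expt[of n] by auto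

lemma one_le: "n \<in> D N \<Longrightarrow> n \<noteq> zero \<Longrightarrow> succ \<bullet> zero \<^bold>\<le> n"
  by (cases n rule: nat_cases) auto

text \<open>The coding uses a grid of width 4^(-n). Writing the power as a square makes it directly
  comparable with the rate 2^(-n) of convergence.\<close>

definition pow4 :: "'a \<Rightarrow> 'a" where
  "pow4 n = expt n \<^bold>* expt n"

lemma pow4_simps [simp]: "n \<in> D N \<Longrightarrow> pow4 n \<in> D N" "pow4 zero = succ \<bullet> zero"
  "n \<in> D N \<Longrightarrow> pow4 (succ \<bullet> n) = pow4 n \<^bold>+ pow4 n \<^bold>+ (pow4 n \<^bold>+ pow4 n)"
  by (simp_all add: pow4_def ring_simps)

lemma pow4_add: "m \<in> D N \<Longrightarrow> n \<in> D N \<Longrightarrow> pow4 (m \<^bold>+ n) = pow4 m \<^bold>* pow4 n"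
  by (simp add: pow4_def expt_add mul_ac)

lemma mul_eq_zero: "m \<in> D N \<Longrightarrow> n \<in> D N \<Longrightarrow> m \<^bold>* n = zero \<longleftrightarrow> m = zero \<or> n = zero"
  by (cases m rule: nat_cases) (auto simp: add_eq_zero)

lemma pow4_nonzero [simp]: "n \<in> D N \<Longrightarrow> pow4 n \<noteq> zero"
  by (simp add: pow4_def mul_eq_zero)

lemma expt_le_pow4: "n \<in> D N \<Longrightarrow> expt n \<^bold>\<le> pow4 n"
  using mul_mono(1)[of "succ \<bullet> zero" "expt n" "expt n"] one_le[of "expt n"] by (simp add: pow4_def)

lemma rep_pow4: "rep \<Gamma> N F \<Longrightarrow> rep \<Gamma> N (\<lambda>xs. pow4 (F xs))"
  unfolding pow4_def by (intro rep_mul rep_expt)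


section \<open>Coding sequences of natural numbers by real numbers\<close>

lemma rep_apN: "rep \<Gamma> (N \<rightarrow> \<tau>) F \<Longrightarrow> rep \<Gamma> N G \<Longrightarrow> rep \<Gamma> \<tau> (\<lambda>xs. F xs \<bullet> G xs)"
  by (rule rep_ap)

lemma rep_parts:
  assumes "rep \<Gamma> ty1 F" "rep \<Gamma> N G"
  shows "rep \<Gamma> N (\<lambda>xs. numer (F xs) (G xs))" "rep \<Gamma> N (\<lambda>xs. numer' (F xs) (G xs))"
    "rep \<Gamma> N (\<lambda>xs. den (F xs) (G xs))"
  unfolding numer_def numer'_def den_def by (intro rep_apN rep_succ rep_add assms)+

lemma parts_in [simp]:
  assumes "x \<in> D ty1" "n \<in> D N"
  shows "numer x n \<in> D N" "numer' x n \<in> D N" "den x n \<in> D N" "den x n \<noteq> zero"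
  unfolding numer_def numer'_def den_def using assms by simp_all

lemma rep_dist:
  assumes "rep \<Gamma> ty1 F" "rep \<Gamma> N G" "rep \<Gamma> ty1 F'" "rep \<Gamma> N G'"
  shows "rep \<Gamma> N (\<lambda>xs. dist (F xs) (G xs) (F' xs) (G' xs))"
  unfolding dist_def Let_def by (intro rep_add rep_sub rep_mul rep_parts assms)

text \<open>The \<open>n\<close>-th rational approximation of \<open>x\<close> is at least \<open>l / L\<close>.\<close>

definition approx_ge :: "'a \<Rightarrow> 'a \<Rightarrow> 'a \<Rightarrow> 'a \<Rightarrow> bool" where
  "approx_ge x n l L \<longleftrightarrow> l \<^bold>* den x n \<^bold>+ numer' x n \<^bold>* L \<^bold>\<le> numer x n \<^bold>* L"

text \<open>Entries with index \<open>n\<close> of equal reals differ by at most 2/2^n, and 4 L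
  \<le> 2^n makes this at most 1/(2 L). Hence the bound l/L for \<open>x\<close> becomes l/L - 1/(2
  L) = (2 l - 1)/(2 L) for \<open>y\<close>, and \<open>l'\<close> is 2 l - 1.\<close>

lemma approx_ge_transfer:
  assumes x: "x \<in> D ty1" "y \<in> D ty1" "n \<in> D N" "l \<in> D N" "L \<in> D N" "l' \<in> D N"
    and eq: "dist x n y n \<^bold>* expt n \<^bold>\<le> (succ \<bullet> (succ \<bullet> zero)) \<^bold>* (den x n \<^bold>* den y n)"
    and ge: "approx_ge x n l L" and n: "L \<^bold>+ L \<^bold>+ (L \<^bold>+ L) \<^bold>\<le> expt n" and l': "l \<^bold>+ l = succ \<bullet> l'"
  shows "approx_ge y n l' (L \<^bold>+ L)"
proof -
  define a b d a' b' d' T where abd: "a = numer x n" "b = numer' x n" "d = den x n"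
    "a' = numer y n" "b' = numer' y n" "d' = den y n" "T = expt n"
  have in_N [simp]: "a \<in> D N" "b \<in> D N" "d \<in> D N" "a' \<in> D N" "b' \<in> D N" "d' \<in> D N" "T \<in> D N"
    and nz: "d \<noteq> zero" "T \<noteq> zero"
    using x by (simp_all add: abd)
  note [simp] = \<open>l \<in> D N\<close> \<open>L \<in> D N\<close> \<open>l' \<in> D N\<close>
  define X Y where XY: "X = a \<^bold>* d' \<^bold>+ b' \<^bold>* d" "Y = a' \<^bold>* d \<^bold>+ b \<^bold>* d'"
  have [simp]: "X \<in> D N" "Y \<in> D N"
    by (simp_all add: XY)
  have dist: "dist x n y n = (X \<^bold>- Y) \<^bold>+ (Y \<^bold>- X)"
    by (simp add: dist_def Let_def abd XY)
  have "X \<^bold>* T \<^bold>\<le> (Y \<^bold>+ ((X \<^bold>- Y) \<^bold>+ (Y \<^bold>- X))) \<^bold>* T"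
    by (intro mul_mono le_absdiff) auto
  also have "\<dots> = Y \<^bold>* T \<^bold>+ dist x n y n \<^bold>* T"
    by (simp add: dist distrib_right)
  finally have "X \<^bold>* T \<^bold>\<le> Y \<^bold>* T \<^bold>+ dist x n y n \<^bold>* T" .
  moreover have "Y \<^bold>* T \<^bold>+ dist x n y n \<^bold>* T \<^bold>\<le> Y \<^bold>* T \<^bold>+ (d \<^bold>* d' \<^bold>+ d \<^bold>* d')"
    using eq by (intro add_mono) (simp_all add: abd(3,6,7)[symmetric] dist)
  ultimately have "X \<^bold>* T \<^bold>\<le> Y \<^bold>* T \<^bold>+ (d \<^bold>* d' \<^bold>+ d \<^bold>* d')"
    by (rule le_trans) (simp_all add: dist)
  then have 1: "X \<^bold>* T \<^bold>* L \<^bold>\<le> (Y \<^bold>* T \<^bold>+ (d \<^bold>* d' \<^bold>+ d \<^bold>* d')) \<^bold>* L"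
    by (intro mul_mono) auto
  have 2: "(l \<^bold>* d \<^bold>+ b \<^bold>* L) \<^bold>* (d' \<^bold>* T) \<^bold>\<le> a \<^bold>* L \<^bold>* (d' \<^bold>* T)"
    using ge by (intro mul_mono) (simp_all add: approx_ge_def abd[symmetric])
  have "(l \<^bold>* d \<^bold>+ b \<^bold>* L) \<^bold>* (d' \<^bold>* T) \<^bold>+ X \<^bold>* T \<^bold>* L \<^bold>\<le>
      a \<^bold>* L \<^bold>* (d' \<^bold>* T) \<^bold>+ (Y \<^bold>* T \<^bold>+ (d \<^bold>* d' \<^bold>+ d \<^bold>* d')) \<^bold>* L"
    using 1 2 by (intro add_mono) auto
  \<comment> \<open>After multiplying out, the contributions of \<open>a\<close> and
    \<open>b\<close> agree on both sides and cancel. What remains has the common factor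
    \<open>d\<close>, the denominator of \<open>x\<close>.\<close>
  then have "d \<^bold>* (l \<^bold>* (d' \<^bold>* T) \<^bold>+ b' \<^bold>* (T \<^bold>* L)) \<^bold>+ (a \<^bold>* (L \<^bold>* (d' \<^bold>* T)) \<^bold>+ b \<^bold>* (L \<^bold>* (d' \<^bold>* T))) \<^bold>\<le>
      d \<^bold>* (a' \<^bold>* (T \<^bold>* L) \<^bold>+ (d' \<^bold>* L \<^bold>+ d' \<^bold>* L)) \<^bold>+ (a \<^bold>* (L \<^bold>* (d' \<^bold>* T)) \<^bold>+ b \<^bold>* (L \<^bold>* (d' \<^bold>* T)))"
    by (simp add: XY ring_simps)
  then have "d \<^bold>* (l \<^bold>* (d' \<^bold>* T) \<^bold>+ b' \<^bold>* (T \<^bold>* L)) \<^bold>\<le> d \<^bold>* (a' \<^bold>* (T \<^bold>* L) \<^bold>+ (d' \<^bold>* L \<^bold>+ d' \<^bold>* L))"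
    by (subst (asm) add_le_cancel) auto
  then have "l \<^bold>* (d' \<^bold>* T) \<^bold>+ b' \<^bold>* (T \<^bold>* L) \<^bold>\<le> a' \<^bold>* (T \<^bold>* L) \<^bold>+ (d' \<^bold>* L \<^bold>+ d' \<^bold>* L)"
    by (rule mul_le_cancel) (use nz in simp_all)
  \<comment> \<open>Doubling creates \<open>l + l\<close>, which is one more than \<open>l'\<close>,
    and the error term d' (4 L), which is at most d' T. Cancelling one d' T uses up exactly this
    surplus.\<close>
  from add_mono[OF this this]
  have "(l \<^bold>+ l) \<^bold>* (d' \<^bold>* T) \<^bold>+ b' \<^bold>* (T \<^bold>* (L \<^bold>+ L)) \<^bold>\<le> a' \<^bold>* (T \<^bold>* (L \<^bold>+ L)) \<^bold>+ d' \<^bold>* (L \<^bold>+ L \<^bold>+ (L \<^bold>+ L))"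
    by (simp add: ring_simps)
  moreover have "a' \<^bold>* (T \<^bold>* (L \<^bold>+ L)) \<^bold>+ d' \<^bold>* (L \<^bold>+ L \<^bold>+ (L \<^bold>+ L)) \<^bold>\<le> a' \<^bold>* (T \<^bold>* (L \<^bold>+ L)) \<^bold>+ d' \<^bold>* T"
    using n unfolding abd(7)[symmetric] by (intro add_mono mul_mono) simp_all
  ultimately have "(l \<^bold>+ l) \<^bold>* (d' \<^bold>* T) \<^bold>+ b' \<^bold>* (T \<^bold>* (L \<^bold>+ L)) \<^bold>\<le> a' \<^bold>* (T \<^bold>* (L \<^bold>+ L)) \<^bold>+ d' \<^bold>* T"
    by (rule le_trans) simp_all
  then have "T \<^bold>* (l' \<^bold>* d' \<^bold>+ b' \<^bold>* (L \<^bold>+ L)) \<^bold>+ d' \<^bold>* T \<^bold>\<le> T \<^bold>* (a' \<^bold>* (L \<^bold>+ L)) \<^bold>+ d' \<^bold>* T"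
    by (simp add: l' ring_simps)
  then have "T \<^bold>* (l' \<^bold>* d' \<^bold>+ b' \<^bold>* (L \<^bold>+ L)) \<^bold>\<le> T \<^bold>* (a' \<^bold>* (L \<^bold>+ L))"
    by (subst (asm) add_le_cancel) auto
  then have "l' \<^bold>* d' \<^bold>+ b' \<^bold>* (L \<^bold>+ L) \<^bold>\<le> a' \<^bold>* (L \<^bold>+ L)"
    by (rule mul_le_cancel) (use nz in simp_all)
  then show ?thesis
    by (simp add: approx_ge_def abd)
qed

lemma LAM_cong: "(\<And>x. x \<in> D \<sigma> \<Longrightarrow> F x = G x) \<Longrightarrow> LAM \<sigma> \<tau> F = LAM \<sigma> \<tau> G"
  unfolding LAM_def by (rule arg_cong[where f = Eps]) auto

lemma CH_cong: "(\<And>n. n \<in> D N \<Longrightarrow> P n = Q n) \<Longrightarrow> CH P = CH Q"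
  unfolding CH_def char_fun_def by (simp cong: LAM_cong)

lemma eq_re_sym:
  assumes "x \<in> D ty1" "y \<in> D ty1" "eq_re x y"
  shows "eq_re y x"
proof -
  have "dist y n x n = dist x n y n" "den y n \<^bold>* den x n = den x n \<^bold>* den y n" if "n \<in> D N" for n
    using assms that by (simp_all add: dist_def Let_def add_comm mul_comm)
  then show ?thesis
    using assms by (simp add: eq_re_def)
qed

lemma eq_re_refl:
  assumes "x \<in> D ty1"
  shows "eq_re x x"
proof -
  have "k \<^bold>- k = zero" if "k \<in> D N" for k
    using le_refl[OF that] by (simp add: le_def)
  then show ?thesis
    using assms by (simp add: eq_re_def dist_def Let_def)
qed

text \<open>The \<open>2^j\<close>-fold refinement of the grid turns \<open>x > m / 4^k\<close> into an eventual property of the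
  approximations, whose invariance under equality of reals needs no limit argument.\<close>

definition cut :: "'a \<Rightarrow> 'a \<Rightarrow> 'a \<Rightarrow> bool" where
  "cut x m k \<longleftrightarrow> (\<exists>j\<in>D N. \<exists>n\<in>D N. \<forall>i\<in>D N.
    approx_ge x (n \<^bold>+ i) (succ \<bullet> (m \<^bold>* expt j)) (pow4 k \<^bold>* expt j))"

text \<open>The numerator m 2^j + 1 is designed for the transfer: 2 (m 2^j + 1) - 1 = m 2^(j+1) + 1,
  so passing to an equal real preserves the shape of the bound and merely raises \<open>j\<close> by
  one.\<close>

lemma cut_invariant:
  assumes x: "x \<in> D ty1" "y \<in> D ty1" "m \<in> D N" "k \<in> D N" and eq: "eq_re x y" and "cut x m k"
  shows "cut y m k"
proof -
  obtain j n where j: "j \<in> D N" "n \<in> D N" "\<And>i. i \<in> D N \<Longrightarrow>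
      approx_ge x (n \<^bold>+ i) (succ \<bullet> (m \<^bold>* expt j)) (pow4 k \<^bold>* expt j)"
    using \<open>cut x m k\<close> unfolding cut_def by blast
  let ?L = "pow4 k \<^bold>* expt j"
  \<comment> \<open>Starting later by 4 L makes all further indices at least 4 L; their powers of
    two are larger still, as the transfer requires.\<close>
  let ?n = "n \<^bold>+ (?L \<^bold>+ ?L \<^bold>+ (?L \<^bold>+ ?L))"
  have "approx_ge y (?n \<^bold>+ i) (succ \<bullet> (m \<^bold>* expt (succ \<bullet> j))) (pow4 k \<^bold>* expt (succ \<bullet> j))" if i: "i \<in> D N" for i
  proof -
    have L: "?L \<in> D N"
      using x j by simp
    have "approx_ge y (?n \<^bold>+ i) (succ \<bullet> (m \<^bold>* expt (succ \<bullet> j))) (?L \<^bold>+ ?L)"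
    proof (rule approx_ge_transfer)
      show "dist x (?n \<^bold>+ i) y (?n \<^bold>+ i) \<^bold>* expt (?n \<^bold>+ i) \<^bold>\<le>
          succ \<bullet> (succ \<bullet> zero) \<^bold>* (den x (?n \<^bold>+ i) \<^bold>* den y (?n \<^bold>+ i))"
        using eq L j i by (simp add: eq_re_def del: mul_simps succ_mul)
      show "approx_ge x (?n \<^bold>+ i) (succ \<bullet> (m \<^bold>* expt j)) ?L"
        using j(3)[of "?L \<^bold>+ ?L \<^bold>+ (?L \<^bold>+ ?L) \<^bold>+ i"] j i L by (simp add: add_assoc)
      have "?L \<^bold>+ ?L \<^bold>+ (?L \<^bold>+ ?L) \<^bold>\<le> ?n \<^bold>+ i"
        using j i L le_trans[of "?L \<^bold>+ ?L \<^bold>+ (?L \<^bold>+ ?L)" ?n "?n \<^bold>+ i"] by simp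
      then show "?L \<^bold>+ ?L \<^bold>+ (?L \<^bold>+ ?L) \<^bold>\<le> expt (?n \<^bold>+ i)"
        using j i L le_expt[of "?n \<^bold>+ i"] le_trans[of "?L \<^bold>+ ?L \<^bold>+ (?L \<^bold>+ ?L)" "?n \<^bold>+ i" "expt (?n \<^bold>+ i)"] by simp
    qed (use x j i L in \<open>simp_all add: distrib_left\<close>)
    then show ?thesis
      using x j by (simp add: distrib_left)
  qed
  moreover have "?n \<in> D N"
    using j x by simp
  ultimately show ?thesis
    unfolding cut_def using succ_closed[OF j(1)] by blast
qed

lemma dec_approx_ge:
  "rep \<Gamma> ty1 F \<Longrightarrow> rep \<Gamma> N G \<Longrightarrow> rep \<Gamma> N H \<Longrightarrow> rep \<Gamma> N K \<Longrightarrow>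
    dec \<Gamma> (\<lambda>xs. approx_ge (F xs) (G xs) (H xs) (K xs))"
  unfolding approx_ge_def by (intro dec_le rep_add rep_mul rep_parts)

lemma dec_cut:
  assumes "rep \<Gamma> ty1 F" "rep \<Gamma> N G" "rep \<Gamma> N H"
  shows "dec \<Gamma> (\<lambda>xs. cut (F xs) (G xs) (H xs))"
  unfolding cut_def
  by (intro dec_ex dec_all dec_approx_ge rep_add rep_mul rep_succ rep_expt rep_pow4 rep_vars
      assms[THEN rep_tl, THEN rep_tl, THEN rep_tl])

text \<open>For a real strictly between two grid points this is the integer part of 4^k x. If no
  such \<open>m\<close> exists the value is arbitrary, yet still determined by the cut.\<close>

definition prefix :: "'a \<Rightarrow> 'a \<Rightarrow> 'a" where
  "prefix x k = CH (\<lambda>m. cut x m k \<and> \<not> cut x (succ \<bullet> m) k)"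

lemma rep_prefix: "rep \<Gamma> ty1 F \<Longrightarrow> rep \<Gamma> N G \<Longrightarrow> rep \<Gamma> N (\<lambda>xs. prefix (F xs) (G xs))"
  unfolding prefix_def by (intro rep_CH dec_and dec_not dec_cut rep_tl rep_succ rep_vars)

text \<open>The pairs with sum \<open>s\<close> are mapped to numbers from s^2 to s^2 + s, before (s
  + 1)^2. Injectivity suffices for the coding, so no halving as in Cantor's pairing is
  involved.\<close>

definition pair :: "'a \<Rightarrow> 'a \<Rightarrow> 'a" where
  "pair k m = (k \<^bold>+ m) \<^bold>* (k \<^bold>+ m) \<^bold>+ k"

lemma rep_pair: "rep \<Gamma> N F \<Longrightarrow> rep \<Gamma> N G \<Longrightarrow> rep \<Gamma> N (\<lambda>xs. pair (F xs) (G xs))"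
  unfolding pair_def by (intro rep_add rep_mul)

lemma pair_in [simp]: "k \<in> D N \<Longrightarrow> m \<in> D N \<Longrightarrow> pair k m \<in> D N"
  by (simp add: pair_def)

lemma pair_less:
  assumes "succ \<bullet> (k \<^bold>+ m) \<^bold>\<le> k' \<^bold>+ m'" and [simp]: "k \<in> D N" "m \<in> D N" "k' \<in> D N" "m' \<in> D N"
  shows "pair k m \<noteq> pair k' m'"
proof
  assume eq: "pair k m = pair k' m'"
  let ?s = "k \<^bold>+ m" and ?s' = "k' \<^bold>+ m'"
  have "succ \<bullet> ?s \<^bold>* succ \<bullet> ?s \<^bold>\<le> succ \<bullet> ?s \<^bold>* ?s'"
    using assms(1) by (intro mul_mono) simp_all
  moreover have "succ \<bullet> ?s \<^bold>* ?s' \<^bold>\<le> ?s' \<^bold>* ?s'"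
    using assms(1) by (intro mul_mono) simp_all
  ultimately have "succ \<bullet> ?s \<^bold>* succ \<bullet> ?s \<^bold>\<le> ?s' \<^bold>* ?s'"
    by (rule le_trans) simp_all
  moreover have "?s' \<^bold>* ?s' \<^bold>\<le> pair k m"
    unfolding eq by (simp add: pair_def)
  ultimately have "succ \<bullet> ?s \<^bold>* succ \<bullet> ?s \<^bold>\<le> pair k m"
    by (rule le_trans) simp_all
  \<comment> \<open>With s = k + m, the increment 2 s + 1 of the square is (s + m + 1) + k, so (s +
    1)^2 exceeds \<open>pair k m\<close> by s + m + 1.\<close>
  moreover have "succ \<bullet> ?s \<^bold>* succ \<bullet> ?s = succ \<bullet> (?s \<^bold>+ m) \<^bold>+ pair k m"
    by (simp add: pair_def ring_simps)
  ultimately have "succ \<bullet> (?s \<^bold>+ m) \<^bold>+ pair k m \<^bold>\<le> zero \<^bold>+ pair k m"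
    by simp
  then show False
    by (subst (asm) add_le_cancel) simp_all
qed

lemma pair_inject:
  assumes "pair k m = pair k' m'" and [simp]: "k \<in> D N" "m \<in> D N" "k' \<in> D N" "m' \<in> D N"
  shows "k = k'" "m = m'"
proof -
  have "k' \<^bold>+ m' \<^bold>\<le> k \<^bold>+ m" "k \<^bold>+ m \<^bold>\<le> k' \<^bold>+ m'"
    using pair_less[of k m k' m'] pair_less[of k' m' k m] assms(1) not_le[of "k' \<^bold>+ m'" "k \<^bold>+ m"]
      not_le[of "k \<^bold>+ m" "k' \<^bold>+ m'"] by auto
  then have s: "k \<^bold>+ m = k' \<^bold>+ m'"
    by (intro le_antisym) simp_all
  with assms(1) show "k = k'"
    by (simp add: pair_def)
  with s show "m = m'"
    by simp
qed

text \<open>The graph of the coded function is read off the base 4 digits, which are 1 or 2: the \<open>k\<close>-th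
  value is \<open>m\<close> if and only if the digit at position \<open>pair k m\<close> is 2.\<close>

definition decode :: "'a \<Rightarrow> 'a" where
  "decode x = LAM N N (\<lambda>k. CH (\<lambda>m. prefix x (succ \<bullet> pair k m) =
    succ \<bullet> (succ \<bullet> (prefix x (pair k m) \<^bold>+ prefix x (pair k m) \<^bold>+ (prefix x (pair k m) \<^bold>+ prefix x (pair k m))))))"

lemma rep_decode: "rep \<Gamma> ty1 F \<Longrightarrow> rep \<Gamma> ty1 (\<lambda>xs. decode (F xs))"
  unfolding decode_def
  by (intro rep_LAM rep_CH dec_eq rep_prefix rep_succ rep_add rep_pair rep_vars; rule rep_tl, rule rep_tl)

lemma decode_in [simp]: "x \<in> D ty1 \<Longrightarrow> decode x \<in> D ty1"
  using rep_in[OF rep_decode[OF rep_const[of x ty1 "[]"]], of "[]"] by simp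

text \<open>Equal reals have the same cuts, and everything after that is computed from the cuts by
  \<open>CH\<close>. Equal predicates yield the same selected number, hence uniqueness of the digits
  plays no part and the invariance covers all reals, not only coded ones.\<close>

lemma decode_invariant:
  assumes "x \<in> Re" "y \<in> Re" "eq_re x y"
  shows "decode x = decode y"
proof -
  have *: "cut x m k = cut y m k" if "m \<in> D N" "k \<in> D N" for m k
    using assms that cut_invariant[of x y] cut_invariant[of y x] eq_re_sym[of x y] by (auto simp: Re_def)
  have prefix: "prefix x k = prefix y k" if "k \<in> D N" for k
    unfolding prefix_def by (rule CH_cong) (use * that in simp)
  show ?thesis
    unfolding decode_def by (intro LAM_cong CH_cong) (simp add: prefix)
qed

lemma le_trans': "n \<^bold>\<le> k \<Longrightarrow> m \<^bold>\<le> n \<Longrightarrow> m \<in> D N \<Longrightarrow> n \<in> D N \<Longrightarrow> k \<in> D N \<Longrightarrow> m \<^bold>\<le> k"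
  by (rule le_trans)

lemma neq_succ [simp]: "n \<in> D N \<Longrightarrow> n \<noteq> succ \<bullet> n"
  using not_le[of n n] by auto

lemma dec_is_re: 
  assumes "rep \<Gamma> ty1 F"
  shows "dec \<Gamma> (\<lambda>xs. is_re (F xs))"
  unfolding is_re_def
  by (intro dec_all dec_le rep_succ rep_mul rep_dist rep_add rep_expt rep_parts rep_vars
      assms[THEN rep_tl, THEN rep_tl])

lemma dec_In:
  assumes "rep \<Gamma> ty1 F" "X \<in> D ty2"
  shows "dec \<Gamma> (\<lambda>xs. F xs \<in> In X)"
proof -
  have "dec \<Gamma> (\<lambda>xs. is_re (F xs) \<and> X \<bullet> F xs = succ \<bullet> zero)"
    by (rule dec_and dec_is_re dec_eq rep_succ rep_zero rep_ap rep_const assms)+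
  then show ?thesis
    by (rule dec_cong[THEN iffD1, rotated]) (auto simp: In_def Re_def rep_in[OF assms(1)])
qed

lemma In_D: "x \<in> In X \<Longrightarrow> x \<in> D ty1" "x \<in> In X \<Longrightarrow> x \<in> Re" "x \<in> Re \<Longrightarrow> x \<in> D ty1"
  by (auto simp: In_def Re_def)

section \<open>Reals with prescribed base 4 digits\<close>

lemma triple_inject:
  assumes "n \<in> D N" "m \<in> D N" "n \<^bold>+ n \<^bold>+ n = m \<^bold>+ m \<^bold>+ m"
  shows "n = m"
proof -
  have "\<forall>m\<in>D N. n \<^bold>+ n \<^bold>+ n = m \<^bold>+ m \<^bold>+ m \<longrightarrow> n = m"
  proof (rule IND[of "\<lambda>n. \<forall>m\<in>D N. n \<^bold>+ n \<^bold>+ n = m \<^bold>+ m \<^bold>+ m \<longrightarrow> n = m", OF _ _ _ assms(1)])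
    show "dec [N] (\<lambda>xs. \<forall>m\<in>D N. hd xs \<^bold>+ hd xs \<^bold>+ hd xs = m \<^bold>+ m \<^bold>+ m \<longrightarrow> hd xs = m)"
      by (intro arith_rules)
    show "\<forall>m\<in>D N. zero \<^bold>+ zero \<^bold>+ zero = m \<^bold>+ m \<^bold>+ m \<longrightarrow> zero = m"
    proof
      fix m assume "m \<in> D N"
      then show "zero \<^bold>+ zero \<^bold>+ zero = m \<^bold>+ m \<^bold>+ m \<longrightarrow> zero = m"
        by (cases rule: nat_cases) auto
    qed
    fix n assume n: "n \<in> D N" "\<forall>m\<in>D N. n \<^bold>+ n \<^bold>+ n = m \<^bold>+ m \<^bold>+ m \<longrightarrow> n = m"
    show "\<forall>m\<in>D N. succ \<bullet> n \<^bold>+ succ \<bullet> n \<^bold>+ succ \<bullet> n = m \<^bold>+ m \<^bold>+ m \<longrightarrow> succ \<bullet> n = m"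
    proof
      fix m assume "m \<in> D N"
      then show "succ \<bullet> n \<^bold>+ succ \<bullet> n \<^bold>+ succ \<bullet> n = m \<^bold>+ m \<^bold>+ m \<longrightarrow> succ \<bullet> n = m"
        by (cases rule: nat_cases) (use n in auto)
    qed
  qed
  then show ?thesis
    using assms by blast
qed

text \<open>The three components of a rational entry sit at positions 0, 1 and 2 modulo 3. They can
  be prescribed separately because these positions never collide.\<close>

lemma triple_neq:
  assumes "n \<in> D N" "m \<in> D N"
  shows "n \<^bold>+ n \<^bold>+ n \<noteq> succ \<bullet> (m \<^bold>+ m \<^bold>+ m)" "n \<^bold>+ n \<^bold>+ n \<noteq> succ \<bullet> (succ \<bullet> (m \<^bold>+ m \<^bold>+ m))"
proof -
  let ?P = "\<lambda>n m. n \<^bold>+ n \<^bold>+ n \<noteq> succ \<bullet> (m \<^bold>+ m \<^bold>+ m) \<and> n \<^bold>+ n \<^bold>+ n \<noteq> succ \<bullet> (succ \<bullet> (m \<^bold>+ m \<^bold>+ m))"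
  have "\<forall>m\<in>D N. ?P n m"
  proof (rule IND[of "\<lambda>n. \<forall>m\<in>D N. ?P n m", OF _ _ _ assms(1)])
    show "dec [N] (\<lambda>xs. \<forall>m\<in>D N. ?P (hd xs) m)"
      by (intro arith_rules)
    fix n assume n: "n \<in> D N" "\<forall>m\<in>D N. ?P n m"
    show "\<forall>m\<in>D N. ?P (succ \<bullet> n) m"
    proof
      fix m assume "m \<in> D N"
      then show "?P (succ \<bullet> n) m"
        by (cases rule: nat_cases) (use n in auto)
    qed
  qed auto
  then show "n \<^bold>+ n \<^bold>+ n \<noteq> succ \<bullet> (m \<^bold>+ m \<^bold>+ m)" "n \<^bold>+ n \<^bold>+ n \<noteq> succ \<bullet> (succ \<bullet> (m \<^bold>+ m \<^bold>+ m))"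
    using assms by blast+
qed

lemma CH_unique:
  assumes "dec [N] (\<lambda>xs. P (hd xs))" "n \<in> D N" "P n" "\<And>m. m \<in> D N \<Longrightarrow> P m \<Longrightarrow> m = n"
  shows "CH P = n"
  using CH[OF assms(1)] assms by blast

text \<open>The number \<open>p n\<close> consists of the first \<open>n\<close> digits, and the
  real is the limit of p n / 4^n. Because no digit is zero, the real lies strictly above each p k /
  4^k; because no digit exceeds 2, it does not pass the next grid point. So the cuts recover
  \<open>p\<close> exactly.\<close>

lemma real_of_digits:
  assumes d: "d \<in> D ty1" "\<And>n. n \<in> D N \<Longrightarrow> d \<bullet> n = succ \<bullet> zero \<or> d \<bullet> n = succ \<bullet> (succ \<bullet> zero)"
  obtains x p where "x \<in> Re" "p \<in> D ty1"
    "\<And>n. n \<in> D N \<Longrightarrow> p \<bullet> (succ \<bullet> n) = d \<bullet> n \<^bold>+ (p \<bullet> n \<^bold>+ p \<bullet> n \<^bold>+ (p \<bullet> n \<^bold>+ p \<bullet> n))"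
    "\<And>m k. m \<in> D N \<Longrightarrow> k \<in> D N \<Longrightarrow> cut x m k \<longleftrightarrow> m \<^bold>\<le> p \<bullet> k"
proof -
  have "\<exists>g\<in>D (N \<rightarrow> N \<rightarrow> N). \<forall>n\<in>D N. \<forall>r\<in>D N. g \<bullet> n \<bullet> r = d \<bullet> n \<^bold>+ (r \<^bold>+ r \<^bold>+ (r \<^bold>+ r))"
    by (rule rep_fun2, intro rep_add rep_vars) (rule rep_ap rep_const d rep_vars)+
  then obtain g where g: "g \<in> D (N \<rightarrow> N \<rightarrow> N)"
    "\<And>n r. n \<in> D N \<Longrightarrow> r \<in> D N \<Longrightarrow> g \<bullet> n \<bullet> r = d \<bullet> n \<^bold>+ (r \<^bold>+ r \<^bold>+ (r \<^bold>+ r))" by blast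
  define p where "p = recursor \<bullet> g \<bullet> zero"
  have p: "p \<in> D ty1"
    unfolding p_def using recursor_in g zero_in ap_in by blast
  note [simp] = p d(1)
  have p0: "p \<bullet> zero = zero"
    using g by (simp add: p_def)
  have p_succ: "p \<bullet> (succ \<bullet> n) = d \<bullet> n \<^bold>+ (p \<bullet> n \<^bold>+ p \<bullet> n \<^bold>+ (p \<bullet> n \<^bold>+ p \<bullet> n))" if "n \<in> D N" for n
    using g that ap_in_simps(1)[OF p that] by (simp add: p_def)
  \<comment> \<open>The \<open>i\<close> digits after position \<open>n\<close> add less than 4^i.
    The upper bound is preserved since 4 r + d + 1 \<le> 4 (r + 1) for a digit d \<le> 3.\<close>
  have bounds: "p \<bullet> n \<^bold>* pow4 i \<^bold>\<le> p \<bullet> (n \<^bold>+ i) \<and> succ \<bullet> (p \<bullet> (n \<^bold>+ i)) \<^bold>\<le> succ \<bullet> (p \<bullet> n) \<^bold>* pow4 i"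
    if n: "n \<in> D N" and i: "i \<in> D N" for n i
  proof (rule IND[of "\<lambda>i. p \<bullet> n \<^bold>* pow4 i \<^bold>\<le> p \<bullet> (n \<^bold>+ i) \<and> succ \<bullet> (p \<bullet> (n \<^bold>+ i)) \<^bold>\<le> succ \<bullet> (p \<bullet> n) \<^bold>* pow4 i", OF _ _ _ i])
    show "dec [N] (\<lambda>xs. p \<bullet> n \<^bold>* pow4 (hd xs) \<^bold>\<le> p \<bullet> (n \<^bold>+ hd xs) \<and>
        succ \<bullet> (p \<bullet> (n \<^bold>+ hd xs)) \<^bold>\<le> succ \<bullet> (p \<bullet> n) \<^bold>* pow4 (hd xs))"
      by (intro dec_and dec_le rep_mul rep_succ rep_pow4 rep_add rep_vars)
        (rule rep_ap rep_const p n rep_add rep_vars)+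
    show "p \<bullet> n \<^bold>* pow4 zero \<^bold>\<le> p \<bullet> (n \<^bold>+ zero) \<and> succ \<bullet> (p \<bullet> (n \<^bold>+ zero)) \<^bold>\<le> succ \<bullet> (p \<bullet> n) \<^bold>* pow4 zero"
      using n by (simp del: succ_mul)
    fix i assume i: "i \<in> D N" and IH: "p \<bullet> n \<^bold>* pow4 i \<^bold>\<le> p \<bullet> (n \<^bold>+ i) \<and> succ \<bullet> (p \<bullet> (n \<^bold>+ i)) \<^bold>\<le> succ \<bullet> (p \<bullet> n) \<^bold>* pow4 i"
    let ?r = "p \<bullet> (n \<^bold>+ i)" and ?c = "p \<bullet> n \<^bold>* pow4 i" and ?e = "succ \<bullet> (p \<bullet> n) \<^bold>* pow4 i"
    have [simp]: "?r \<in> D N" "?c \<in> D N" "?e \<in> D N" "p \<bullet> n \<in> D N"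
      using n i by simp_all
    have "?c \<^bold>+ ?c \<^bold>+ (?c \<^bold>+ ?c) \<^bold>\<le> ?r \<^bold>+ ?r \<^bold>+ (?r \<^bold>+ ?r)"
      using IH by (intro add_mono) simp_all
    moreover have "?r \<^bold>+ ?r \<^bold>+ (?r \<^bold>+ ?r) \<^bold>\<le> d \<bullet> (n \<^bold>+ i) \<^bold>+ (?r \<^bold>+ ?r \<^bold>+ (?r \<^bold>+ ?r))"
      using n i by simp
    ultimately have 1: "?c \<^bold>+ ?c \<^bold>+ (?c \<^bold>+ ?c) \<^bold>\<le> d \<bullet> (n \<^bold>+ i) \<^bold>+ (?r \<^bold>+ ?r \<^bold>+ (?r \<^bold>+ ?r))"
      by (rule le_trans) (use n i in simp_all)
    let ?s = "succ \<bullet> ?r"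
    have "?s \<^bold>+ ?s \<^bold>+ (?s \<^bold>+ ?s) \<^bold>\<le> ?e \<^bold>+ ?e \<^bold>+ (?e \<^bold>+ ?e)"
      using IH by (intro add_mono) (simp_all del: succ_mul)
    moreover have "succ \<bullet> (d \<bullet> (n \<^bold>+ i) \<^bold>+ (?r \<^bold>+ ?r \<^bold>+ (?r \<^bold>+ ?r))) \<^bold>\<le> ?s \<^bold>+ ?s \<^bold>+ (?s \<^bold>+ ?s)"
      using d(2)[of "n \<^bold>+ i"] n i by (auto simp: le_succ)
    ultimately have 2: "succ \<bullet> (d \<bullet> (n \<^bold>+ i) \<^bold>+ (?r \<^bold>+ ?r \<^bold>+ (?r \<^bold>+ ?r))) \<^bold>\<le> ?e \<^bold>+ ?e \<^bold>+ (?e \<^bold>+ ?e)"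
      by (rule le_trans') (use n i in simp_all)
    show "p \<bullet> n \<^bold>* pow4 (succ \<bullet> i) \<^bold>\<le> p \<bullet> (n \<^bold>+ succ \<bullet> i) \<and>
        succ \<bullet> (p \<bullet> (n \<^bold>+ succ \<bullet> i)) \<^bold>\<le> succ \<bullet> (p \<bullet> n) \<^bold>* pow4 (succ \<bullet> i)"
      using 1 2 n i by (simp add: p_succ distrib_left del: succ_mul)
  qed
  \<comment> \<open>Entry \<open>n\<close> shall be p n / 4^n. Denominators are stored minus one,
    hence the predecessor of 4^n; the negative part is zero.\<close>
  have "\<exists>x\<in>D ty1. \<forall>j\<in>D N. x \<bullet> j = (if \<exists>n\<in>D N. j = n \<^bold>+ n \<^bold>+ n then p \<bullet> CH (\<lambda>n. j = n \<^bold>+ n \<^bold>+ n)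
      else if \<exists>n\<in>D N. j = succ \<bullet> (succ \<bullet> (n \<^bold>+ n \<^bold>+ n)) then pred (pow4 (CH (\<lambda>n. j = succ \<bullet> (succ \<bullet> (n \<^bold>+ n \<^bold>+ n)))))
      else zero)"
    by (rule rep_fun1, intro rep_if dec_ex dec_eq rep_add rep_vars rep_succ rep_pred rep_pow4 rep_CH rep_zero
        rep_ap[OF rep_const[OF p]])
  then obtain x where x: "x \<in> D ty1" "\<And>j. j \<in> D N \<Longrightarrow> x \<bullet> j =
      (if \<exists>n\<in>D N. j = n \<^bold>+ n \<^bold>+ n then p \<bullet> CH (\<lambda>n. j = n \<^bold>+ n \<^bold>+ n)
      else if \<exists>n\<in>D N. j = succ \<bullet> (succ \<bullet> (n \<^bold>+ n \<^bold>+ n)) then pred (pow4 (CH (\<lambda>n. j = succ \<bullet> (succ \<bullet> (n \<^bold>+ n \<^bold>+ n)))))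
      else zero)" by blast
  have numer: "numer x n = p \<bullet> n" if n: "n \<in> D N" for n
  proof -
    have "CH (\<lambda>m. n \<^bold>+ n \<^bold>+ n = m \<^bold>+ m \<^bold>+ m) = n"
    proof (rule CH_unique)
      show "dec [N] (\<lambda>xs. n \<^bold>+ n \<^bold>+ n = hd xs \<^bold>+ hd xs \<^bold>+ hd xs)"
        by (intro dec_eq rep_add rep_const rep_vars n add_simps)
    qed (use n triple_inject[of n] in simp_all)
    then show ?thesis
      unfolding numer_def using n by (subst x(2)) auto
  qed
  have numer': "numer' x n = zero" if "n \<in> D N" for n
  proof -
    have "\<not> (\<exists>m\<in>D N. succ \<bullet> (n \<^bold>+ n \<^bold>+ n) = m \<^bold>+ m \<^bold>+ m)"
      using triple_neq(1) that by metis
    moreover have "\<not> (\<exists>m\<in>D N. succ \<bullet> (n \<^bold>+ n \<^bold>+ n) = succ \<bullet> (succ \<bullet> (m \<^bold>+ m \<^bold>+ m)))"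
      using triple_neq(1) that by simp
    ultimately show ?thesis
      unfolding numer'_def using that by (subst x(2)) auto
  qed
  have den: "den x n = pow4 n" if n: "n \<in> D N" for n
  proof -
    have "CH (\<lambda>m. succ \<bullet> (succ \<bullet> (n \<^bold>+ n \<^bold>+ n)) = succ \<bullet> (succ \<bullet> (m \<^bold>+ m \<^bold>+ m))) = n"
    proof (rule CH_unique)
      show "dec [N] (\<lambda>xs. succ \<bullet> (succ \<bullet> (n \<^bold>+ n \<^bold>+ n)) = succ \<bullet> (succ \<bullet> (hd xs \<^bold>+ hd xs \<^bold>+ hd xs)))"
        by (intro dec_eq rep_succ rep_add rep_const rep_vars n)
    qed (use n triple_inject[of n] in simp_all)
    moreover have "\<not> (\<exists>m\<in>D N. succ \<bullet> (succ \<bullet> (n \<^bold>+ n \<^bold>+ n)) = m \<^bold>+ m \<^bold>+ m)"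
      using triple_neq(2) n by metis
    ultimately have "x \<bullet> (succ \<bullet> (succ \<bullet> (n \<^bold>+ n \<^bold>+ n))) = pred (pow4 n)"
      using n by (subst x(2)) auto
    moreover have "succ \<bullet> pred (pow4 n) = pow4 n"
      by (rule nat_cases[of "pow4 n"]) (use n pow4_nonzero[of n] in auto)
    ultimately show ?thesis
      by (simp add: den_def)
  qed
  have "is_re x"
    unfolding is_re_def
  proof (intro ballI)
    fix n i assume [simp]: "n \<in> D N" "i \<in> D N"
    \<comment> \<open>With \<open>Z\<close> the numerator of the distance of entries
      \<open>n\<close> and n + i, the upper bound gives 4^n + Z \<le> 4^(n+i). The distance Z / (4^n
      4^(n+i)) is thus strictly below 4^(-n), and so below 2^(-n).\<close>
    let ?X = "p \<bullet> n \<^bold>* pow4 (n \<^bold>+ i)" and ?Y = "p \<bullet> (n \<^bold>+ i) \<^bold>* pow4 n"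
    let ?q = "pow4 i \<^bold>* pow4 n"
    have XY: "?X \<^bold>\<le> ?Y"
      using mul_mono(1)[of "p \<bullet> n \<^bold>* pow4 i" "p \<bullet> (n \<^bold>+ i)" "pow4 n"] bounds[of n i] by (simp add: pow4_add mul_ac)
    define Z where "Z = ?Y \<^bold>- ?X"
    have [simp]: "Z \<in> D N"
      by (simp add: Z_def)
    have Y: "?X \<^bold>+ Z = ?Y"
      using sub_add[OF XY] by (simp add: Z_def)
    have "?X \<^bold>- ?Y = zero"
      using XY by (simp add: le_def)
    then have dist: "dist x n x (n \<^bold>+ i) = Z"
      by (simp add: dist_def Let_def numer numer' den Z_def)
    have "succ \<bullet> (p \<bullet> (n \<^bold>+ i)) \<^bold>* pow4 n \<^bold>\<le> succ \<bullet> (p \<bullet> n) \<^bold>* pow4 i \<^bold>* pow4 n"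
      using bounds[of n i] by (intro mul_mono) (simp_all del: succ_mul)
    moreover have "succ \<bullet> (p \<bullet> (n \<^bold>+ i)) \<^bold>* pow4 n = pow4 n \<^bold>+ Z \<^bold>+ ?X"
      by (simp add: Y[symmetric]) (simp add: add_ac)
    moreover have "succ \<bullet> (p \<bullet> n) \<^bold>* pow4 i \<^bold>* pow4 n = ?q \<^bold>+ ?X"
      by (simp add: pow4_add ring_simps)
    ultimately have "pow4 n \<^bold>+ Z \<^bold>+ ?X \<^bold>\<le> ?q \<^bold>+ ?X"
      by simp
    then have "pow4 n \<^bold>+ Z \<^bold>\<le> ?q"
      by (subst (asm) add_le_cancel) simp_all
    then have "(pow4 n \<^bold>+ Z) \<^bold>* expt n \<^bold>\<le> ?q \<^bold>* expt n"
      by (intro mul_mono) simp_all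
    moreover have "?q \<^bold>* expt n \<^bold>\<le> ?q \<^bold>* pow4 n"
      by (intro mul_mono expt_le_pow4) simp_all
    ultimately have "(pow4 n \<^bold>+ Z) \<^bold>* expt n \<^bold>\<le> ?q \<^bold>* pow4 n"
      by (rule le_trans) simp_all
    moreover have "succ \<bullet> (Z \<^bold>* expt n) \<^bold>\<le> (pow4 n \<^bold>+ Z) \<^bold>* expt n"
      using add_mono[of "succ \<bullet> zero" "pow4 n \<^bold>* expt n" "Z \<^bold>* expt n" "Z \<^bold>* expt n"]
        one_le[of "pow4 n \<^bold>* expt n"] by (simp add: distrib_right mul_eq_zero)
    ultimately have "succ \<bullet> (Z \<^bold>* expt n) \<^bold>\<le> ?q \<^bold>* pow4 n"
      by (rule le_trans') simp_all
    then show "succ \<bullet> (dist x n x (n \<^bold>+ i) \<^bold>* expt n) \<^bold>\<le> den x n \<^bold>* den x (n \<^bold>+ i)"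
      unfolding dist by (simp add: den pow4_add mul_ac)
  qed
  then have "x \<in> Re"
    using x by (simp add: Re_def)
  moreover have "cut x m k \<longleftrightarrow> m \<^bold>\<le> p \<bullet> k" if [simp]: "m \<in> D N" "k \<in> D N" for m k
  proof
    assume le: "m \<^bold>\<le> p \<bullet> k"
    \<comment> \<open>Refinement by 2^2 = 4 accounts for one further digit. That digit is at least
      1, so p (k + 1) \<ge> 4 (p k) + 1 \<ge> 4 m + 1, and the bound holds from entry k + 1
      on.\<close>
    let ?j = "succ \<bullet> (succ \<bullet> zero)"
    define c where "c = expt ?j"
    have [simp]: "c \<in> D N"
      by (simp add: c_def)
    have c: "y \<^bold>* c = y \<^bold>+ y \<^bold>+ (y \<^bold>+ y)" if "y \<in> D N" for y
      using that by (simp add: c_def add_assoc)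
    have "approx_ge x (succ \<bullet> k \<^bold>+ i) (succ \<bullet> (m \<^bold>* c)) (pow4 k \<^bold>* c)" if [simp]: "i \<in> D N" for i
    proof -
      have "m \<^bold>* c \<^bold>\<le> p \<bullet> k \<^bold>* c"
        using le by (intro mul_mono) simp_all
      then have "succ \<bullet> (m \<^bold>* c) \<^bold>\<le> succ \<bullet> (p \<bullet> k \<^bold>* c)"
        by simp
      moreover have "succ \<bullet> (p \<bullet> k \<^bold>* c) \<^bold>\<le> p \<bullet> (succ \<bullet> k)"
        using d(2)[of k] add_assoc[of "p \<bullet> k"] by (auto simp: p_succ c le_succ)
      ultimately have "succ \<bullet> (m \<^bold>* c) \<^bold>\<le> p \<bullet> (succ \<bullet> k)"
        by (rule le_trans) simp_all
      then have "succ \<bullet> (m \<^bold>* c) \<^bold>* pow4 i \<^bold>\<le> p \<bullet> (succ \<bullet> k) \<^bold>* pow4 i"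
        by (intro mul_mono) simp_all
      moreover have "p \<bullet> (succ \<bullet> k) \<^bold>* pow4 i \<^bold>\<le> p \<bullet> (succ \<bullet> k \<^bold>+ i)"
        using bounds[of "succ \<bullet> k" i] by simp
      ultimately have "succ \<bullet> (m \<^bold>* c) \<^bold>* pow4 i \<^bold>\<le> p \<bullet> (succ \<bullet> k \<^bold>+ i)"
        by (rule le_trans) simp_all
      then have "succ \<bullet> (m \<^bold>* c) \<^bold>* pow4 i \<^bold>* (pow4 k \<^bold>* c) \<^bold>\<le> p \<bullet> (succ \<bullet> k \<^bold>+ i) \<^bold>* (pow4 k \<^bold>* c)"
        by (intro mul_mono) simp_all
      moreover have "pow4 (succ \<bullet> k \<^bold>+ i) = pow4 i \<^bold>* (pow4 k \<^bold>* c)"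
        unfolding pow4_add[OF succ_closed[OF \<open>k \<in> D N\<close>] \<open>i \<in> D N\<close>] by (simp add: mul_assoc[symmetric] c) (simp add: ring_simps)
      ultimately show ?thesis
        unfolding approx_ge_def by (simp add: numer numer' den mul_assoc del: succ_add succ_mul)
    qed
    then have "\<forall>i\<in>D N. approx_ge x (succ \<bullet> k \<^bold>+ i) (succ \<bullet> (m \<^bold>* expt ?j)) (pow4 k \<^bold>* expt ?j)"
      unfolding c_def by blast
    then show "cut x m k"
      unfolding cut_def by (intro bexI[of _ ?j] bexI[of _ "succ \<bullet> k"]) auto
  next
    assume "cut x m k"
    then obtain j n where [simp]: "j \<in> D N" "n \<in> D N" and ge: "\<And>i. i \<in> D N \<Longrightarrow>
        approx_ge x (n \<^bold>+ i) (succ \<bullet> (m \<^bold>* expt j)) (pow4 k \<^bold>* expt j)"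
      unfolding cut_def by blast
    let ?L = "pow4 k \<^bold>* expt j"
    show "m \<^bold>\<le> p \<bullet> k"
    proof (rule ccontr)
      \<comment> \<open>At entry n + k both facts apply. The cut gives a value of at least (m +
        2^(-j)) / 4^k, but \<open>bounds\<close> allows at most (p k + 1) / 4^k, which is at most m
        / 4^k.\<close>
      assume "\<not> m \<^bold>\<le> p \<bullet> k"
      then have "succ \<bullet> (p \<bullet> k) \<^bold>\<le> m"
        by (simp add: not_le)
      then have "succ \<bullet> (p \<bullet> k) \<^bold>* expt j \<^bold>\<le> m \<^bold>* expt j"
        by (intro mul_mono) simp_all
      then have "succ \<bullet> (succ \<bullet> (p \<bullet> k) \<^bold>* expt j) \<^bold>* pow4 (n \<^bold>+ k) \<^bold>\<le> succ \<bullet> (m \<^bold>* expt j) \<^bold>* pow4 (n \<^bold>+ k)"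
        by (intro mul_mono) (simp_all del: succ_mul)
      moreover have "succ \<bullet> (m \<^bold>* expt j) \<^bold>* pow4 (n \<^bold>+ k) \<^bold>\<le> p \<bullet> (n \<^bold>+ k) \<^bold>* ?L"
        using ge[of k] by (simp add: approx_ge_def numer numer' den)
      ultimately have 1: "succ \<bullet> (succ \<bullet> (p \<bullet> k) \<^bold>* expt j) \<^bold>* pow4 (n \<^bold>+ k) \<^bold>\<le> p \<bullet> (n \<^bold>+ k) \<^bold>* ?L"
        by (rule le_trans) simp_all
      have "p \<bullet> (n \<^bold>+ k) \<^bold>\<le> succ \<bullet> (p \<bullet> k) \<^bold>* pow4 n"
        using bounds[of k n] le_succ[of "p \<bullet> (n \<^bold>+ k)" "p \<bullet> (n \<^bold>+ k)"]
          le_trans[of "p \<bullet> (n \<^bold>+ k)" "succ \<bullet> (p \<bullet> (n \<^bold>+ k))" "succ \<bullet> (p \<bullet> k) \<^bold>* pow4 n"]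
        by (simp add: add_comm[of k n] del: succ_mul)
      then have "p \<bullet> (n \<^bold>+ k) \<^bold>* ?L \<^bold>\<le> succ \<bullet> (p \<bullet> k) \<^bold>* pow4 n \<^bold>* ?L"
        by (intro mul_mono) simp_all
      with 1 have "succ \<bullet> (succ \<bullet> (p \<bullet> k) \<^bold>* expt j) \<^bold>* pow4 (n \<^bold>+ k) \<^bold>\<le> succ \<bullet> (p \<bullet> k) \<^bold>* pow4 n \<^bold>* ?L"
        by (rule le_trans) simp_all
      then have "pow4 (n \<^bold>+ k) \<^bold>+ succ \<bullet> (p \<bullet> k) \<^bold>* expt j \<^bold>* pow4 (n \<^bold>+ k) \<^bold>\<le>
          zero \<^bold>+ succ \<bullet> (p \<bullet> k) \<^bold>* expt j \<^bold>* pow4 (n \<^bold>+ k)"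
        by (simp add: pow4_add ring_simps)
      then show False
        by (subst (asm) add_le_cancel) simp_all
    qed
  qed
  ultimately show ?thesis
    using that[of x p] p p_succ by blast
qed

lemma decode_surjective:
  assumes f: "f \<in> D ty1"
  obtains x where "x \<in> Re" "decode x = f"
proof -
  \<comment> \<open>Digit 2 marks the pairs on the graph of \<open>f\<close>; all other positions
    carry 1 rather than 0, as \<open>real_of_digits\<close> demands.\<close>
  have "\<exists>d\<in>D ty1. \<forall>n\<in>D N. d \<bullet> n = (if \<exists>k\<in>D N. n = pair k (f \<bullet> k) then succ \<bullet> (succ \<bullet> zero) else succ \<bullet> zero)"
    by (rule rep_fun1, intro rep_if dec_ex dec_eq rep_pair rep_succ rep_zero rep_vars rep_ap[OF rep_const[OF f]])
  then obtain d where d: "d \<in> D ty1" "\<And>n. n \<in> D N \<Longrightarrow>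
      d \<bullet> n = (if \<exists>k\<in>D N. n = pair k (f \<bullet> k) then succ \<bullet> (succ \<bullet> zero) else succ \<bullet> zero)" by blast
  obtain x p where x: "x \<in> Re" "p \<in> D ty1"
    "\<And>n. n \<in> D N \<Longrightarrow> p \<bullet> (succ \<bullet> n) = d \<bullet> n \<^bold>+ (p \<bullet> n \<^bold>+ p \<bullet> n \<^bold>+ (p \<bullet> n \<^bold>+ p \<bullet> n))"
    "\<And>m k. m \<in> D N \<Longrightarrow> k \<in> D N \<Longrightarrow> cut x m k \<longleftrightarrow> m \<^bold>\<le> p \<bullet> k"
    by (rule real_of_digits[of d]) (use d in auto)
  have xD: "x \<in> D ty1"
    using x by (simp add: Re_def)
  note [simp] = f d(1) x(2) xD
  \<comment> \<open>The cut at level \<open>k\<close> consists of the numbers up to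
    \<open>p k\<close>, so the only place where it stops is \<open>p k\<close> itself.\<close>
  have prefix: "prefix x k = p \<bullet> k" if k: "k \<in> D N" for k
    unfolding prefix_def
  proof (rule CH_unique)
    show "dec [N] (\<lambda>xs. cut x (hd xs) k \<and> \<not> cut x (succ \<bullet> hd xs) k)"
      by (intro dec_and dec_not dec_cut rep_succ rep_vars rep_const) (use k in simp_all)
    have "\<not> succ \<bullet> (p \<bullet> k) \<^bold>\<le> p \<bullet> k"
      using k not_le[of "p \<bullet> k" "p \<bullet> k"] by simp
    then show "cut x (p \<bullet> k) k \<and> \<not> cut x (succ \<bullet> (p \<bullet> k)) k"
      using k by (simp add: x(4))
    fix m assume "m \<in> D N" "cut x m k \<and> \<not> cut x (succ \<bullet> m) k"
    then show "m = p \<bullet> k"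
      using k not_le[of "p \<bullet> k" m] by (intro le_antisym) (simp_all add: x(4))
  qed (use k in simp)
  have "decode x = f"
    unfolding decode_def
  proof (rule LAM_eqI)
    fix k assume k: "k \<in> D N"
    have eq: "prefix x (succ \<bullet> pair k m) = succ \<bullet> (succ \<bullet> (prefix x (pair k m) \<^bold>+ prefix x (pair k m) \<^bold>+
        (prefix x (pair k m) \<^bold>+ prefix x (pair k m)))) \<longleftrightarrow> m = f \<bullet> k" if m: "m \<in> D N" for m
    proof -
      have "(\<exists>k'\<in>D N. pair k m = pair k' (f \<bullet> k')) \<longleftrightarrow> m = f \<bullet> k"
        using pair_inject[of k m] k m f by (metis ap_in_simps(1))
      then have "d \<bullet> pair k m = (if m = f \<bullet> k then succ \<bullet> (succ \<bullet> zero) else succ \<bullet> zero)"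
        using d(2)[of "pair k m"] k m by simp
      then show ?thesis
        using k m by (simp add: prefix x(3))
    qed
    show "f \<bullet> k = CH (\<lambda>m. prefix x (succ \<bullet> pair k m) = succ \<bullet> (succ \<bullet> (prefix x (pair k m) \<^bold>+ prefix x (pair k m) \<^bold>+
        (prefix x (pair k m) \<^bold>+ prefix x (pair k m)))))"
    proof (rule CH_unique[symmetric])
      show "dec [N] (\<lambda>xs. prefix x (succ \<bullet> pair k (hd xs)) = succ \<bullet> (succ \<bullet> (prefix x (pair k (hd xs)) \<^bold>+
          prefix x (pair k (hd xs)) \<^bold>+ (prefix x (pair k (hd xs)) \<^bold>+ prefix x (pair k (hd xs))))))"
        by (intro dec_eq rep_prefix rep_succ rep_add rep_pair rep_vars rep_const) (use k in simp_all)
    qed (use k eq in auto)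
  qed fact
  then show ?thesis
    using x that by blast
qed

section \<open>The order by codes, and the way from comparability to BOOT\<close>

definition code :: "'a \<Rightarrow> 'a" where
  "code x = decode x \<bullet> zero"

lemma code_in [simp]: "x \<in> D ty1 \<Longrightarrow> code x \<in> D N"
  by (simp add: code_def)

lemma rep_code: "rep \<Gamma> ty1 F \<Longrightarrow> rep \<Gamma> N (\<lambda>xs. code (F xs))"
  unfolding code_def by (intro rep_apN rep_decode rep_zero)

lemma code_invariant: "x \<in> Re \<Longrightarrow> y \<in> Re \<Longrightarrow> eq_re x y \<Longrightarrow> code x = code y"
  by (simp add: code_def decode_invariant)

lemma code_surjective:
  assumes "n \<in> D N"
  shows "\<exists>x\<in>Re. code x = n"
proof -
  have "combK N N \<bullet> n \<in> D ty1"
    using assms combK_in ap_in by blast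
  then obtain x where "x \<in> Re" "decode x = combK N N \<bullet> n"
    using decode_surjective by blast
  then show ?thesis
    using assms by (intro bexI[of _ x]) (simp_all add: code_def)
qed

definition code_order :: "'a \<Rightarrow> bool" where
  "code_order R \<longleftrightarrow> R \<in> D (ty1 \<rightarrow> ty1 \<rightarrow> N) \<and>
    (\<forall>x\<in>D ty1. \<forall>y\<in>D ty1. R \<bullet> x \<bullet> y = (if code x \<^bold>\<le> code y then succ \<bullet> zero else zero))"

lemma code_order_exists: "\<exists>R. code_order R"
proof -
  have "rep [ty1, ty1] N (\<lambda>xs. if code (hd xs) \<^bold>\<le> code (hd (tl xs)) then succ \<bullet> zero else zero)"
    by (intro rep_if dec_le rep_code rep_vars rep_succ rep_zero)
  from rep_fun2[OF this] show ?thesis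
    unfolding code_order_def by blast
qed

lemma Rel_code_order: "code_order R \<Longrightarrow> x \<in> D ty1 \<Longrightarrow> y \<in> D ty1 \<Longrightarrow> Rel R x y \<longleftrightarrow> code x \<^bold>\<le> code y"
  by (simp add: code_order_def Rel_def)

text \<open>A strictly descending sequence \<open>g\<close> of numbers would satisfy \<open>g n + n \<le> g 0\<close> for all \<open>n\<close>.\<close>

lemma Cwo_code_order:
  assumes X: "X \<in> D ty2" "real_invariant X" "\<And>x. x \<in> Re \<Longrightarrow> X \<bullet> x = zero \<or> X \<bullet> x = succ \<bullet> zero"
    and R: "code_order R"
  shows "Cwo X R"
proof -
  note R_eq = Rel_code_order[OF R]
  have "Linear X R"
    unfolding Linear_def
  proof (intro conjI ballI impI)
    fix x x' y y' assume "x \<in> Re" "x' \<in> Re" "y \<in> Re" "y' \<in> Re" "eq_re x x' \<and> eq_re y y'"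
    then have "code x = code x'" "code y = code y'"
      by (auto intro: code_invariant)
    then show "R \<bullet> x \<bullet> y = R \<bullet> x' \<bullet> y'"
      using R \<open>x \<in> Re\<close> \<open>x' \<in> Re\<close> \<open>y \<in> Re\<close> \<open>y' \<in> Re\<close> by (simp add: code_order_def In_D)
  next
    fix x y z assume "x \<in> D ty1" "y \<in> D ty1" "z \<in> D ty1" "Rel R x y \<and> Rel R y z"
    then show "Rel R x z"
      using le_trans[of "code x" "code y" "code z"] by (simp add: R_eq)
  next
    fix x y assume "x \<in> D ty1" "y \<in> D ty1"
    then show "Rel R x y \<or> Rel R y x"
      using le_linear[of "code x" "code y"] by (simp add: R_eq)
  qed (use X R in \<open>auto simp: code_order_def In_D\<close>)
  moreover have "\<not> (\<exists>s\<in>D (N \<rightarrow> ty1). \<forall>n\<in>D N. s \<bullet> n \<in> In X \<and>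
         (Rel R (s \<bullet> (succ \<bullet> n)) (s \<bullet> n) \<and> \<not> (Rel R (s \<bullet> (succ \<bullet> n)) (s \<bullet> n) \<and> Rel R (s \<bullet> n) (s \<bullet> (succ \<bullet> n)))))"
  proof clarify
    fix s assume s: "s \<in> D (N \<rightarrow> ty1)" and desc: "\<forall>n\<in>D N. s \<bullet> n \<in> In X \<and>
         (Rel R (s \<bullet> (succ \<bullet> n)) (s \<bullet> n) \<and> \<not> (Rel R (s \<bullet> (succ \<bullet> n)) (s \<bullet> n) \<and> Rel R (s \<bullet> n) (s \<bullet> (succ \<bullet> n))))"
    have less: "succ \<bullet> code (s \<bullet> (succ \<bullet> n)) \<^bold>\<le> code (s \<bullet> n)" if "n \<in> D N" for n
    proof -
      have "\<not> Rel R (s \<bullet> n) (s \<bullet> (succ \<bullet> n))"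
        using desc that by blast
      then show ?thesis
        using that s by (simp add: R_eq not_le)
    qed
    let ?c = "code (s \<bullet> zero)"
    have c: "succ \<bullet> ?c \<in> D N"
      using s by simp
    have "code (s \<bullet> (succ \<bullet> ?c)) \<^bold>+ succ \<bullet> ?c \<^bold>\<le> ?c"
    proof (rule IND[of "\<lambda>n. code (s \<bullet> n) \<^bold>+ n \<^bold>\<le> ?c", OF _ _ _ c])
      show "dec [N] (\<lambda>xs. code (s \<bullet> hd xs) \<^bold>+ hd xs \<^bold>\<le> ?c)"
        by (intro dec_le rep_add rep_code rep_ap[OF rep_const[OF s]] rep_vars rep_const) (use s in simp)
      show "code (s \<bullet> zero) \<^bold>+ zero \<^bold>\<le> ?c"
        using s by simp
      fix n assume n: "n \<in> D N" "code (s \<bullet> n) \<^bold>+ n \<^bold>\<le> ?c"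
      have "succ \<bullet> code (s \<bullet> (succ \<bullet> n)) \<^bold>+ n \<^bold>\<le> code (s \<bullet> n) \<^bold>+ n"
        using less[OF n(1)] n(1) s by (intro add_mono) simp_all
      then have "succ \<bullet> code (s \<bullet> (succ \<bullet> n)) \<^bold>+ n \<^bold>\<le> ?c"
        using n(2) by (rule le_trans) (use s n in simp_all)
      then show "code (s \<bullet> (succ \<bullet> n)) \<^bold>+ succ \<bullet> n \<^bold>\<le> ?c"
        using n s by simp
    qed
    moreover have "succ \<bullet> ?c \<^bold>\<le> code (s \<bullet> (succ \<bullet> ?c)) \<^bold>+ succ \<bullet> ?c"
      using s c by (intro le_add) simp_all
    ultimately have "succ \<bullet> ?c \<^bold>\<le> ?c"
      by (rule le_trans') (use s c in simp_all)
    then show False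
      using s not_le[of ?c ?c] by simp
  qed
  moreover have "\<exists>Y\<in>D ty2. \<forall>x\<in>D ty1. Y \<bullet> x = code x"
    by (rule rep_fun1, intro rep_code rep_vars)
  then have "\<exists>Y\<in>D ty2. real_invariant Y \<and>
      (\<forall>x\<in>D ty1. \<forall>y\<in>D ty1. x \<in> In X \<and> y \<in> In X \<longrightarrow> Y \<bullet> x = Y \<bullet> y \<longrightarrow> Rel R x y \<and> Rel R y x)"
    by (elim bexE, intro bexI) (auto simp: real_invariant_def In_D code_invariant R_eq)
  ultimately show ?thesis
    unfolding Cwo_def by blast
qed

definition boot :: "'a \<Rightarrow> 'a \<Rightarrow> bool" where
  "boot Y X \<longleftrightarrow> X \<in> D ty1 \<and> (\<forall>n\<in>D N. (X \<bullet> n = zero \<or> X \<bullet> n = succ \<bullet> zero) \<and>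
    (X \<bullet> n = succ \<bullet> zero \<longleftrightarrow> (\<exists>f\<in>D ty1. Y \<bullet> f \<bullet> n = zero)))"

text \<open>An enumeration that meets every code occurring in \<open>A\<close> replaces the
  quantifier over functions by one over the indices in the decidable set \<open>I\<close>. The
  latter is decided by \<exists>^2.\<close>

lemma boot_of_enumeration:
  assumes s: "s \<in> D (N \<rightarrow> ty1)" and I: "dec [N] (\<lambda>xs. I (hd xs))"
    and A: "\<And>n. n \<in> D N \<Longrightarrow> (\<exists>f\<in>D ty1. Y \<bullet> f \<bullet> n = zero) \<longleftrightarrow> (\<exists>x\<in>A. code x = n)"
    and sA: "\<And>k. k \<in> D N \<Longrightarrow> I k \<Longrightarrow> s \<bullet> k \<in> A"
    and As: "\<And>x. x \<in> A \<Longrightarrow> \<exists>k\<in>D N. I k \<and> code (s \<bullet> k) = code x"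
  shows "\<exists>X. boot Y X"
proof -
  have "rep [N] N (\<lambda>xs. if \<exists>k\<in>D N. I k \<and> code (s \<bullet> k) = hd xs then succ \<bullet> zero else zero)"
    by (intro rep_if dec_ex dec_and dec_compose[OF I] dec_eq rep_code rep_ap[OF rep_const[OF s]] rep_vars rep_succ rep_zero)
  from rep_fun1[OF this] obtain X where X: "X \<in> D ty1"
    "\<And>n. n \<in> D N \<Longrightarrow> X \<bullet> n = (if \<exists>k\<in>D N. I k \<and> code (s \<bullet> k) = n then succ \<bullet> zero else zero)"
    by blast
  have "(\<exists>k\<in>D N. I k \<and> code (s \<bullet> k) = n) \<longleftrightarrow> (\<exists>f\<in>D ty1. Y \<bullet> f \<bullet> n = zero)" if "n \<in> D N" for n
    using A[OF that] sA As by metis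
  then show ?thesis
    using X by (intro exI[of _ X]) (auto simp: boot_def)
qed

lemma IsoD:
  assumes "Iso P R Q S" "P \<subseteq> D ty1" "Q \<subseteq> D ty1"
  shows "\<exists>Z\<in>D (ty1 \<rightarrow> ty1). (\<forall>x\<in>P. Z \<bullet> x \<in> Q) \<and> (\<forall>w\<in>Q. \<exists>x\<in>P. Rel S (Z \<bullet> x) w \<and> Rel S w (Z \<bullet> x)) \<and>
    (\<forall>x\<in>P. \<forall>x'\<in>P. Rel R x x' \<longleftrightarrow> Rel S (Z \<bullet> x) (Z \<bullet> x'))"
proof -
  from assms(1) obtain Z where Z: "Z \<in> D (ty1 \<rightarrow> ty1)" "\<forall>x\<in>D ty1. x \<in> P \<longrightarrow> Z \<bullet> x \<in> Q"
     "\<forall>w\<in>D ty1. w \<in> Q \<longrightarrow> (\<exists>x\<in>D ty1. x \<in> P \<and> Rel S (Z \<bullet> x) w \<and> Rel S w (Z \<bullet> x))"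
     "\<forall>x\<in>D ty1. \<forall>x'\<in>D ty1. x \<in> P \<and> x' \<in> P \<longrightarrow> (Rel R x x' \<longleftrightarrow> Rel S (Z \<bullet> x) (Z \<bullet> x'))"
    unfolding Iso_def by (elim bexE conjE)
  show ?thesis
  proof (intro bexI[of _ Z] conjI)
    show "\<forall>x\<in>P. Z \<bullet> x \<in> Q"
      using Z(2) assms(2) by blast
    show "\<forall>w\<in>Q. \<exists>x\<in>P. Rel S (Z \<bullet> x) w \<and> Rel S w (Z \<bullet> x)"
      using Z(3) assms(3) by blast
    show "\<forall>x\<in>P. \<forall>x'\<in>P. Rel R x x' \<longleftrightarrow> Rel S (Z \<bullet> x) (Z \<bullet> x')"
      using Z(4) assms(2) by blast
  qed (rule Z)
qed

lemma comparability_imp_boot: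
  assumes comp: "\<forall>A\<in>D ty2. \<forall>R\<in>D (ty1 \<rightarrow> ty1 \<rightarrow> N). \<forall>B\<in>D ty2. \<forall>S\<in>D (ty1 \<rightarrow> ty1 \<rightarrow> N).
      Cwo A R \<and> Cwo B S \<longrightarrow> Embeds A R B S \<or> Embeds B S A R"
    and Y: "Y \<in> D (ty1 \<rightarrow> N \<rightarrow> N)"
  shows "\<exists>X. boot Y X"
proof -
  obtain R where R: "code_order R"
    using code_order_exists by blast
  note R_eq = Rel_code_order[OF R]
  \<comment> \<open>A real codes the pair of the number \<open>code x\<close>, its decoded value at
    zero, and this tail of the decoded function.\<close>
  let ?f = "\<lambda>x. LAM N N (\<lambda>k. decode x \<bullet> (succ \<bullet> k))"
  have "\<exists>A\<in>D ty2. \<forall>x\<in>D ty1. A \<bullet> x = (if Y \<bullet> ?f x \<bullet> code x = zero then succ \<bullet> zero else zero)"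
    by (rule rep_fun1)
      (rule rep_if dec_eq rep_code rep_decode rep_LAM rep_succ rep_zero rep_ap rep_const Y rep_vars)+
  then obtain A where A: "A \<in> D ty2"
    "\<And>x. x \<in> D ty1 \<Longrightarrow> A \<bullet> x = (if Y \<bullet> ?f x \<bullet> code x = zero then succ \<bullet> zero else zero)" by blast
  \<comment> \<open>The constant function one, that is, the set of all reals.\<close>
  define B where "B = combK N ty1 \<bullet> (succ \<bullet> zero)"
  have B: "B \<in> D ty2"
    unfolding B_def using combK_in ap_in succ_in zero_in by blast
  have In_B: "In B = Re"
    by (auto simp: In_def Re_def B_def)
  have "Cwo A R"
    by (rule Cwo_code_order) (use A R in \<open>auto simp: real_invariant_def In_D code_invariant decode_invariant\<close>)
  moreover have "Cwo B R"
    by (rule Cwo_code_order) (use B R in \<open>auto simp: real_invariant_def In_D B_def\<close>)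
  ultimately have emb: "Embeds A R B R \<or> Embeds B R A R"
    using comp A B R unfolding code_order_def by blast
  have A_iff: "(\<exists>f\<in>D ty1. Y \<bullet> f \<bullet> n = zero) \<longleftrightarrow> (\<exists>x\<in>In A. code x = n)" if n: "n \<in> D N" for n
  proof
    assume "\<exists>f\<in>D ty1. Y \<bullet> f \<bullet> n = zero"
    then obtain f where f: "f \<in> D ty1" "Y \<bullet> f \<bullet> n = zero" by blast
    \<comment> \<open>The function \<open>g\<close> consists of \<open>n\<close> followed by
      \<open>f\<close>; a real that decodes to it is the required element of
      \<open>A\<close>.\<close>
    have "\<exists>g\<in>D ty1. \<forall>k\<in>D N. g \<bullet> k = (if k = zero then n else f \<bullet> pred k)"
      by (rule rep_fun1, intro rep_if dec_eq rep_vars rep_zero rep_const[OF n] rep_ap[OF rep_const[OF f(1)]] rep_pred)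
    then obtain g where g: "g \<in> D ty1" "\<And>k. k \<in> D N \<Longrightarrow> g \<bullet> k = (if k = zero then n else f \<bullet> pred k)" by blast
    obtain x where x: "x \<in> Re" "decode x = g"
      using decode_surjective[OF g(1)] by blast
    have "?f x = f"
      by (rule LAM_eqI) (use f g x in simp_all)
    moreover have "code x = n"
      using g(2)[OF zero_in] x by (simp add: code_def)
    ultimately show "\<exists>x\<in>In A. code x = n"
      using A(2)[OF In_D(3)[OF x(1)]] x(1) f(2) by (intro bexI[of _ x]) (simp_all add: In_def)
  next
    assume "\<exists>x\<in>In A. code x = n"
    then obtain x where x: "x \<in> In A" "code x = n" by blast
    have "rep [ty1] ty1 (\<lambda>xs. ?f (hd xs))"
      by (rule rep_LAM rep_ap rep_decode rep_succ rep_vars)+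
    from rep_in[OF this, of "[x]"] have "?f x \<in> D ty1"
      using x by (simp add: In_D)
    moreover have "Y \<bullet> ?f x \<bullet> n = zero"
      using x A(2)[OF In_D(1)[OF x(1)]] by (simp add: In_def split: if_splits)
    ultimately show "\<exists>f\<in>D ty1. Y \<bullet> f \<bullet> n = zero" by blast
  qed
  txt \<open>An isomorphism from \<open>A\<close> is inverted by choice, one into \<open>A\<close> is composed with a choice of
    real codes for the natural numbers.\<close>
  have from_A: "\<exists>X. boot Y X"
    if Z: "Z \<in> D (ty1 \<rightarrow> ty1)" and I: "dec [N] (\<lambda>xs. I (hd xs))"
      and surj: "\<And>k. k \<in> D N \<Longrightarrow> I k \<Longrightarrow> \<exists>x\<in>In A. code (Z \<bullet> x) = k"
      and range: "\<And>x. x \<in> In A \<Longrightarrow> I (code (Z \<bullet> x))"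
      and iso: "\<And>x x'. x \<in> In A \<Longrightarrow> x' \<in> In A \<Longrightarrow> Rel R x x' \<longleftrightarrow> Rel R (Z \<bullet> x) (Z \<bullet> x')" for Z I
  proof -
    \<comment> \<open>Outside the index set any function is accepted as a default, so that choice
      can be applied to all numbers.\<close>
    let ?P = "\<lambda>x k. I k \<longrightarrow> x \<in> In A \<and> code (Z \<bullet> x) = k"
    have dec: "dec [ty1, N] (\<lambda>xs. ?P (hd xs) (hd (tl xs)))"
      by (intro dec_imp dec_and dec_eq dec_In rep_code rep_ap[OF rep_const[OF Z]] rep_vars dec_compose[OF I] A)
    have ex: "\<exists>x\<in>D ty1. ?P x k" if "k \<in> D N" for k
      using surj[OF that] code_surjective[OF that] In_D by (cases "I k") blast+
    obtain s where s: "s \<in> D (N \<rightarrow> ty1)" "\<And>k. k \<in> D N \<Longrightarrow> ?P (s \<bullet> k) k"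
      using choice_sequence[of ?P, OF dec ex] by blast
    show ?thesis
    proof (rule boot_of_enumeration[OF s(1) I A_iff])
      fix x assume x: "x \<in> In A"
      let ?k = "code (Z \<bullet> x)"
      have k: "?k \<in> D N" "I ?k"
        using x Z range by (simp_all add: In_D)
      then have sk: "s \<bullet> ?k \<in> In A" "code (Z \<bullet> (s \<bullet> ?k)) = ?k"
        using s(2) by blast+
      \<comment> \<open>The elements \<open>x\<close> and \<open>s k\<close> have images with the
        same code. The isomorphism reflects the order, so they are equivalent in \<open>A\<close>
        and carry the same number.\<close>
      have "Rel R x (s \<bullet> ?k)" "Rel R (s \<bullet> ?k) x"
        unfolding iso[OF x sk(1)] iso[OF sk(1) x] using x Z k s(1) sk by (simp_all add: R_eq In_D)
      then have "code (s \<bullet> ?k) = code x"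
        using x s(1) k by (intro le_antisym) (simp_all add: R_eq In_D)
      then show "\<exists>k\<in>D N. I k \<and> code (s \<bullet> k) = code x"
        using k by blast
    next
      fix k assume k: "k \<in> D N" "I k"
      show "s \<bullet> k \<in> In A"
        using s(2)[OF k(1)] k(2) by blast
    qed
  qed
  have "\<exists>b\<in>D (N \<rightarrow> ty1). \<forall>k\<in>D N. b \<bullet> k \<in> In B \<and> code (b \<bullet> k) = k"
  proof (rule choice_sequence[of "\<lambda>x k. x \<in> In B \<and> code x = k"])
    show "dec [ty1, N] (\<lambda>xs. hd xs \<in> In B \<and> code (hd xs) = hd (tl xs))"
      by (intro dec_and dec_eq dec_In rep_code rep_vars B)
    show "\<exists>x\<in>D ty1. x \<in> In B \<and> code x = k" if "k \<in> D N" for k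
      using code_surjective[OF that] In_D(3) unfolding In_B by blast
  qed
  then obtain b where b: "b \<in> D (N \<rightarrow> ty1)" "\<And>k. k \<in> D N \<Longrightarrow> b \<bullet> k \<in> In B \<and> code (b \<bullet> k) = k"
    by blast
  have sub: "In X \<subseteq> D ty1" "Initial X R c \<subseteq> D ty1" for X c
    by (auto simp: Initial_def In_D)
  consider "Iso (In A) R (In B) R" | c where "c \<in> In B" "Iso (In A) R (Initial B R c) R"
    | "Iso (In B) R (In A) R" | c where "c \<in> In A" "Iso (In B) R (Initial A R c) R"
    using emb unfolding Embeds_def by blast
  then show ?thesis
  proof cases
    case 1
    from IsoD[OF 1 sub(1) sub(1)] obtain Z where Z0: "Z \<in> D (ty1 \<rightarrow> ty1)" "\<forall>x\<in>In A. Z \<bullet> x \<in> In B"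
      "\<forall>w\<in>In B. \<exists>x\<in>In A. Rel R (Z \<bullet> x) w \<and> Rel R w (Z \<bullet> x)"
      "\<forall>x\<in>In A. \<forall>x'\<in>In A. Rel R x x' \<longleftrightarrow> Rel R (Z \<bullet> x) (Z \<bullet> x')"
      by (elim bexE conjE)
    note Z = Z0(1) Z0(2-4)[rule_format]
    show ?thesis
    proof (rule from_A[OF Z(1), of "\<lambda>_. True"])
      fix k assume k: "k \<in> D N"
      then obtain x where x: "x \<in> In A" "Rel R (Z \<bullet> x) (b \<bullet> k)" "Rel R (b \<bullet> k) (Z \<bullet> x)"
        using Z(3) b by blast
      then have "code (Z \<bullet> x) = code (b \<bullet> k)"
        using Z(1) b k by (intro le_antisym) (simp_all add: R_eq In_D)
      then show "\<exists>x\<in>In A. code (Z \<bullet> x) = k"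
        using x b k by auto
    qed (use Z dec_const in auto)
  next
    case (2 c)
    from IsoD[OF 2(2) sub(1) sub(2)] obtain Z where Z0: "Z \<in> D (ty1 \<rightarrow> ty1)" "\<forall>x\<in>In A. Z \<bullet> x \<in> Initial B R c"
      "\<forall>w\<in>Initial B R c. \<exists>x\<in>In A. Rel R (Z \<bullet> x) w \<and> Rel R w (Z \<bullet> x)"
      "\<forall>x\<in>In A. \<forall>x'\<in>In A. Rel R x x' \<longleftrightarrow> Rel R (Z \<bullet> x) (Z \<bullet> x')"
      by (elim bexE conjE)
    note Z = Z0(1) Z0(2-4)[rule_format]
    have cN: "code c \<in> D N"
      using 2(1) by (simp add: In_D)
    show ?thesis
    \<comment> \<open>The codes occurring below \<open>c\<close> are exactly the numbers below
      \<open>code c\<close>, a decidable index set.\<close>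
    proof (rule from_A[OF Z(1), of "\<lambda>k. \<not> code c \<^bold>\<le> k"])
      fix k assume k: "k \<in> D N" "\<not> code c \<^bold>\<le> k"
      then have "b \<bullet> k \<in> Initial B R c"
        using b 2(1) le_linear[of k "code c"] cN by (simp add: Initial_def R_eq In_D)
      then obtain x where x: "x \<in> In A" "Rel R (Z \<bullet> x) (b \<bullet> k)" "Rel R (b \<bullet> k) (Z \<bullet> x)"
        using Z(3) by blast
      then have "code (Z \<bullet> x) = code (b \<bullet> k)"
        using Z(1) b k by (intro le_antisym) (simp_all add: R_eq In_D)
      then show "\<exists>x\<in>In A. code (Z \<bullet> x) = k"
        using x b k by auto
    next
      fix x assume "x \<in> In A"
      then show "\<not> code c \<^bold>\<le> code (Z \<bullet> x)"
        using 2(1) Z(1) Z(2)[of x] by (simp add: Initial_def R_eq In_D)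
    next
      show "dec [N] (\<lambda>xs. \<not> code c \<^bold>\<le> hd xs)"
        by (intro dec_not dec_le rep_const rep_vars cN)
    qed (use Z(4) in blast)
  next
    case 3
    from IsoD[OF 3 sub(1) sub(1)] obtain Z where Z0: "Z \<in> D (ty1 \<rightarrow> ty1)" "\<forall>x\<in>In B. Z \<bullet> x \<in> In A"
      "\<forall>w\<in>In A. \<exists>x\<in>In B. Rel R (Z \<bullet> x) w \<and> Rel R w (Z \<bullet> x)"
      "\<forall>x\<in>In B. \<forall>x'\<in>In B. Rel R x x' \<longleftrightarrow> Rel R (Z \<bullet> x) (Z \<bullet> x')"
      by (elim bexE conjE)
    note Z = Z0(1) Z0(2-4)[rule_format]
    have "\<exists>s\<in>D (N \<rightarrow> ty1). \<forall>k\<in>D N. s \<bullet> k = Z \<bullet> (b \<bullet> k)"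
      by (rule rep_fun1) (rule rep_ap rep_const Z(1) b(1) rep_vars)+
    then obtain s where s: "s \<in> D (N \<rightarrow> ty1)" "\<And>k. k \<in> D N \<Longrightarrow> s \<bullet> k = Z \<bullet> (b \<bullet> k)" by blast
    show ?thesis
    proof (rule boot_of_enumeration[OF s(1) dec_const[of _ True] A_iff])
      fix x assume x: "x \<in> In A"
      then obtain w where w: "w \<in> In B" "Rel R (Z \<bullet> w) x" "Rel R x (Z \<bullet> w)"
        using Z(3) by blast
      let ?k = "code w"
      have k: "?k \<in> D N" "b \<bullet> ?k \<in> In B" "code (b \<bullet> ?k) = ?k"
        using b(2) w by (simp_all add: In_D)
      then have "Rel R (b \<bullet> ?k) w" "Rel R w (b \<bullet> ?k)"
        using w by (simp_all add: R_eq In_D)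
      then have "Rel R (Z \<bullet> (b \<bullet> ?k)) (Z \<bullet> w)" "Rel R (Z \<bullet> w) (Z \<bullet> (b \<bullet> ?k))"
        using Z(4)[OF k(2) w(1)] Z(4)[OF w(1) k(2)] by blast+
      then have "code (Z \<bullet> (b \<bullet> ?k)) = code (Z \<bullet> w)"
        using Z(1) w k by (intro le_antisym) (simp_all add: R_eq In_D)
      moreover have "code (Z \<bullet> w) = code x"
        using w x Z(1) by (intro le_antisym) (simp_all add: R_eq In_D)
      ultimately show "\<exists>k\<in>D N. True \<and> code (s \<bullet> k) = code x"
        using k s by auto
    qed (use s b Z(2) in auto)
  next
    case (4 c)
    from IsoD[OF 4(2) sub(1) sub(2)] obtain Z where Z0: "Z \<in> D (ty1 \<rightarrow> ty1)" "\<forall>x\<in>In B. Z \<bullet> x \<in> Initial A R c"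
      "\<forall>w\<in>Initial A R c. \<exists>x\<in>In B. Rel R (Z \<bullet> x) w \<and> Rel R w (Z \<bullet> x)"
      "\<forall>x\<in>In B. \<forall>x'\<in>In B. Rel R x x' \<longleftrightarrow> Rel R (Z \<bullet> x) (Z \<bullet> x')"
      by (elim bexE conjE)
    note Z = Z0(1) Z0(2-4)[rule_format]
    have cN: "code c \<in> D N"
      using 4(1) by (simp add: In_D)
    \<comment> \<open>On the chosen reals \<open>b k\<close> the isomorphism acts as a strictly
      increasing map of numbers. Such a map lies above the identity, which at \<open>code c\<close>
      contradicts that all images lie below \<open>c\<close>.\<close>
    have mono: "k \<^bold>\<le> l \<longleftrightarrow> code (Z \<bullet> (b \<bullet> k)) \<^bold>\<le> code (Z \<bullet> (b \<bullet> l))" if "k \<in> D N" "l \<in> D N" for k l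
      using Z(4)[of "b \<bullet> k" "b \<bullet> l"] b that Z(1) by (simp add: R_eq In_D)
    have "code c \<^bold>\<le> code (Z \<bullet> (b \<bullet> code c))"
    proof (rule IND[of "\<lambda>k. k \<^bold>\<le> code (Z \<bullet> (b \<bullet> k))", OF _ _ _ cN])
      show "dec [N] (\<lambda>xs. hd xs \<^bold>\<le> code (Z \<bullet> (b \<bullet> hd xs)))"
        by (rule dec_le rep_code rep_ap rep_const Z(1) b(1) rep_vars)+
      show "zero \<^bold>\<le> code (Z \<bullet> (b \<bullet> zero))"
        using Z(1) b by simp
      fix k assume k: "k \<in> D N" "k \<^bold>\<le> code (Z \<bullet> (b \<bullet> k))"
      have "\<not> succ \<bullet> k \<^bold>\<le> k"
        using k not_le[of k k] by simp
      then have "succ \<bullet> code (Z \<bullet> (b \<bullet> k)) \<^bold>\<le> code (Z \<bullet> (b \<bullet> (succ \<bullet> k)))"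
        using mono[of "succ \<bullet> k" k] k b(1) Z(1) by (simp add: not_le)
      moreover have "succ \<bullet> k \<^bold>\<le> succ \<bullet> code (Z \<bullet> (b \<bullet> k))"
        using k b(1) Z(1) by simp
      ultimately show "succ \<bullet> k \<^bold>\<le> code (Z \<bullet> (b \<bullet> (succ \<bullet> k)))"
        by (rule le_trans') (use k b(1) Z(1) in simp_all)
    qed
    moreover have "\<not> code c \<^bold>\<le> code (Z \<bullet> (b \<bullet> code c))"
      using 4(1) Z(1) Z(2)[of "b \<bullet> code c"] b cN by (simp add: Initial_def R_eq In_D)
    ultimately show ?thesis by blast
  qed
qed

section \<open>Well-orders on sets of natural numbers\<close>

text \<open>Membership is value zero, as in \<open>dec\<close>, and opposite to the convention for
  characteristic functions of sets in BOOT.\<close>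

definition fld :: "'a \<Rightarrow> 'a set" where
  "fld I = {n \<in> D N. I \<bullet> n = zero}"

definition lq :: "'a \<Rightarrow> 'a \<Rightarrow> 'a \<Rightarrow> bool" where
  "lq L n m \<longleftrightarrow> L \<bullet> n \<bullet> m = zero"

definition lequiv :: "'a \<Rightarrow> 'a \<Rightarrow> 'a \<Rightarrow> bool" where
  "lequiv L n m \<longleftrightarrow> lq L n m \<and> lq L m n"

text \<open>The order is total and transitive but not antisymmetric, since distinct numbers may
  index equivalent elements. By totality, the negated comparison expresses a strict descent.\<close>

definition wo :: "'a \<Rightarrow> 'a \<Rightarrow> bool" where
  "wo I L \<longleftrightarrow> I \<in> D ty1 \<and> L \<in> D (N \<rightarrow> ty1) \<and>
    (\<forall>n\<in>fld I. \<forall>m\<in>fld I. lq L n m \<or> lq L m n) \<and>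
    (\<forall>n\<in>fld I. \<forall>m\<in>fld I. \<forall>k\<in>fld I. lq L n m \<longrightarrow> lq L m k \<longrightarrow> lq L n k) \<and>
    \<not> (\<exists>f\<in>D ty1. \<forall>n\<in>D N. f \<bullet> n \<in> fld I \<and> \<not> lq L (f \<bullet> n) (f \<bullet> (succ \<bullet> n)))"

text \<open>The predicate \<open>Q\<close> cuts out the range, either everything or the part below
  an element; surjectivity holds up to equivalence.\<close>

definition order_embeds :: "'a \<Rightarrow> 'a \<Rightarrow> 'a \<Rightarrow> 'a \<Rightarrow> ('a \<Rightarrow> bool) \<Rightarrow> bool" where
  "order_embeds I L J M Q \<longleftrightarrow> (\<exists>k\<in>D ty1.
    (\<forall>n\<in>fld I. k \<bullet> n \<in> fld J \<and> Q (k \<bullet> n)) \<and>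
    (\<forall>n\<in>fld I. \<forall>n'\<in>fld I. lq L n n' \<longleftrightarrow> lq M (k \<bullet> n) (k \<bullet> n')) \<and>
    (\<forall>m\<in>fld J. Q m \<longrightarrow> (\<exists>n\<in>fld I. lequiv M (k \<bullet> n) m)))"

lemma dec_fld: "rep \<Gamma> N F \<Longrightarrow> I \<in> D ty1 \<Longrightarrow> dec \<Gamma> (\<lambda>xs. F xs \<in> fld I)"
proof -
  assume F: "rep \<Gamma> N F" and I: "I \<in> D ty1"
  have "dec \<Gamma> (\<lambda>xs. I \<bullet> F xs = zero)"
    by (rule dec_eq rep_zero rep_ap rep_const F I)+
  then show ?thesis
    by (rule dec_cong[THEN iffD1, rotated]) (simp add: fld_def rep_in[OF F])
qed

lemma dec_lq: "rep \<Gamma> N F \<Longrightarrow> rep \<Gamma> N G \<Longrightarrow> L \<in> D (N \<rightarrow> ty1) \<Longrightarrow> dec \<Gamma> (\<lambda>xs. lq L (F xs) (G xs))"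
  unfolding lq_def by (rule dec_eq rep_zero rep_ap rep_const | assumption)+

lemma dec_lequiv: "rep \<Gamma> N F \<Longrightarrow> rep \<Gamma> N G \<Longrightarrow> L \<in> D (N \<rightarrow> ty1) \<Longrightarrow> dec \<Gamma> (\<lambda>xs. lequiv L (F xs) (G xs))"
  unfolding lequiv_def by (intro dec_and dec_lq)

lemma dec_fun:
  assumes "dec [N] (\<lambda>xs. P (hd xs))"
  shows "\<exists>p\<in>D ty1. \<forall>n\<in>D N. p \<bullet> n = zero \<longleftrightarrow> P n"
proof -
  obtain p where "p \<in> D ty1" "\<And>n. n \<in> D N \<Longrightarrow> p \<bullet> n = (if P n then zero else succ \<bullet> zero)"
    using rep_fun1[OF assms[unfolded dec_def]] by blast
  then show ?thesis
    by (intro bexI[of _ p]) auto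
qed

lemma fld_D [simp]: "n \<in> fld I \<Longrightarrow> n \<in> D N"
  by (simp add: fld_def)

lemma wo_D:
  assumes "wo I L"
  shows "I \<in> D ty1" "L \<in> D (N \<rightarrow> ty1)"
    "n \<in> fld I \<Longrightarrow> m \<in> fld I \<Longrightarrow> lq L n m \<or> lq L m n"
    "n \<in> fld I \<Longrightarrow> m \<in> fld I \<Longrightarrow> k \<in> fld I \<Longrightarrow> lq L n m \<Longrightarrow> lq L m k \<Longrightarrow> lq L n k"
    "n \<in> fld I \<Longrightarrow> lq L n n"
  using assms unfolding wo_def by blast+

text \<open>Otherwise \<open>CH\<close> selects from each element of \<open>P\<close> a strictly
  smaller one, and recursion from \<open>n\<close> yields a descending sequence in the model.
  Decidability of \<open>P\<close> is what makes both the selection and the induction along the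
  sequence possible.\<close>

lemma wo_min:
  assumes wo: "wo I L" and P: "dec [N] (\<lambda>xs. P (hd xs))" and n: "n \<in> fld I" "P n"
  shows "\<exists>m\<in>fld I. P m \<and> (\<forall>k\<in>fld I. P k \<longrightarrow> lq L m k)"
proof (rule ccontr)
  assume "\<not> ?thesis"
  then have step: "\<exists>k\<in>fld I. P k \<and> \<not> lq L m k" if "m \<in> fld I" "P m" for m
    using that by blast
  note IL = wo_D(1,2)[OF wo]
  \<comment> \<open>With \<open>P\<close> given by an element of the model, it may occur under
    further variables.\<close>
  obtain p where p: "p \<in> D ty1" "\<And>n. n \<in> D N \<Longrightarrow> p \<bullet> n = zero \<longleftrightarrow> P n"
    using dec_fun[OF P] by blast
  let ?Q = "\<lambda>m k. k \<in> fld I \<and> p \<bullet> k = zero \<and> \<not> lq L m k"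
  have "\<exists>g\<in>D (N \<rightarrow> N \<rightarrow> N). \<forall>i\<in>D N. \<forall>m\<in>D N. g \<bullet> i \<bullet> m = CH (?Q m)"
    by (rule rep_fun2, intro rep_CH dec_and dec_not dec_fld dec_lq dec_eq rep_ap[OF rep_const[OF p(1)]] rep_zero rep_vars IL)
  then obtain g where g: "g \<in> D (N \<rightarrow> N \<rightarrow> N)" "\<And>i m. i \<in> D N \<Longrightarrow> m \<in> D N \<Longrightarrow> g \<bullet> i \<bullet> m = CH (?Q m)"
    by blast
  have Q: "dec [N] (\<lambda>xs. ?Q m (hd xs))" if "m \<in> D N" for m
    by (intro dec_and dec_not dec_fld dec_lq dec_eq rep_ap[OF rep_const[OF p(1)]] rep_zero rep_vars rep_const IL that)
  have nxt: "?Q m (CH (?Q m))" if m: "m \<in> fld I" "p \<bullet> m = zero" for m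
  proof -
    obtain k where "k \<in> fld I" "P k" "\<not> lq L m k"
      using step[OF m(1)] p(2)[OF fld_D[OF m(1)]] m(2) by blast
    then have "\<exists>k\<in>D N. ?Q m k"
      using p(2)[of k] by (intro bexI[of _ k]) simp_all
    then show ?thesis
      by (rule CH(2)[OF Q[OF fld_D[OF m(1)]]])
  qed
  define f where "f = recursor \<bullet> g \<bullet> n"
  have f: "f \<in> D ty1"
    unfolding f_def using recursor_in g(1) fld_D[OF n(1)] ap_in by blast
  have f_succ: "f \<bullet> (succ \<bullet> i) = CH (?Q (f \<bullet> i))" if "i \<in> D N" for i
  proof -
    have "f \<bullet> (succ \<bullet> i) = g \<bullet> i \<bullet> (f \<bullet> i)"
      unfolding f_def using g(1) n that by simp
    then show ?thesis
      using g(2) f that by simp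
  qed
  have fP: "f \<bullet> i \<in> fld I \<and> p \<bullet> (f \<bullet> i) = zero" if i: "i \<in> D N" for i
  proof (rule IND[of "\<lambda>i. f \<bullet> i \<in> fld I \<and> p \<bullet> (f \<bullet> i) = zero", OF _ _ _ i])
    show "dec [N] (\<lambda>xs. f \<bullet> hd xs \<in> fld I \<and> p \<bullet> (f \<bullet> hd xs) = zero)"
      by (intro dec_and dec_fld dec_eq rep_ap[OF rep_const[OF p(1)]] rep_ap[OF rep_const[OF f]] rep_zero rep_vars IL)
    show "f \<bullet> zero \<in> fld I \<and> p \<bullet> (f \<bullet> zero) = zero"
      using g(1) n p(2) by (simp add: f_def)
    fix i assume "i \<in> D N" "f \<bullet> i \<in> fld I \<and> p \<bullet> (f \<bullet> i) = zero"
    then show "f \<bullet> (succ \<bullet> i) \<in> fld I \<and> p \<bullet> (f \<bullet> (succ \<bullet> i)) = zero"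
      using nxt[of "f \<bullet> i"] by (simp add: f_succ)
  qed
  have "f \<bullet> i \<in> fld I \<and> \<not> lq L (f \<bullet> i) (f \<bullet> (succ \<bullet> i))" if "i \<in> D N" for i
    using fP[OF that] nxt[of "f \<bullet> i"] that by (simp add: f_succ)
  then show False
    using wo f unfolding wo_def by blast
qed

definition seg :: "'a \<Rightarrow> 'a \<Rightarrow> 'a \<Rightarrow> 'a set" where
  "seg I L a = {n \<in> fld I. \<not> lq L a n}"

end

section \<open>Isomorphisms between initial segments\<close>

locale order_pair = aca_model +
  fixes I L J M :: 'a
  assumes I: "wo I L" and J: "wo J M"
begin

text \<open>The quantifiers range over \<open>D N\<close> with explicit bounds so that the rules for
  decidability apply; \<open>seg_iso_iff\<close> is the readable form.\<close>

definition seg_iso :: "'a \<Rightarrow> 'a \<Rightarrow> 'a \<Rightarrow> bool" where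
  "seg_iso h a b \<longleftrightarrow>
    (\<forall>n\<in>D N. n \<in> fld I \<and> \<not> lq L a n \<longrightarrow> h \<bullet> n \<in> fld J \<and> \<not> lq M b (h \<bullet> n)) \<and>
    (\<forall>n\<in>D N. n \<in> fld I \<and> \<not> lq L a n \<longrightarrow> (\<forall>n'\<in>D N. n' \<in> fld I \<and> \<not> lq L a n' \<longrightarrow>
      (lq L n n' \<longleftrightarrow> lq M (h \<bullet> n) (h \<bullet> n')))) \<and>
    (\<forall>m\<in>D N. m \<in> fld J \<and> \<not> lq M b m \<longrightarrow> (\<exists>n\<in>D N. (n \<in> fld I \<and> \<not> lq L a n) \<and> lequiv M (h \<bullet> n) m))"

lemma seg_iso_iff: "seg_iso h a b \<longleftrightarrow> (\<forall>n\<in>seg I L a. h \<bullet> n \<in> seg J M b) \<and>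
    (\<forall>n\<in>seg I L a. \<forall>n'\<in>seg I L a. lq L n n' \<longleftrightarrow> lq M (h \<bullet> n) (h \<bullet> n')) \<and>
    (\<forall>m\<in>seg J M b. \<exists>n\<in>seg I L a. lequiv M (h \<bullet> n) m)"
proof -
  have "(\<forall>n\<in>D N. n \<in> fld I' \<and> \<not> lq L' c n \<longrightarrow> P n) \<longleftrightarrow> (\<forall>n\<in>seg I' L' c. P n)"
    "(\<exists>n\<in>D N. (n \<in> fld I' \<and> \<not> lq L' c n) \<and> P n) \<longleftrightarrow> (\<exists>n\<in>seg I' L' c. P n)" for I' L' c P
    by (auto simp: seg_def)
  then show ?thesis
    unfolding seg_iso_def by (simp add: seg_def)
qed

lemma dec_seg_iso:
  assumes "rep \<Gamma> ty1 F" "rep \<Gamma> N G" "rep \<Gamma> N H"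
  shows "dec \<Gamma> (\<lambda>xs. seg_iso (F xs) (G xs) (H xs))"
  unfolding seg_iso_def
  by (intro dec_and dec_all dec_imp dec_iff dec_ex dec_not dec_fld dec_lq dec_lequiv
      rep_apN rep_vars wo_D(1,2)[OF I] wo_D(1,2)[OF J] assms[THEN rep_tl] assms[THEN rep_tl, THEN rep_tl])

lemmas totalI = wo_D(3)[OF I] and transI = wo_D(4)[OF I] and reflI = wo_D(5)[OF I]
lemmas totalJ = wo_D(3)[OF J] and transJ = wo_D(4)[OF J] and reflJ = wo_D(5)[OF J]

lemma segD: "n \<in> seg I' L' a \<Longrightarrow> n \<in> fld I'" "n \<in> seg I' L' a \<Longrightarrow> \<not> lq L' a n"
  by (auto simp: seg_def)

lemma lequiv_trans: "lequiv M x y \<Longrightarrow> lequiv M y z \<Longrightarrow> x \<in> fld J \<Longrightarrow> y \<in> fld J \<Longrightarrow> z \<in> fld J \<Longrightarrow> lequiv M x z"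
  unfolding lequiv_def using transJ by blast

lemma lq_cong:
  "lequiv M x x' \<Longrightarrow> lequiv M y y' \<Longrightarrow> x \<in> fld J \<Longrightarrow> x' \<in> fld J \<Longrightarrow> y \<in> fld J \<Longrightarrow> y' \<in> fld J \<Longrightarrow>
    lq M x y \<longleftrightarrow> lq M x' y'"
  unfolding lequiv_def using transJ by blast

lemma lequiv_sym: "lequiv M x y \<Longrightarrow> lequiv M y x"
  by (auto simp: lequiv_def)

lemma seg_trans:
  "n \<in> seg I L a \<Longrightarrow> lq L a a' \<Longrightarrow> a \<in> fld I \<Longrightarrow> a' \<in> fld I \<Longrightarrow> n \<in> seg I L a'"
  "n' \<in> fld I \<Longrightarrow> \<not> lq L n n' \<Longrightarrow> n \<in> seg I L a \<Longrightarrow> a \<in> fld I \<Longrightarrow> n' \<in> seg I L a"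
  "m' \<in> fld J \<Longrightarrow> \<not> lq M m m' \<Longrightarrow> m \<in> seg J M b \<Longrightarrow> b \<in> fld J \<Longrightarrow> m' \<in> seg J M b"
  "m \<in> seg J M b \<Longrightarrow> lq M b b' \<Longrightarrow> b \<in> fld J \<Longrightarrow> b' \<in> fld J \<Longrightarrow> m \<in> seg J M b'"
  unfolding seg_def using transI totalI transJ totalJ by blast+

text \<open>At a least point \<open>n\<close> of disagreement the smaller of the two values must be
  attained by the other map as well, at some \<open>k\<close>. This \<open>k\<close> precedes
  \<open>n\<close>, where both maps agree, so one map takes equivalent values at \<open>k\<close>
  and \<open>n\<close>, which forces \<open>n\<close> not to exceed \<open>k\<close>.\<close>

lemma seg_iso_agree:
  assumes h: "seg_iso h a b" "h \<in> D ty1" "a \<in> fld I" "b \<in> fld J"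
    and h': "seg_iso h' a' b'" "h' \<in> D ty1" "a' \<in> fld I" "b' \<in> fld J"
    and le: "lq L a a'" and n: "n \<in> seg I L a"
  shows "lequiv M (h \<bullet> n) (h' \<bullet> n)"
proof (rule ccontr)
  assume neq: "\<not> lequiv M (h \<bullet> n) (h' \<bullet> n)"
  let ?P = "\<lambda>n. \<not> lq L a n \<and> \<not> lequiv M (h \<bullet> n) (h' \<bullet> n)"
  have "dec [N] (\<lambda>xs. ?P (hd xs))"
    by (intro dec_and dec_not dec_lq dec_lequiv rep_ap[OF rep_const[OF h(2)]] rep_ap[OF rep_const[OF h'(2)]]
        rep_const rep_vars wo_D(2)[OF I] wo_D(2)[OF J] fld_D[OF h(3)])
  from wo_min[OF I this, of n] obtain n where n: "n \<in> seg I L a" "\<not> lequiv M (h \<bullet> n) (h' \<bullet> n)"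
    and min: "\<And>k. k \<in> seg I L a \<Longrightarrow> \<not> lq L n k \<Longrightarrow> lequiv M (h \<bullet> k) (h' \<bullet> k)"
    using n neq unfolding seg_def by blast
  have n': "n \<in> seg I L a'"
    using n(1) le h(3) h'(3) by (rule seg_trans)
  note H = h(1)[unfolded seg_iso_iff] and H' = h'(1)[unfolded seg_iso_iff]
  have hn: "h \<bullet> n \<in> seg J M b" "h' \<bullet> n \<in> seg J M b'"
    using H H' n n' by blast+
  consider "\<not> lq M (h' \<bullet> n) (h \<bullet> n)" | "\<not> lq M (h \<bullet> n) (h' \<bullet> n)"
    using n(2) by (auto simp: lequiv_def)
  then show False
  proof cases
    case 1
    then have "h \<bullet> n \<in> seg J M b'"
      using hn h'(4) segD seg_trans(3) by blast
    then obtain k where k: "k \<in> seg I L a'" "lequiv M (h' \<bullet> k) (h \<bullet> n)"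
      using H' by blast
    have hk: "h' \<bullet> k \<in> seg J M b'"
      using H' k by blast
    have "\<not> lq L n k"
    proof
      assume "lq L n k"
      then have "lq M (h' \<bullet> n) (h' \<bullet> k)"
        using H' n' k by blast
      then show False
        using 1 k(2) transJ[of "h' \<bullet> n" "h' \<bullet> k" "h \<bullet> n"] hn hk segD by (auto simp: lequiv_def)
    qed
    moreover from this have ka: "k \<in> seg I L a"
      using k n h(3) segD seg_trans(2) by blast
    ultimately have "lequiv M (h \<bullet> k) (h' \<bullet> k)"
      using min by blast
    moreover have "h \<bullet> k \<in> seg J M b"
      using H ka by blast
    ultimately have "lequiv M (h \<bullet> k) (h \<bullet> n)"
      using lequiv_trans[OF _ k(2)] hk hn segD by blast
    then have "lq L n k"
      using H ka n by (auto simp: lequiv_def)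
    with \<open>\<not> lq L n k\<close> show False by blast
  next
    case 2
    then have "h' \<bullet> n \<in> seg J M b"
      using hn h(4) segD seg_trans(3) by blast
    then obtain k where k: "k \<in> seg I L a" "lequiv M (h \<bullet> k) (h' \<bullet> n)"
      using H by blast
    have hk: "h \<bullet> k \<in> seg J M b"
      using H k by blast
    have "\<not> lq L n k"
    proof
      assume "lq L n k"
      then have "lq M (h \<bullet> n) (h \<bullet> k)"
        using H n k by blast
      then show False
        using 2 k(2) transJ[of "h \<bullet> n" "h \<bullet> k" "h' \<bullet> n"] hn hk segD by (auto simp: lequiv_def)
    qed
    moreover have ka: "k \<in> seg I L a'"
      using k(1) le h(3) h'(3) by (rule seg_trans)
    ultimately have "lequiv M (h' \<bullet> k) (h \<bullet> k)"
      using min k lequiv_sym by blast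
    moreover have "h' \<bullet> k \<in> seg J M b'"
      using H' ka by blast
    ultimately have "lequiv M (h' \<bullet> k) (h' \<bullet> n)"
      using lequiv_trans[OF _ k(2)] hk hn segD by blast
    then have "lq L n k"
      using H' ka n' by (auto simp: lequiv_def)
    with \<open>\<not> lq L n k\<close> show False by blast
  qed
qed

text \<open>If \<open>b'\<close> preceded \<open>b\<close>, then \<open>h\<close> would attain it at
  some \<open>n\<close> below \<open>a\<close>, where \<open>h'\<close> has an equivalent value, yet
  all values of \<open>h'\<close> precede \<open>b'\<close>. If \<open>a'\<close> preceded
  \<open>a\<close>, then \<open>h'\<close> would attain the value of \<open>h\<close> at
  \<open>a'\<close> at some \<open>n\<close> below \<open>a'\<close>, where both maps agree,
  contrary to \<open>h\<close> being order reflecting.\<close>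

lemma seg_iso_le_iff:
  assumes h: "seg_iso h a b" "h \<in> D ty1" "a \<in> fld I" "b \<in> fld J"
    and h': "seg_iso h' a' b'" "h' \<in> D ty1" "a' \<in> fld I" "b' \<in> fld J"
  shows "lq L a a' \<longleftrightarrow> lq M b b'"
proof
  note H = h(1)[unfolded seg_iso_iff] and H' = h'(1)[unfolded seg_iso_iff]
  assume le: "lq L a a'"
  show "lq M b b'"
  proof (rule ccontr)
    assume "\<not> lq M b b'"
    then have "b' \<in> seg J M b"
      using h'(4) by (simp add: seg_def)
    then obtain n where n: "n \<in> seg I L a" "lequiv M (h \<bullet> n) b'"
      using H by blast
    then have "lequiv M (h \<bullet> n) (h' \<bullet> n)"
      using seg_iso_agree[OF h h' le] by blast
    moreover have "h' \<bullet> n \<in> seg J M b'" "h \<bullet> n \<in> seg J M b"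
      using H H' n seg_trans(1)[OF n(1) le h(3) h'(3)] by blast+
    ultimately show False
      using n(2) transJ[of b' "h \<bullet> n" "h' \<bullet> n"] h'(4) segD by (auto simp: lequiv_def)
  qed
next
  note H = h(1)[unfolded seg_iso_iff] and H' = h'(1)[unfolded seg_iso_iff]
  assume le: "lq M b b'"
  show "lq L a a'"
  proof (rule ccontr)
    assume "\<not> lq L a a'"
    then have a': "a' \<in> seg I L a" "lq L a' a"
      using h(3) h'(3) totalI by (auto simp: seg_def)
    then have ha: "h \<bullet> a' \<in> seg J M b"
      using H by blast
    then have "h \<bullet> a' \<in> seg J M b'"
      using seg_trans(4) le h(4) h'(4) by blast
    then obtain n where n: "n \<in> seg I L a'" "lequiv M (h' \<bullet> n) (h \<bullet> a')"
      using H' by blast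
    have na: "n \<in> seg I L a"
      using seg_trans(1)[OF n(1) a'(2) h'(3) h(3)] .
    have "lequiv M (h' \<bullet> n) (h \<bullet> n)"
      using seg_iso_agree[OF h' h a'(2) n(1)] .
    moreover have "h' \<bullet> n \<in> seg J M b'" "h \<bullet> n \<in> seg J M b"
      using H H' n na by blast+
    ultimately have "lequiv M (h \<bullet> n) (h \<bullet> a')"
      using lequiv_trans[OF lequiv_sym n(2)] ha segD by blast
    then have "lq L a' n"
      using H na a' by (auto simp: lequiv_def)
    then show False
      using n segD by blast
  qed
qed

text \<open>An isomorphism preserves and reflects strict order, so preimages of elements below
  \<open>h n\<close> lie below \<open>n\<close>.\<close>

lemma seg_iso_restrict:
  assumes h: "seg_iso h a b" "a \<in> fld I" "b \<in> fld J" and n: "n \<in> seg I L a"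
  shows "seg_iso h n (h \<bullet> n)" "h \<bullet> n \<in> fld J"
proof -
  note H = h(1)[unfolded seg_iso_iff]
  have hn: "h \<bullet> n \<in> seg J M b"
    using H n by blast
  then show "h \<bullet> n \<in> fld J"
    by (rule segD)
  have sub: "k \<in> seg I L a" if "k \<in> seg I L n" for k
    using that n h(2) segD seg_trans(2) by blast
  show "seg_iso h n (h \<bullet> n)"
    unfolding seg_iso_iff
  proof (intro conjI ballI)
    fix k assume k: "k \<in> seg I L n"
    then have "h \<bullet> k \<in> seg J M b" "\<not> lq M (h \<bullet> n) (h \<bullet> k)"
      using H n sub segD by blast+
    then show "h \<bullet> k \<in> seg J M (h \<bullet> n)"
      by (simp add: seg_def)
  next
    fix k k' assume "k \<in> seg I L n" "k' \<in> seg I L n"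
    then show "lq L k k' \<longleftrightarrow> lq M (h \<bullet> k) (h \<bullet> k')"
      using H sub by blast
  next
    fix m assume m: "m \<in> seg J M (h \<bullet> n)"
    then have "m \<in> seg J M b"
      using hn h(3) segD seg_trans(3) by blast
    then obtain k where k: "k \<in> seg I L a" "lequiv M (h \<bullet> k) m"
      using H by blast
    have "\<not> lq L n k"
    proof
      assume "lq L n k"
      then have "lq M (h \<bullet> n) (h \<bullet> k)"
        using H n k by blast
      moreover have "h \<bullet> k \<in> seg J M b"
        using H k by blast
      ultimately have "lq M (h \<bullet> n) m"
        using k(2) transJ[of "h \<bullet> n" "h \<bullet> k" m] hn segD m by (auto simp: lequiv_def)
      then show False
        using m segD by blast
    qed
    then show "\<exists>k\<in>seg I L n. lequiv M (h \<bullet> k) m"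
      using k by (intro bexI[of _ k]) (simp_all add: seg_def)
  qed
qed

text \<open>BOOT yields the set \<open>K\<close> of all \<open>a\<close> whose initial segment is isomorphic to an initial segment
  of the other order; the witnesses \<open>f\<close> code the bound \<open>f 0\<close> of the latter and the isomorphism
  \<open>\<lambda>k. f (k + 1)\<close>. The chosen bounds form the largest isomorphism \<open>g\<close> between initial segments.\<close>

lemma comparison:
  assumes boot: "\<And>Y. Y \<in> D (ty1 \<rightarrow> N \<rightarrow> N) \<Longrightarrow> \<exists>X. boot Y X"
  shows "order_embeds I L J M (\<lambda>_. True) \<or> (\<exists>b\<in>fld J. order_embeds I L J M (\<lambda>m. \<not> lq M b m)) \<or>
    order_embeds J M I L (\<lambda>_. True) \<or> (\<exists>a\<in>fld I. order_embeds J M I L (\<lambda>n. \<not> lq L a n))"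
proof -
  note IJ = wo_D(1,2)[OF I] wo_D(1,2)[OF J]
  let ?s = "\<lambda>f. LAM N N (\<lambda>k. f \<bullet> (succ \<bullet> k))"
  let ?P = "\<lambda>f n. n \<in> fld I \<and> f \<bullet> zero \<in> fld J \<and> seg_iso (?s f) n (f \<bullet> zero)"
  \<comment> \<open>Isomorphy of segments quantifies over numbers only, so BOOT is applied to a
    decidable relation between \<open>f\<close> and \<open>n\<close>.\<close>
  have decP: "dec [ty1, N] (\<lambda>xs. ?P (hd xs) (hd (tl xs)))"
    by (intro dec_and dec_fld dec_seg_iso rep_LAM rep_apN rep_succ rep_zero rep_vars IJ)
  have s_in: "?s f \<in> D ty1" if "f \<in> D ty1" for f
  proof -
    have "rep [ty1] ty1 (\<lambda>xs. ?s (hd xs))"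
      by (intro rep_LAM rep_apN rep_succ rep_vars)
    from rep_in[OF this, of "[f]"] that show ?thesis by simp
  qed
  obtain Y where Y: "Y \<in> D (ty1 \<rightarrow> N \<rightarrow> N)" "\<And>f n. f \<in> D ty1 \<Longrightarrow> n \<in> D N \<Longrightarrow>
      Y \<bullet> f \<bullet> n = (if ?P f n then zero else succ \<bullet> zero)"
    using rep_fun2[of ty1 N N "\<lambda>f n. if ?P f n then zero else succ \<bullet> zero"] decP unfolding dec_def by blast
  obtain X where X: "boot Y X"
    using boot[OF Y(1)] by blast
  define K where "K n \<longleftrightarrow> X \<bullet> n = succ \<bullet> zero" for n
  have XD: "X \<in> D ty1"
    using X by (simp add: boot_def)
  have K_iff: "K n \<longleftrightarrow> (\<exists>f\<in>D ty1. ?P f n)" if "n \<in> D N" for n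
    using X Y(2) that by (auto simp: boot_def K_def)
  have dec_K: "dec \<Gamma> (\<lambda>xs. K (F xs))" if "rep \<Gamma> N F" for \<Gamma> F
    unfolding K_def by (intro dec_eq rep_succ rep_zero rep_ap[OF rep_const[OF XD]] that)
  have K_I: "n \<in> fld I" if "K n" "n \<in> D N" for n
    using that K_iff by blast
  \<comment> \<open>The witness is the bound \<open>b\<close> followed by the values of
    \<open>h\<close>.\<close>
  have K_intro: "K a" if a: "a \<in> fld I" and b: "b \<in> fld J" and h: "h \<in> D ty1" "seg_iso h a b" for a b h
  proof -
    have "\<exists>f\<in>D ty1. \<forall>k\<in>D N. f \<bullet> k = (if k = zero then b else h \<bullet> pred k)"
      by (rule rep_fun1, intro rep_if dec_eq rep_vars rep_zero rep_const[OF fld_D[OF b]]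
          rep_ap[OF rep_const[OF h(1)]] rep_pred)
    then obtain f where f: "f \<in> D ty1" "\<And>k. k \<in> D N \<Longrightarrow> f \<bullet> k = (if k = zero then b else h \<bullet> pred k)" by blast
    have "?s f = h"
      by (rule LAM_eqI) (use f h in simp_all)
    moreover have "f \<bullet> zero = b"
      using f(2)[OF zero_in] by simp
    ultimately show ?thesis
      using K_iff[of a] f(1) a b h(2) by auto
  qed
  have "\<exists>s\<in>D (N \<rightarrow> ty1). \<forall>n\<in>D N. K n \<longrightarrow> ?P (s \<bullet> n) n"
  proof (rule choice_sequence[of "\<lambda>f n. K n \<longrightarrow> ?P f n"])
    show "dec [ty1, N] (\<lambda>xs. K (hd (tl xs)) \<longrightarrow> ?P (hd xs) (hd (tl xs)))"
      by (intro dec_imp dec_K decP rep_vars)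
    show "\<exists>f\<in>D ty1. K n \<longrightarrow> ?P f n" if "n \<in> D N" for n
      using K_iff[OF that] XD by (cases "K n") auto
  qed
  then obtain s where s: "s \<in> D (N \<rightarrow> ty1)" "\<And>n. n \<in> D N \<Longrightarrow> K n \<Longrightarrow> ?P (s \<bullet> n) n" by blast
  have "\<exists>g\<in>D ty1. \<forall>n\<in>D N. g \<bullet> n = s \<bullet> n \<bullet> zero"
    by (rule rep_fun1, intro rep_apN rep_zero rep_vars rep_const[OF s(1)])
  then obtain g where g: "g \<in> D ty1" "\<And>n. n \<in> D N \<Longrightarrow> g \<bullet> n = s \<bullet> n \<bullet> zero" by blast
  define h where "h n = ?s (s \<bullet> n)" for n
  have h: "h n \<in> D ty1" if "n \<in> D N" for n
    unfolding h_def by (rule s_in) (use s that in simp)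
  have iso: "seg_iso (h n) n (g \<bullet> n)" "g \<bullet> n \<in> fld J" if "K n" "n \<in> D N" for n
    using s(2)[OF that(2,1)] g(2)[OF that(2)] by (simp_all add: h_def)
  have g_iff: "lq L n n' \<longleftrightarrow> lq M (g \<bullet> n) (g \<bullet> n')" if "K n" "K n'" "n \<in> D N" "n' \<in> D N" for n n'
    using that by (intro seg_iso_le_iff[of "h n" _ _ "h n'"] iso h K_I)
  \<comment> \<open>An element equivalent to \<open>n\<close> has the same initial segment; an
    element strictly below inherits the restricted isomorphism.\<close>
  have K_down: "K n'" if n: "K n" "n \<in> D N" and n': "n' \<in> fld I" "lq L n' n" for n n'
  proof (cases "lq L n n'")
    case True
    have "seg I L n' = seg I L n"
      using seg_trans(1) True n' K_I[OF n] by blast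
    then show ?thesis
      using iso[OF n] K_intro[OF n'(1) iso(2)[OF n] h[OF n(2)]] by (simp add: seg_iso_iff)
  next
    case False
    then have "n' \<in> seg I L n"
      using n' by (simp add: seg_def)
    from seg_iso_restrict[OF iso(1)[OF n] K_I[OF n] iso(2)[OF n] this] show ?thesis
      using K_intro[OF n'(1)] h[OF n(2)] by blast
  qed
  \<comment> \<open>A smaller \<open>b\<close> is attained by the isomorphism chosen for
    \<open>n\<close>, at some \<open>k\<close>. Its restriction puts \<open>k\<close> into
    \<open>K\<close>, though with a bound that may differ from the chosen
    \<open>g k\<close>.\<close>
  have image_down: "\<exists>n'\<in>D N. K n' \<and> lequiv M (g \<bullet> n') b" if n: "K n" "n \<in> D N" and b: "b \<in> fld J" "lq M b (g \<bullet> n)" for n b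
  proof (cases "lq M (g \<bullet> n) b")
    case True
    then show ?thesis
      using n b by (auto simp: lequiv_def)
  next
    case False
    then have "b \<in> seg J M (g \<bullet> n)"
      using b by (simp add: seg_def)
    then obtain k where k: "k \<in> seg I L n" "lequiv M (h n \<bullet> k) b"
      using iso(1)[OF n] unfolding seg_iso_iff by blast
    have kI: "k \<in> fld I"
      using k segD by blast
    note r = seg_iso_restrict[OF iso(1)[OF n] K_I[OF n] iso(2)[OF n] k(1)]
    have Kk: "K k"
      using K_intro[OF kI r(2) h[OF n(2)] r(1)] .
    have kN: "k \<in> D N"
      using kI by simp
    \<comment> \<open>The segment below \<open>k\<close> has two isomorphisms, the chosen one and
      the restricted one. Comparing them in both directions shows that their bounds are
      equivalent.\<close>
    have "lequiv M (g \<bullet> k) (h n \<bullet> k)"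
      using seg_iso_le_iff[OF iso(1)[OF Kk kN] h[OF kN] kI iso(2)[OF Kk kN] r(1) h[OF n(2)] kI r(2)]
        seg_iso_le_iff[OF r(1) h[OF n(2)] kI r(2) iso(1)[OF Kk kN] h[OF kN] kI iso(2)[OF Kk kN]] reflI[OF kI]
      by (simp add: lequiv_def)
    then have "lequiv M (g \<bullet> k) b"
      using lequiv_trans k(2) iso(2)[OF Kk kN] r(2) b by blast
    then show ?thesis
      using Kk kN by blast
  qed
  have dec_image: "dec [N] (\<lambda>xs. \<not> (\<exists>n\<in>D N. K n \<and> lequiv M (g \<bullet> n) (hd xs)))"
    by (intro dec_not dec_ex dec_and dec_K dec_lequiv rep_ap[OF rep_const[OF g(1)]] rep_vars IJ)
  \<comment> \<open>The image of \<open>g\<close> is arithmetical, hence decidable. If it misses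
    something there is a least missed \<open>b\<close>, and downward closure makes the image the
    segment below it.\<close>
  have image: "(\<forall>b\<in>fld J. \<exists>n\<in>D N. K n \<and> lequiv M (g \<bullet> n) b) \<or>
    (\<exists>b\<in>fld J. \<forall>m\<in>fld J. (\<exists>n\<in>D N. K n \<and> lequiv M (g \<bullet> n) m) \<longleftrightarrow> \<not> lq M b m)"
  proof (cases "\<forall>b\<in>fld J. \<exists>n\<in>D N. K n \<and> lequiv M (g \<bullet> n) b")
    case False
    then obtain b' where b': "b' \<in> fld J" "\<not> (\<exists>n\<in>D N. K n \<and> lequiv M (g \<bullet> n) b')" by blast
    obtain b where b: "b \<in> fld J" "\<not> (\<exists>n\<in>D N. K n \<and> lequiv M (g \<bullet> n) b)"
      "\<forall>m\<in>fld J. \<not> (\<exists>n\<in>D N. K n \<and> lequiv M (g \<bullet> n) m) \<longrightarrow> lq M b m"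
      using wo_min[OF J dec_image b'] by blast
    have "\<not> lq M b m" if m: "m \<in> fld J" and n: "n \<in> D N" "K n" "lequiv M (g \<bullet> n) m" for m n
    proof
      assume "lq M b m"
      then have "lq M b (g \<bullet> n)"
        using n(3) transJ[OF b(1) m iso(2)[OF n(2,1)]] by (simp add: lequiv_def)
      then show False
        using image_down[OF n(2,1) b(1)] b(2) by blast
    qed
    then show ?thesis
      using b by blast
  qed blast
  have embeds: "order_embeds I L J M (\<lambda>_. True) \<or> (\<exists>b\<in>fld J. order_embeds I L J M (\<lambda>m. \<not> lq M b m))"
    if all: "\<forall>n\<in>fld I. K n"
    using image
  proof (elim disjE bexE)
    assume range: "\<forall>b\<in>fld J. \<exists>n\<in>D N. K n \<and> lequiv M (g \<bullet> n) b"
    have "order_embeds I L J M (\<lambda>_. True)"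
      unfolding order_embeds_def
    proof (rule bexI[of _ g], intro conjI ballI impI)
      fix m assume "m \<in> fld J"
      then show "\<exists>n\<in>fld I. lequiv M (g \<bullet> n) m"
        using range K_I by blast
    qed (use all g(1) iso(2) g_iff in simp_all)
    then show ?thesis ..
  next
    fix b assume b: "b \<in> fld J" "\<forall>m\<in>fld J. (\<exists>n\<in>D N. K n \<and> lequiv M (g \<bullet> n) m) \<longleftrightarrow> \<not> lq M b m"
    have "order_embeds I L J M (\<lambda>m. \<not> lq M b m)"
      unfolding order_embeds_def
    proof (rule bexI[of _ g], intro conjI ballI impI)
      fix m assume "m \<in> fld J" "\<not> lq M b m"
      then show "\<exists>n\<in>fld I. lequiv M (g \<bullet> n) m"
        using b K_I by blast
    next
      fix n assume n: "n \<in> fld I"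
      then have "g \<bullet> n \<in> fld J" "lequiv M (g \<bullet> n) (g \<bullet> n)"
        using all iso(2) reflJ by (simp_all add: lequiv_def)
      then show "\<not> lq M b (g \<bullet> n)"
        using b(2) n all fld_D by blast
    qed (use all g(1) iso(2) g_iff in simp_all)
    then show ?thesis
      using b(1) by blast
  qed
  show ?thesis
  proof (cases "\<forall>n\<in>fld I. K n")
    case True
    then show ?thesis
      using embeds by blast
  next
    case False
    then obtain a' where a': "a' \<in> fld I" "\<not> K a'" by blast
    have "dec [N] (\<lambda>xs. \<not> K (hd xs))"
      by (intro dec_not dec_K rep_vars)
    from wo_min[OF I this a'] obtain a where a: "a \<in> fld I" "\<not> K a" "\<forall>k\<in>fld I. \<not> K k \<longrightarrow> lq L a k" by blast
    \<comment> \<open>As \<open>K\<close> is closed downwards and \<open>a\<close> is least outside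
      it, \<open>K\<close> is the initial segment below \<open>a\<close>.\<close>
    have K_seg: "K n \<longleftrightarrow> \<not> lq L a n" if "n \<in> fld I" for n
      using a that K_down[OF _ fld_D[OF that] a(1)] by blast
    show ?thesis
      using image
    proof (elim disjE bexE)
      assume range: "\<forall>b\<in>fld J. \<exists>n\<in>D N. K n \<and> lequiv M (g \<bullet> n) b"
      \<comment> \<open>Here \<open>g\<close> maps the segment below \<open>a\<close> onto all of
        the other order. Its inverse consists of numbers, so the selection functional
        \<open>CH\<close> provides it.\<close>
      let ?Q = "\<lambda>m n. K n \<and> lequiv M (g \<bullet> n) m"
      have Q: "dec [N] (\<lambda>xs. ?Q m (hd xs))" if "m \<in> D N" for m
        by (intro dec_and dec_K dec_lequiv rep_ap[OF rep_const[OF g(1)]] rep_vars rep_const that IJ)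
      have "\<exists>k\<in>D ty1. \<forall>m\<in>D N. k \<bullet> m = CH (?Q m)"
        by (rule rep_fun1, intro rep_CH dec_and dec_K dec_lequiv rep_ap[OF rep_const[OF g(1)]] rep_vars IJ)
      then obtain k where k: "k \<in> D ty1" "\<And>m. m \<in> D N \<Longrightarrow> k \<bullet> m = CH (?Q m)" by blast
      have kQ: "K (k \<bullet> m)" "lequiv M (g \<bullet> (k \<bullet> m)) m" "k \<bullet> m \<in> D N" if "m \<in> fld J" for m
        using CH[OF Q[OF fld_D[OF that]]] range that k by simp_all
      have "order_embeds J M I L (\<lambda>n. \<not> lq L a n)"
        unfolding order_embeds_def
      proof (rule bexI[of _ k], intro conjI ballI impI)
        fix m assume m: "m \<in> fld J"
        show "k \<bullet> m \<in> fld I"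
          using kQ[OF m] K_I by blast
        then show "\<not> lq L a (k \<bullet> m)"
          using kQ[OF m] K_seg by blast
      next
        fix m m' assume m: "m \<in> fld J" "m' \<in> fld J"
        have "lq L (k \<bullet> m) (k \<bullet> m') \<longleftrightarrow> lq M (g \<bullet> (k \<bullet> m)) (g \<bullet> (k \<bullet> m'))"
          using kQ m g_iff by blast
        also have "\<dots> \<longleftrightarrow> lq M m m'"
          using lq_cong[OF kQ(2)[OF m(1)] kQ(2)[OF m(2)]] iso(2) kQ m by blast
        finally show "lq M m m' \<longleftrightarrow> lq L (k \<bullet> m) (k \<bullet> m')" ..
      next
        fix n assume n: "n \<in> fld I" "\<not> lq L a n"
        then have Kn: "K n" "n \<in> D N"
          using K_seg by simp_all
        let ?m = "g \<bullet> n"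
        have m: "?m \<in> fld J"
          using iso(2) Kn by blast
        then have "lequiv L (k \<bullet> ?m) n"
          using kQ[OF m] g_iff[OF kQ(1)[OF m] Kn(1)] g_iff[OF Kn(1) kQ(1)[OF m]] Kn by (simp add: lequiv_def)
        then show "\<exists>m\<in>fld J. lequiv L (k \<bullet> m) n"
          using m by blast
      qed (rule k)
      then show ?thesis
        using a(1) by blast
    next
      fix b assume b: "b \<in> fld J" "\<forall>m\<in>fld J. (\<exists>n\<in>D N. K n \<and> lequiv M (g \<bullet> n) m) \<longleftrightarrow> \<not> lq M b m"
      have Kseg: "K n" "n \<in> D N" if "n \<in> seg I L a" for n
        using that K_seg by (auto simp: seg_def)
      \<comment> \<open>If both the domain and the image were proper segments, \<open>g\<close>
        itself would witness that \<open>a\<close> belongs to \<open>K\<close>.\<close>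
      have "seg_iso g a b"
        unfolding seg_iso_iff
      proof (intro conjI ballI)
        fix n assume n: "n \<in> seg I L a"
        then have "g \<bullet> n \<in> fld J" "lequiv M (g \<bullet> n) (g \<bullet> n)"
          using Kseg[OF n] iso(2) reflJ by (simp_all add: lequiv_def)
        then show "g \<bullet> n \<in> seg J M b"
          using b(2) Kseg[OF n] by (auto simp: seg_def)
      next
        fix n n' assume "n \<in> seg I L a" "n' \<in> seg I L a"
        then show "lq L n n' \<longleftrightarrow> lq M (g \<bullet> n) (g \<bullet> n')"
          using Kseg g_iff by blast
      next
        fix m assume "m \<in> seg J M b"
        then obtain n where n: "n \<in> D N" "K n" "lequiv M (g \<bullet> n) m"
          using b(2) by (auto simp: seg_def)
        then have "n \<in> seg I L a"
          using K_I K_seg by (auto simp: seg_def)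
        then show "\<exists>n\<in>seg I L a. lequiv M (g \<bullet> n) m"
          using n by blast
      qed
      then show ?thesis
        using K_intro[OF a(1) b(1) g(1)] a(2) by blast
    qed
  qed
qed

end

context aca_model
begin

section \<open>From countable well-orderings of real numbers to natural numbers and back\<close>

lemma Cwo_D:
  assumes "Cwo X R"
  shows "x \<in> In X \<Longrightarrow> y \<in> In X \<Longrightarrow> z \<in> In X \<Longrightarrow> Rel R x y \<Longrightarrow> Rel R y z \<Longrightarrow> Rel R x z"
    "x \<in> In X \<Longrightarrow> y \<in> In X \<Longrightarrow> Rel R x y \<or> Rel R y x"
proof -
  from assms have lin: "Linear X R"
    by (simp add: Cwo_def)
  have trans: "\<forall>x\<in>D ty1. \<forall>y\<in>D ty1. \<forall>z\<in>D ty1.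
      x \<in> In X \<and> y \<in> In X \<and> z \<in> In X \<longrightarrow> Rel R x y \<and> Rel R y z \<longrightarrow> Rel R x z"
    using lin unfolding Linear_def by (elim conjE)
  have total: "\<forall>x\<in>D ty1. \<forall>y\<in>D ty1. x \<in> In X \<and> y \<in> In X \<longrightarrow> Rel R x y \<or> Rel R y x"
    using lin unfolding Linear_def by (elim conjE)
  show "x \<in> In X \<Longrightarrow> y \<in> In X \<Longrightarrow> z \<in> In X \<Longrightarrow> Rel R x y \<Longrightarrow> Rel R y z \<Longrightarrow> Rel R x z"
    using trans In_D(1)[of _ X] by blast
  show "x \<in> In X \<Longrightarrow> y \<in> In X \<Longrightarrow> Rel R x y \<or> Rel R y x"
    using total In_D(1)[of _ X] by blast
qed

text \<open>The counting map \<open>Y\<close> and the choice \<open>s\<close> of representatives are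
  inverse to each other only up to equivalence in the order of the reals.\<close>

definition indexes :: "'a \<Rightarrow> 'a \<Rightarrow> 'a \<Rightarrow> 'a \<Rightarrow> 'a \<Rightarrow> 'a \<Rightarrow> bool" where
  "indexes A R I L s Y \<longleftrightarrow> wo I L \<and> s \<in> D (N \<rightarrow> ty1) \<and> Y \<in> D ty2 \<and> real_invariant Y \<and>
    (\<forall>x\<in>In A. Y \<bullet> x \<in> fld I \<and> Rel R (s \<bullet> (Y \<bullet> x)) x \<and> Rel R x (s \<bullet> (Y \<bullet> x))) \<and>
    (\<forall>n\<in>fld I. s \<bullet> n \<in> In A) \<and>
    (\<forall>n\<in>fld I. \<forall>m\<in>fld I. lq L n m \<longleftrightarrow> Rel R (s \<bullet> n) (s \<bullet> m))"

lemma indexes_exist: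
  assumes boot: "\<And>Y. Y \<in> D (ty1 \<rightarrow> N \<rightarrow> N) \<Longrightarrow> \<exists>X. boot Y X"
    and A: "A \<in> D ty2" and R: "R \<in> D (ty1 \<rightarrow> ty1 \<rightarrow> N)" and cwo: "Cwo A R"
  shows "\<exists>I L s Y. indexes A R I L s Y"
proof -
  obtain Y where Y: "Y \<in> D ty2" "real_invariant Y"
    "\<forall>x\<in>D ty1. \<forall>y\<in>D ty1. x \<in> In A \<and> y \<in> In A \<longrightarrow> Y \<bullet> x = Y \<bullet> y \<longrightarrow> Rel R x y \<and> Rel R y x"
    using cwo unfolding Cwo_def by blast
  let ?P = "\<lambda>f n. f \<in> In A \<and> Y \<bullet> f = n"
  have decP: "dec [ty1, N] (\<lambda>xs. ?P (hd xs) (hd (tl xs)))"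
    by (intro dec_and dec_In dec_eq rep_ap[OF rep_const[OF Y(1)]] rep_vars A)
  obtain F where F: "F \<in> D (ty1 \<rightarrow> N \<rightarrow> N)" "\<And>f n. f \<in> D ty1 \<Longrightarrow> n \<in> D N \<Longrightarrow>
      F \<bullet> f \<bullet> n = (if ?P f n then zero else succ \<bullet> zero)"
    using rep_fun2[of ty1 N N "\<lambda>f n. if ?P f n then zero else succ \<bullet> zero"] decP unfolding dec_def by blast
  obtain X where X: "boot F X"
    using boot[OF F(1)] by blast
  have XD: "X \<in> D ty1"
    using X by (simp add: boot_def)
  have X_iff: "X \<bullet> n = succ \<bullet> zero \<longleftrightarrow> (\<exists>f\<in>D ty1. ?P f n)" if "n \<in> D N" for n
    using X F(2) that by (auto simp: boot_def)
  \<comment> \<open>The values are switched, since BOOT marks members by one and \<open>fld\<close>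
    by zero.\<close>
  have "\<exists>I\<in>D ty1. \<forall>n\<in>D N. I \<bullet> n = (if X \<bullet> n = succ \<bullet> zero then zero else succ \<bullet> zero)"
    by (rule rep_fun1, intro rep_if dec_eq rep_ap[OF rep_const[OF XD]] rep_vars rep_succ rep_zero)
  then obtain I where I: "I \<in> D ty1" "\<And>n. n \<in> D N \<Longrightarrow> I \<bullet> n = (if X \<bullet> n = succ \<bullet> zero then zero else succ \<bullet> zero)"
    by blast
  have I_iff: "I \<bullet> n = zero \<longleftrightarrow> X \<bullet> n = succ \<bullet> zero" if "n \<in> D N" for n
    using that by (simp add: I(2))
  have fld: "n \<in> fld I \<longleftrightarrow> (\<exists>f\<in>In A. Y \<bullet> f = n)" for n
  proof
    assume "n \<in> fld I"
    then show "\<exists>f\<in>In A. Y \<bullet> f = n"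
      using I_iff[of n] X_iff[of n] unfolding fld_def by blast
  next
    assume "\<exists>f\<in>In A. Y \<bullet> f = n"
    then obtain f where f: "f \<in> In A" "f \<in> D ty1" "Y \<bullet> f = n"
      using In_D(1) by blast
    then have "n \<in> D N"
      using Y(1) by auto
    then show "n \<in> fld I"
      using I_iff X_iff f unfolding fld_def by blast
  qed
  have "\<exists>s\<in>D (N \<rightarrow> ty1). \<forall>n\<in>D N. I \<bullet> n = zero \<longrightarrow> ?P (s \<bullet> n) n"
  proof (rule choice_sequence[of "\<lambda>f n. I \<bullet> n = zero \<longrightarrow> ?P f n"])
    show "dec [ty1, N] (\<lambda>xs. I \<bullet> hd (tl xs) = zero \<longrightarrow> ?P (hd xs) (hd (tl xs)))"
      by (intro dec_imp dec_eq decP rep_ap[OF rep_const[OF I(1)]] rep_zero rep_vars)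
    show "\<exists>f\<in>D ty1. I \<bullet> n = zero \<longrightarrow> ?P f n" if "n \<in> D N" for n
      using X_iff[OF that] I_iff[OF that] XD by blast
  qed
  then obtain s where s: "s \<in> D (N \<rightarrow> ty1)" "\<And>n. n \<in> fld I \<Longrightarrow> s \<bullet> n \<in> In A \<and> Y \<bullet> (s \<bullet> n) = n"
    unfolding fld_def by blast
  have "rep [N, N] N (\<lambda>xs. if R \<bullet> (s \<bullet> hd xs) \<bullet> (s \<bullet> hd (tl xs)) = succ \<bullet> zero then zero else succ \<bullet> zero)"
    by (rule rep_if dec_eq rep_succ rep_zero rep_ap rep_const R s(1) rep_vars)+
  from rep_fun2[OF this] obtain L where L: "L \<in> D (N \<rightarrow> ty1)" "\<And>n m. n \<in> D N \<Longrightarrow> m \<in> D N \<Longrightarrow>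
      L \<bullet> n \<bullet> m = (if R \<bullet> (s \<bullet> n) \<bullet> (s \<bullet> m) = succ \<bullet> zero then zero else succ \<bullet> zero)" by blast
  have lq: "lq L n m \<longleftrightarrow> Rel R (s \<bullet> n) (s \<bullet> m)" if "n \<in> D N" "m \<in> D N" for n m
    using L(2)[OF that] by (simp add: lq_def Rel_def)
  have "wo I L"
    unfolding wo_def
  proof (intro conjI ballI impI notI)
    fix n m assume "n \<in> fld I" "m \<in> fld I"
    then show "lq L n m \<or> lq L m n"
      using s(2) Cwo_D(2)[OF cwo] by (simp add: lq)
  next
    fix n m k assume *: "n \<in> fld I" "m \<in> fld I" "k \<in> fld I" "lq L n m" "lq L m k"
    then have "Rel R (s \<bullet> n) (s \<bullet> m)" "Rel R (s \<bullet> m) (s \<bullet> k)"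
      by (simp_all add: lq)
    then have "Rel R (s \<bullet> n) (s \<bullet> k)"
      using * s(2) Cwo_D(1)[OF cwo] by blast
    then show "lq L n k"
      using * by (simp add: lq)
  next
    assume "\<exists>f\<in>D ty1. \<forall>n\<in>D N. f \<bullet> n \<in> fld I \<and> \<not> lq L (f \<bullet> n) (f \<bullet> (succ \<bullet> n))"
    then obtain f where f: "f \<in> D ty1" "\<And>n. n \<in> D N \<Longrightarrow> f \<bullet> n \<in> fld I \<and> \<not> lq L (f \<bullet> n) (f \<bullet> (succ \<bullet> n))" by blast
    \<comment> \<open>A descending sequence of indices is mapped by \<open>s\<close> to a descending
      sequence of reals.\<close>
    have "\<exists>t\<in>D (N \<rightarrow> ty1). \<forall>n\<in>D N. t \<bullet> n = s \<bullet> (f \<bullet> n)"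
      by (rule rep_fun1) (rule rep_ap rep_const s(1) f(1) rep_vars)+
    then obtain t where t: "t \<in> D (N \<rightarrow> ty1)" "\<And>n. n \<in> D N \<Longrightarrow> t \<bullet> n = s \<bullet> (f \<bullet> n)" by blast
    have "t \<bullet> n \<in> In A \<and> Rel R (t \<bullet> (succ \<bullet> n)) (t \<bullet> n) \<and>
        \<not> (Rel R (t \<bullet> (succ \<bullet> n)) (t \<bullet> n) \<and> Rel R (t \<bullet> n) (t \<bullet> (succ \<bullet> n)))" if n: "n \<in> D N" for n
    proof -
      have "t \<bullet> n \<in> In A" "t \<bullet> (succ \<bullet> n) \<in> In A" "\<not> Rel R (t \<bullet> n) (t \<bullet> (succ \<bullet> n))"
        using f n s(2) by (simp_all add: t(2) lq)
      then show ?thesis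
        using Cwo_D(2)[OF cwo] by blast
    qed
    then show False
      using t(1) cwo unfolding Cwo_def by blast
  qed (rule I L)+
  moreover have "Y \<bullet> x \<in> fld I \<and> Rel R (s \<bullet> (Y \<bullet> x)) x \<and> Rel R x (s \<bullet> (Y \<bullet> x))" if x: "x \<in> In A" for x
  proof -
    have n: "Y \<bullet> x \<in> fld I"
      using x fld by blast
    then have "s \<bullet> (Y \<bullet> x) \<in> In A" "Y \<bullet> (s \<bullet> (Y \<bullet> x)) = Y \<bullet> x"
      using s(2) by blast+
    then show ?thesis
      using n x Y(3) In_D(1) by blast
  qed
  ultimately have "indexes A R I L s Y"
    unfolding indexes_def using s Y(1,2) lq by simp
  then show ?thesis by blast
qed

text \<open>The isomorphism takes the index of a real, translates it by \<open>k\<close> and returns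
  the chosen representative. Equal reals have the same index and hence literally the same image. The
  set \<open>W\<close> and the predicate \<open>Q\<close> stay abstract so as to cover the whole
  order and its initial segments.\<close>

lemma Iso_of_order_embeds:
  assumes A: "Cwo A R" "indexes A R I L sA YA" and B: "Cwo B S" "indexes B S J M sB YB"
    and emb: "order_embeds I L J M Q"
    and W: "\<And>m. m \<in> fld J \<Longrightarrow> Q m \<Longrightarrow> sB \<bullet> m \<in> W" "\<And>w. w \<in> W \<Longrightarrow> w \<in> In B \<and> Q (YB \<bullet> w)"
  shows "Iso (In A) R W S"
proof -
  have a: "sA \<in> D (N \<rightarrow> ty1)" "YA \<in> D ty2" "real_invariant YA" 
    "\<And>x. x \<in> In A \<Longrightarrow> YA \<bullet> x \<in> fld I" "\<And>x. x \<in> In A \<Longrightarrow> Rel R (sA \<bullet> (YA \<bullet> x)) x"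
    "\<And>x. x \<in> In A \<Longrightarrow> Rel R x (sA \<bullet> (YA \<bullet> x))" "\<And>n. n \<in> fld I \<Longrightarrow> sA \<bullet> n \<in> In A"
    "\<And>n m. n \<in> fld I \<Longrightarrow> m \<in> fld I \<Longrightarrow> lq L n m \<longleftrightarrow> Rel R (sA \<bullet> n) (sA \<bullet> m)"
    using A(2) unfolding indexes_def by blast+
  have b: "sB \<in> D (N \<rightarrow> ty1)" "\<And>x. x \<in> In B \<Longrightarrow> YB \<bullet> x \<in> fld J"
    "\<And>x. x \<in> In B \<Longrightarrow> Rel S (sB \<bullet> (YB \<bullet> x)) x" "\<And>x. x \<in> In B \<Longrightarrow> Rel S x (sB \<bullet> (YB \<bullet> x))"
    "\<And>n. n \<in> fld J \<Longrightarrow> sB \<bullet> n \<in> In B"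
    "\<And>n m. n \<in> fld J \<Longrightarrow> m \<in> fld J \<Longrightarrow> lq M n m \<longleftrightarrow> Rel S (sB \<bullet> n) (sB \<bullet> m)"
    using B(2) unfolding indexes_def by blast+
  obtain k where k: "k \<in> D ty1" "\<And>n. n \<in> fld I \<Longrightarrow> k \<bullet> n \<in> fld J \<and> Q (k \<bullet> n)"
    "\<And>n n'. n \<in> fld I \<Longrightarrow> n' \<in> fld I \<Longrightarrow> lq L n n' \<longleftrightarrow> lq M (k \<bullet> n) (k \<bullet> n')"
    "\<And>m. m \<in> fld J \<Longrightarrow> Q m \<Longrightarrow> \<exists>n\<in>fld I. lequiv M (k \<bullet> n) m"
    using emb unfolding order_embeds_def by blast
  have "\<exists>Z\<in>D (ty1 \<rightarrow> ty1). \<forall>x\<in>D ty1. Z \<bullet> x = sB \<bullet> (k \<bullet> (YA \<bullet> x))"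
    by (rule rep_fun1) (rule rep_ap rep_const b(1) k(1) a(2) rep_vars)+
  then obtain Z where Z: "Z \<in> D (ty1 \<rightarrow> ty1)" "\<And>x. x \<in> D ty1 \<Longrightarrow> Z \<bullet> x = sB \<bullet> (k \<bullet> (YA \<bullet> x))" by blast
  show ?thesis
    unfolding Iso_def
  proof (rule bexI[of _ Z], intro conjI ballI impI)
    fix x assume x: "x \<in> D ty1" "x \<in> In A"
    then show "Z \<bullet> x \<in> W"
      using a(4) k(2) W(1) by (simp add: Z)
  next
    fix x x' assume x: "x \<in> D ty1" "x' \<in> D ty1" "x \<in> In A \<and> x' \<in> In A" "eq_re x x'"
    then have "YA \<bullet> x = YA \<bullet> x'"
      using a(3) In_D unfolding real_invariant_def by blast
    then have "Z \<bullet> x' = Z \<bullet> x"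
      using x by (simp add: Z(2))
    moreover have "Z \<bullet> x \<in> D ty1"
      using Z(1) x(1) by auto
    ultimately show "eq_re (Z \<bullet> x) (Z \<bullet> x')"
      by (simp add: eq_re_refl)
  next
    fix w assume "w \<in> D ty1" "w \<in> W"
    then have w: "w \<in> In B" "Q (YB \<bullet> w)" "YB \<bullet> w \<in> fld J"
      using W(2) b(2) by blast+
    then obtain n where n: "n \<in> fld I" "lequiv M (k \<bullet> n) (YB \<bullet> w)"
      using k(4) by blast
    \<comment> \<open>The preimage of \<open>w\<close> is a representative of the index
      \<open>n\<close>. Its own index is used only up to equivalence with \<open>n\<close>, which
      \<open>k\<close> respects.\<close>
    let ?x = "sA \<bullet> n"
    have x: "?x \<in> In A" "YA \<bullet> ?x \<in> fld I" "?x \<in> D ty1"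
      using a(4,7) n In_D by blast+
    have "lq L (YA \<bullet> ?x) n" "lq L n (YA \<bullet> ?x)"
      using a(5,6)[OF x(1)] a(8) x n by simp_all
    then have "lq M (k \<bullet> (YA \<bullet> ?x)) (k \<bullet> n)" "lq M (k \<bullet> n) (k \<bullet> (YA \<bullet> ?x))"
      using k(3) x n by blast+
    then have "Rel S (Z \<bullet> ?x) (sB \<bullet> (k \<bullet> n))" "Rel S (sB \<bullet> (k \<bullet> n)) (Z \<bullet> ?x)"
      unfolding Z(2)[OF x(3)] using b(6) k(2) x(2) n(1) by blast+
    moreover have "Rel S (sB \<bullet> (k \<bullet> n)) (sB \<bullet> (YB \<bullet> w))" "Rel S (sB \<bullet> (YB \<bullet> w)) (sB \<bullet> (k \<bullet> n))"
      using n(2) b(6) k(2)[OF n(1)] w(3) unfolding lequiv_def by blast+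
    moreover have "Z \<bullet> ?x \<in> In B" "sB \<bullet> (k \<bullet> n) \<in> In B" "sB \<bullet> (YB \<bullet> w) \<in> In B"
      unfolding Z(2)[OF x(3)] using b(5) k(2) x(2) n(1) w(3) by blast+
    ultimately have "Rel S (Z \<bullet> ?x) (sB \<bullet> (YB \<bullet> w))" "Rel S (sB \<bullet> (YB \<bullet> w)) (Z \<bullet> ?x)"
      "Z \<bullet> ?x \<in> In B" "sB \<bullet> (YB \<bullet> w) \<in> In B"
      using Cwo_D(1)[OF B(1), of "Z \<bullet> ?x" "sB \<bullet> (k \<bullet> n)" "sB \<bullet> (YB \<bullet> w)"]
        Cwo_D(1)[OF B(1), of "sB \<bullet> (YB \<bullet> w)" "sB \<bullet> (k \<bullet> n)" "Z \<bullet> ?x"] by blast+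
    then have "Rel S (Z \<bullet> ?x) w" "Rel S w (Z \<bullet> ?x)"
      using Cwo_D(1)[OF B(1), of "Z \<bullet> ?x" "sB \<bullet> (YB \<bullet> w)" w]
        Cwo_D(1)[OF B(1), of w "sB \<bullet> (YB \<bullet> w)" "Z \<bullet> ?x"] b(3,4)[OF w(1)] w(1) by blast+
    then show "\<exists>x\<in>D ty1. x \<in> In A \<and> Rel S (Z \<bullet> x) w \<and> Rel S w (Z \<bullet> x)"
      using x by blast
  next
    fix x x' assume x: "x \<in> D ty1" "x' \<in> D ty1" "x \<in> In A \<and> x' \<in> In A"
    have n: "YA \<bullet> x \<in> fld I" "YA \<bullet> x' \<in> fld I"
      using a(4) x by blast+
    \<comment> \<open>Each element is equivalent to the representative of its index, so transitivity
      allows the replacement on both sides.\<close>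
    have "Rel R x x' \<longleftrightarrow> Rel R (sA \<bullet> (YA \<bullet> x)) (sA \<bullet> (YA \<bullet> x'))"
    proof
      assume "Rel R x x'"
      then have "Rel R (sA \<bullet> (YA \<bullet> x)) x'"
        using Cwo_D(1)[OF A(1) a(7)[OF n(1)], of x x'] a(5) x by blast
      then show "Rel R (sA \<bullet> (YA \<bullet> x)) (sA \<bullet> (YA \<bullet> x'))"
        using Cwo_D(1)[OF A(1) a(7)[OF n(1)] _ a(7)[OF n(2)], of x'] a(6) x by blast
    next
      assume "Rel R (sA \<bullet> (YA \<bullet> x)) (sA \<bullet> (YA \<bullet> x'))"
      then have "Rel R x (sA \<bullet> (YA \<bullet> x'))"
        using Cwo_D(1)[OF A(1) _ a(7)[OF n(1)] a(7)[OF n(2)], of x] a(6) x by blast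
      then show "Rel R x x'"
        using Cwo_D(1)[OF A(1) _ a(7)[OF n(2)], of x x'] a(5) x by blast
    qed
    also have "\<dots> \<longleftrightarrow> Rel S (sB \<bullet> (k \<bullet> (YA \<bullet> x))) (sB \<bullet> (k \<bullet> (YA \<bullet> x')))"
      using a(8)[OF n] k(3)[OF n] k(2) n b(6) by blast
    finally show "Rel R x x' \<longleftrightarrow> Rel S (Z \<bullet> x) (Z \<bullet> x')"
      using x by (simp add: Z)
  qed (rule Z)
qed

text \<open>A bound \<open>c\<close> among the indices corresponds to the bound \<open>sB c\<close>
  among the reals.\<close>

lemma Embeds_of_order_embeds:
  assumes A: "Cwo A R" "indexes A R I L sA YA" and B: "Cwo B S" "indexes B S J M sB YB"
    and emb: "order_embeds I L J M (\<lambda>_. True) \<or> (\<exists>b\<in>fld J. order_embeds I L J M (\<lambda>m. \<not> lq M b m))"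
  shows "Embeds A R B S"
  using emb
proof (elim disjE bexE)
  have b: "\<And>n. n \<in> fld J \<Longrightarrow> sB \<bullet> n \<in> In B"
    using B(2) unfolding indexes_def by blast
  assume "order_embeds I L J M (\<lambda>_. True)"
  then have "Iso (In A) R (In B) S"
    using b by (intro Iso_of_order_embeds[OF A B]) simp_all
  then show ?thesis
    by (simp add: Embeds_def)
next
  have b: "\<And>x. x \<in> In B \<Longrightarrow> YB \<bullet> x \<in> fld J"
    "\<And>x. x \<in> In B \<Longrightarrow> Rel S (sB \<bullet> (YB \<bullet> x)) x" "\<And>x. x \<in> In B \<Longrightarrow> Rel S x (sB \<bullet> (YB \<bullet> x))"
    "\<And>n. n \<in> fld J \<Longrightarrow> sB \<bullet> n \<in> In B"
    "\<And>n m. n \<in> fld J \<Longrightarrow> m \<in> fld J \<Longrightarrow> lq M n m \<longleftrightarrow> Rel S (sB \<bullet> n) (sB \<bullet> m)"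
    using B(2) unfolding indexes_def by blast+
  fix c assume c: "c \<in> fld J" and emb: "order_embeds I L J M (\<lambda>m. \<not> lq M c m)"
  have sc: "sB \<bullet> c \<in> In B"
    using b(4) c .
  have "Iso (In A) R (Initial B S (sB \<bullet> c)) S"
  proof (rule Iso_of_order_embeds[OF A B emb])
    fix m assume m: "m \<in> fld J" "\<not> lq M c m"
    then have "\<not> Rel S (sB \<bullet> c) (sB \<bullet> m)" "sB \<bullet> m \<in> In B"
      using b(4,5) c by blast+
    then show "sB \<bullet> m \<in> Initial B S (sB \<bullet> c)"
      using Cwo_D(2)[OF B(1) _ sc] by (auto simp: Initial_def)
  next
    fix w assume "w \<in> Initial B S (sB \<bullet> c)"
    then have w: "w \<in> In B" "\<not> Rel S (sB \<bullet> c) w"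
      by (auto simp: Initial_def)
    \<comment> \<open>Since \<open>w\<close> is equivalent to the representative of its index, lying
      below \<open>sB c\<close> can be tested on the index.\<close>
    have "\<not> Rel S (sB \<bullet> c) (sB \<bullet> (YB \<bullet> w))"
      using Cwo_D(1)[OF B(1) sc b(4)[OF b(1)[OF w(1)]] w(1)] b(2)[OF w(1)] w(2) by blast
    then show "w \<in> In B \<and> \<not> lq M c (YB \<bullet> w)"
      using w(1) b(1,5) c by blast
  qed
  then show ?thesis
    using sc In_D(1) unfolding Embeds_def by blast
qed

lemma boot_imp_comparability:
  assumes boot: "\<And>Y. Y \<in> D (ty1 \<rightarrow> N \<rightarrow> N) \<Longrightarrow> \<exists>X. boot Y X"
    and A: "A \<in> D ty2" "R \<in> D (ty1 \<rightarrow> ty1 \<rightarrow> N)" "Cwo A R"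
    and B: "B \<in> D ty2" "S \<in> D (ty1 \<rightarrow> ty1 \<rightarrow> N)" "Cwo B S"
  shows "Embeds A R B S \<or> Embeds B S A R"
proof -
  obtain I L sA YA where a: "indexes A R I L sA YA"
    using indexes_exist[OF boot A] by blast
  obtain J M sB YB where b: "indexes B S J M sB YB"
    using indexes_exist[OF boot B] by blast
  interpret order_pair D ap zero succ recursor combK combS T e0 I L J M
    by unfold_locales (use a b in \<open>auto simp: indexes_def\<close>)
  show ?thesis
    using comparison[OF boot] Embeds_of_order_embeds[OF A(3) a B(3) b]
      Embeds_of_order_embeds[OF B(3) b A(3) a] by blast
qed

lemma boot_iff_comparability: "sat e (BOOT \<^bold>\<longleftrightarrow> cwo_comparability)"
proof -
  have "sat e BOOT \<longleftrightarrow> (\<forall>Y\<in>D (ty1 \<rightarrow> N \<rightarrow> N). \<exists>X. boot Y X)"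
    unfolding sat_BOOT boot_def by blast
  moreover have "sat e cwo_comparability \<longleftrightarrow> (\<forall>Y\<in>D (ty1 \<rightarrow> N \<rightarrow> N). \<exists>X. boot Y X)"
    unfolding sat_cwo_comparability using comparability_imp_boot boot_imp_comparability by blast
  ultimately show ?thesis by simp
qed

end

theorem theorem2p7:
  "proves (ACA0\<omega> \<union> QF_AC_0_1 \<union> {Sigma_IND}) {} (BOOT \<^bold>\<longleftrightarrow> cwo_comparability)"
proof (rule ccontr)
  let ?T = "ACA0\<omega> \<union> QF_AC_0_1 \<union> {Sigma_IND}"
  assume "\<not> ?thesis"
  moreover have "RCA0\<omega> \<subseteq> ?T" "\<forall>\<phi>\<in>?T. wf_fm \<phi>" "wf_fm (BOOT \<^bold>\<longleftrightarrow> cwo_comparability)"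
    using wf_RCA0\<omega> wf_exists2 wf_QF_AC_0_1 wf_Sigma_IND wf_BOOT wf_cwo_comparability
    by (auto simp: ACA0\<omega>_def)
  ultimately obtain D ap zero succ recursor combK combS and e :: "ty \<Rightarrow> nat \<Rightarrow> tm set"
    where m: "model D ap zero succ recursor combK combS ?T e"
      and false: "\<not> type_structure.sat D ap zero succ recursor combK combS (=) e (BOOT \<^bold>\<longleftrightarrow> cwo_comparability)"
    by (elim completeness)
  interpret model D ap zero succ recursor combK combS ?T e
    by (rule m)
  interpret aca_model D ap zero succ recursor combK combS ?T e
    by unfold_locales (auto simp: ACA0\<omega>_def)
  show False
    using false boot_iff_comparability by blast
qed

end
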